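(* Let $n\ge 1$, $\lambda>n$, let $H$ be a closed subgroup of $G=\mathrm{SU}(n,1)$, and let $\widetilde H$ be its inverse image in the universal covering group $\widetilde G$. Suppose that for some $z_0\in\mathbb{B}^n$ the orbit $M=H\cdot z_0$ is restriction injective and that the function $D_\lambda:h\mapsto j_\lambda(h,z_0)$ on $\widetilde H$ lies in $L^2_{\chi_\lambda}(M,\mu)$. Let $\varphi\in L^\infty(\mathbb{B}^n)$ be an $H$-invariant symbol, i.e. $\varphi(h^{-1}\cdot z)=\varphi(z)$ for all $h\in H$. Then the operator $R\,T^{(\lambda)}_\varphi R^*:\mathcal{B}_\lambda\to\mathcal{B}_\lambda$ is given by $$R\,T^{(\lambda)}_\varphi R^* f=f*\nu_\varphi,\qquad\text{i.e.}\qquad (R\,T^{(\lambda)}_\varphi R^* f)(h)=\int_{\widetilde H/\widetilde H_{z_0}} f(k)\,\nu_\varphi(k^{-1}h)\,d\mu(k)\quad(h\in\widetilde H),$$ for all $f\in L^2_{\chi_\lambda}(M,\mu)$, where $$\nu_\varphi(h)=j_\lambda(h,z_0)\,\langle\varphi K_{z_0},K_{h\cdot z_0}\rangle_{L^2(\mathbb{B}^n,\mu_\lambda)}=j_\lambda(h,z_0)\int_{\mathbb{B}^n}\varphi(z)K_{z_0}(z)\overline{K_{h\cdot z_0}(z)}\,d\mu_\lambda(z).$$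
   Context: $\mathbb{B}^n=\{z\in\mathbb{C}^n: |z|<1\}$. $G=\mathrm{SU}(n,1)$ is the group of determinant-one complex $(n+1)\times(n+1)$ matrices preserving $-z_1\bar w_1-\dots-z_n\bar w_n+z_{n+1}\bar w_{n+1}$. Write $g\in G$ in blocks $\begin{pmatrix}a&v\\ w^t&d\end{pmatrix}$ with $a\in M_n(\mathbb{C})$, $v,w\in\mathbb{C}^n$, $d\in\mathbb{C}$; $G$ acts on $\mathbb{B}^n$ by $g\cdot z=(az+v)/(w^tz+d)$, and $\widetilde G$ acts through the covering map $\widetilde G\to G$. The cocycle $j_\lambda:\widetilde G\times\mathbb{B}^n\to\mathbb{C}$ is the continuous lift of $(g,z)\mapsto(w^tz+d)^{-\lambda}$ normalized by $j_\lambda(e,z)=1$; it satisfies $j_\lambda(gh,z)=j_\lambda(g,h\cdot z)j_\lambda(h,z)$. For $\lambda>n$: $d\mu_\lambda(z)=c_\lambda(1-|z|^2)^{\lambda-n-1}dv(z)$, where $dv$ is normalized Lebesgue measure on $\mathbb{B}^n$ and $c_\lambda$ makes $\mu_\lambda$ a probability measure. $\mathcal{H}^2_\lambda(\mathbb{B}^n)$ is the closed subspace of holomorphic functions in $L^2(\mathbb{B}^n,\mu_\lambda)$. Its reproducing kernel is $K_w(z)=K_\lambda(z,w)=(1-z^t\bar w)^{-\lambda}$. The Toeplitz operator with symbol $\varphi\in L^\infty(\mathbb{B}^n)$ is $T^{(\lambda)}_\varphi f=P_\lambda(\varphi f)$ on $\mathcal{H}^2_\lambda(\mathbb{B}^n)$,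 with $P_\lambda$ the orthogonal projection of $L^2(\mathbb{B}^n,\mu_\lambda)$ onto $\mathcal{H}^2_\lambda(\mathbb{B}^n)$. A submanifold $M\subset\mathbb{B}^n$ is restriction injective if $f\mapsto f|_M$ is injective on holomorphic functions $f:\mathbb{B}^n\to\mathbb{C}$. For $M=H\cdot z_0=\widetilde H\cdot z_0\cong\widetilde H/\widetilde H_{z_0}$ (with $\widetilde H_{z_0}$ the stabilizer of $z_0$), $\mu$ denotes a fixed nonzero $\widetilde H$-invariant Radon measure on $M$. The map $\chi_\lambda(k)=j_\lambda(k,z_0)^{-1}$ is a unitary character of $\widetilde H_{z_0}$. $L^2_{\chi_\lambda}(M,\mu)$ is the Hilbert space of measurable $f:\widetilde H\to\mathbb{C}$ with $f(hk)=\chi_\lambda(k)^{-1}f(h)$ for $h\in\widetilde H$, $k\in\widetilde H_{z_0}$, and $\int_{\widetilde H/\widetilde H_{z_0}}|f|^2d\mu<\infty$; integrals over $\widetilde H/\widetilde H_{z_0}$ of right $\widetilde H_{z_0}$-invariant functions on $\widetilde H$ are taken with respect to $\mu$. The restriction operator is $(Rf)(h)=j_\lambda(h,z_0)f(h\cdot z_0)$, $f\in\mathcal{H}^2_\lambda(\mathbb{B}^n)$, $h\in\widetilde H$, regarded as a closed, densely defined operator into $L^2_{\chi_\lambda}(M,\mu)$. $\mathcal{B}_\lambda$ is the closure of its range, and $R^*$ is its Hilbert-space adjoint (which vanishes on $\mathcal{B}_\lambda^\perp$). *)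

theory Defs
  imports "HOL-Analysis.Analysis" "HOL-Algebra.Group"
begin

section \<open>The group SU(n,1) and its action on the unit ball\<close>

text \<open>
  Vectors of the (n+1)-dimensional space are indexed by \<open>'n option\<close>: the indices \<open>Some i\<close>
  are the first n coordinates, \<open>None\<close> is the last one. Thus the blocks a, v, w, d of a matrix
  are \<open>g $ Some i $ Some k\<close>, \<open>g $ Some i $ None\<close>, \<open>g $ None $ Some k\<close>, \<open>g $ None $ None\<close>.
\<close>

definition herm_form :: "complex ^ ('n::finite) option \<Rightarrow> complex ^ 'n option \<Rightarrow> complex" where
  "herm_form z w = - (\<Sum>i\<in>UNIV. z $ Some i * cnj (w $ Some i)) + z $ None * cnj (w $ None)"

definition SU_n1 :: "(complex ^ ('n::finite) option ^ 'n option) monoid" where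
  "SU_n1 = \<lparr> carrier = {g. det g = 1 \<and> (\<forall>z w. herm_form (g *v z) (g *v w) = herm_form z w)},
            monoid.mult = (**), one = mat 1 \<rparr>"

definition denom :: "complex ^ ('n::finite) option ^ 'n option \<Rightarrow> complex ^ 'n \<Rightarrow> complex" where
  "denom g z = (\<Sum>k\<in>UNIV. g $ None $ Some k * z $ k) + g $ None $ None"

definition act :: "complex ^ ('n::finite) option ^ 'n option \<Rightarrow> complex ^ 'n \<Rightarrow> complex ^ 'n" where
  "act g z = (\<chi> i. ((\<Sum>k\<in>UNIV. g $ Some i $ Some k * z $ k) + g $ Some i $ None) / denom g z)"


section \<open>Universal covering group and cocycle\<close>

definition topological_group :: "'g::topological_space monoid \<Rightarrow> bool" where
  "topological_group G \<longleftrightarrow> group G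
     \<and> continuous_on (carrier G \<times> carrier G) (\<lambda>(x, y). x \<otimes>\<^bsub>G\<^esub> y)
     \<and> continuous_on (carrier G) (\<lambda>x. inv\<^bsub>G\<^esub> x)"

definition universal_covering_group ::
  "'a::topological_space monoid \<Rightarrow> 'g::topological_space monoid \<Rightarrow> ('g \<Rightarrow> 'a) \<Rightarrow> bool" where
  "universal_covering_group G Gt p \<longleftrightarrow> topological_group Gt \<and> simply_connected (carrier Gt)
     \<and> p \<in> hom Gt G \<and> covering_space (carrier Gt) p (carrier G)"

text \<open>
  \<open>j\<close> is the continuous lift of the multivalued function \<open>(denom g z)\<close> to the power \<open>-s\<close>:
  it is \<open>exp (- s * L)\<close> for a continuous branch \<open>L\<close> of the logarithm of the denominator.
  Since the group and the ball are connected, the normalization determines \<open>j\<close>.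
\<close>

definition is_cocycle ::
  "real \<Rightarrow> 'g::topological_space monoid \<Rightarrow> ('g \<Rightarrow> complex ^ ('n::finite) option ^ 'n option) \<Rightarrow>
   ('g \<Rightarrow> complex ^ 'n \<Rightarrow> complex) \<Rightarrow> bool" where
  "is_cocycle s Gt p j \<longleftrightarrow>
     (\<exists>L. continuous_on (carrier Gt \<times> ball 0 1) L \<and>
          (\<forall>g\<in>carrier Gt. \<forall>z\<in>ball 0 1.
             exp (L (g, z)) = denom (p g) z \<and> j g z = exp (- of_real s * L (g, z)))) \<and>
     (\<forall>z\<in>ball 0 1. j \<one>\<^bsub>Gt\<^esub> z = 1)"


section \<open>Weighted Bergman spaces and Toeplitz operators\<close>

definition holomorphic_n_on :: "(complex ^ ('n::finite) \<Rightarrow> complex) \<Rightarrow> (complex ^ 'n) set \<Rightarrow> bool" where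
  "holomorphic_n_on f S \<longleftrightarrow>
     (\<forall>z\<in>S. \<exists>f'. (f has_derivative f') (at z) \<and> (\<forall>c v. f' (c *s v) = c * f' v))"

definition restriction_injective :: "(complex ^ ('n::finite)) set \<Rightarrow> bool" where
  "restriction_injective M \<longleftrightarrow>
     (\<forall>f g. holomorphic_n_on f (ball 0 1) \<and> holomorphic_n_on g (ball 0 1) \<and> (\<forall>z\<in>M. f z = g z)
        \<longrightarrow> (\<forall>z\<in>ball 0 1. f z = g z))"

definition bergman_weight :: "real \<Rightarrow> complex ^ ('n::finite) \<Rightarrow> real" where
  "bergman_weight s z = (1 - (norm z)\<^sup>2) powr (s - real CARD('n) - 1)"

text \<open>A probability measure on the whole space that is concentrated on the unit ball.\<close>

definition bergman_measure :: "real \<Rightarrow> (complex ^ ('n::finite)) measure" where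
  "bergman_measure s =
     (let v = uniform_measure lebesgue (ball 0 1)
      in density v (\<lambda>z. ennreal (bergman_weight s z / (LINT u|v. bergman_weight s u))))"

definition square_integrable :: "'a measure \<Rightarrow> ('a \<Rightarrow> complex) \<Rightarrow> bool" where
  "square_integrable M f \<longleftrightarrow> f \<in> borel_measurable M \<and> integrable M (\<lambda>x. (norm (f x))\<^sup>2)"

definition l2_inner :: "'a measure \<Rightarrow> ('a \<Rightarrow> complex) \<Rightarrow> ('a \<Rightarrow> complex) \<Rightarrow> complex" where
  "l2_inner M f g = (LINT x|M. f x * cnj (g x))"

definition essentially_bounded :: "'a measure \<Rightarrow> ('a \<Rightarrow> complex) \<Rightarrow> bool" where
  "essentially_bounded M f \<longleftrightarrow> f \<in> borel_measurable M \<and> (\<exists>C. AE x in M. norm (f x) \<le> C)"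

text \<open>
  A function on the ball is represented by its extension by 0, so that the elements of the
  Bergman space are determined by their almost-everywhere classes.
\<close>

definition bergman_space :: "real \<Rightarrow> (complex ^ ('n::finite) \<Rightarrow> complex) set" where
  "bergman_space s = {f. holomorphic_n_on f (ball 0 1) \<and> square_integrable (bergman_measure s) f
                          \<and> (\<forall>z. z \<notin> ball 0 1 \<longrightarrow> f z = 0)}"

definition bergman_proj ::
  "real \<Rightarrow> (complex ^ ('n::finite) \<Rightarrow> complex) \<Rightarrow> complex ^ 'n \<Rightarrow> complex" where
  "bergman_proj s f = (THE g. g \<in> bergman_space s \<and>
     (\<forall>u\<in>bergman_space s. l2_inner (bergman_measure s) (\<lambda>z. f z - g z) u = 0))"

definition toeplitz ::
  "real \<Rightarrow> (complex ^ ('n::finite) \<Rightarrow> complex) \<Rightarrow> (complex ^ 'n \<Rightarrow> complex) \<Rightarrow> complex ^ 'n \<Rightarrow> complex" where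
  "toeplitz s \<phi> f = bergman_proj s (\<lambda>z. \<phi> z * f z)"

text \<open>The base has positive real part on the ball, where \<open>powr\<close> is the holomorphic principal branch.\<close>

definition bergman_kernel :: "real \<Rightarrow> complex ^ ('n::finite) \<Rightarrow> complex ^ 'n \<Rightarrow> complex" where
  "bergman_kernel s w z = (1 - (\<Sum>i\<in>UNIV. z $ i * cnj (w $ i))) powr (- of_real s)"


section \<open>The L2 space on the orbit\<close>

definition radon_measure_on :: "'a::topological_space set \<Rightarrow> 'a measure \<Rightarrow> bool" where
  "radon_measure_on S \<mu> \<longleftrightarrow>
     space \<mu> = S \<and> sets \<mu> = sets (restrict_space borel S) \<and>
     (\<forall>K. compact K \<and> K \<subseteq> S \<longrightarrow> emeasure \<mu> K < \<infinity>) \<and>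
     (\<forall>A\<in>sets \<mu>. emeasure \<mu> A = (INF U\<in>{U. openin (top_of_set S) U \<and> A \<subseteq> U}. emeasure \<mu> U)) \<and>
     (\<forall>U. openin (top_of_set S) U \<longrightarrow> emeasure \<mu> U = (SUP K\<in>{K. compact K \<and> K \<subseteq> U}. emeasure \<mu> K))"

definition stabilizer ::
  "('g \<Rightarrow> complex ^ ('n::finite) option ^ 'n option) \<Rightarrow> 'g set \<Rightarrow> complex ^ 'n \<Rightarrow> 'g set" where
  "stabilizer p Ht z\<^sub>0 = {k \<in> Ht. act (p k) z\<^sub>0 = z\<^sub>0}"

text \<open>
  A function \<open>F\<close> on the group \<open>Ht\<close> that is right invariant under the stabilizer of \<open>z\<^sub>0\<close>
  descends to the orbit, the value at \<open>m = h \<sqdot> z\<^sub>0\<close> being \<open>F h\<close> for any choice of \<open>h\<close>.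
  It is used for right invariant \<open>F\<close> only.
\<close>

definition descend ::
  "('g \<Rightarrow> complex ^ ('n::finite) option ^ 'n option) \<Rightarrow> 'g set \<Rightarrow> complex ^ 'n \<Rightarrow>
   ('g \<Rightarrow> 'b) \<Rightarrow> complex ^ 'n \<Rightarrow> 'b" where
  "descend p Ht z\<^sub>0 F m = F (SOME h. h \<in> Ht \<and> act (p h) z\<^sub>0 = m)"

definition character ::
  "('g \<Rightarrow> complex ^ ('n::finite) \<Rightarrow> complex) \<Rightarrow> complex ^ 'n \<Rightarrow> 'g \<Rightarrow> complex" where
  "character j z\<^sub>0 k = inverse (j k z\<^sub>0)"

text \<open>
  Square integrable sections are not identified when they agree almost everywhere; the notions
  built on this space (inner product, adjoint, closure) only depend on the class.
  Measurability is with respect to the Borel sets of the subspace \<open>Ht\<close>.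
\<close>

definition L2_orbit ::
  "'g::topological_space monoid \<Rightarrow> ('g \<Rightarrow> complex ^ ('n::finite) option ^ 'n option) \<Rightarrow>
   ('g \<Rightarrow> complex ^ 'n \<Rightarrow> complex) \<Rightarrow> 'g set \<Rightarrow> complex ^ 'n \<Rightarrow> (complex ^ 'n) measure \<Rightarrow>
   ('g \<Rightarrow> complex) set" where
  "L2_orbit Gt p j Ht z\<^sub>0 \<mu> = {f. f \<in> borel_measurable (restrict_space borel Ht) \<and>
     (\<forall>h\<in>Ht. \<forall>k\<in>stabilizer p Ht z\<^sub>0. f (h \<otimes>\<^bsub>Gt\<^esub> k) = inverse (character j z\<^sub>0 k) * f h) \<and>
     integrable \<mu> (descend p Ht z\<^sub>0 (\<lambda>h. (norm (f h))\<^sup>2))}"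

definition orbit_inner ::
  "('g \<Rightarrow> complex ^ ('n::finite) option ^ 'n option) \<Rightarrow> 'g set \<Rightarrow> complex ^ 'n \<Rightarrow>
   (complex ^ 'n) measure \<Rightarrow> ('g \<Rightarrow> complex) \<Rightarrow> ('g \<Rightarrow> complex) \<Rightarrow> complex" where
  "orbit_inner p Ht z\<^sub>0 \<mu> f g = (LINT m|\<mu>. descend p Ht z\<^sub>0 (\<lambda>h. f h * cnj (g h)) m)"

definition orbit_norm ::
  "('g \<Rightarrow> complex ^ ('n::finite) option ^ 'n option) \<Rightarrow> 'g set \<Rightarrow> complex ^ 'n \<Rightarrow>
   (complex ^ 'n) measure \<Rightarrow> ('g \<Rightarrow> complex) \<Rightarrow> real" where
  "orbit_norm p Ht z\<^sub>0 \<mu> f = sqrt (LINT m|\<mu>. descend p Ht z\<^sub>0 (\<lambda>h. (norm (f h))\<^sup>2) m)"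


section \<open>The restriction operator and its adjoint\<close>

definition restr ::
  "('g \<Rightarrow> complex ^ ('n::finite) option ^ 'n option) \<Rightarrow> ('g \<Rightarrow> complex ^ 'n \<Rightarrow> complex) \<Rightarrow>
   complex ^ 'n \<Rightarrow> (complex ^ 'n \<Rightarrow> complex) \<Rightarrow> 'g \<Rightarrow> complex" where
  "restr p j z\<^sub>0 f h = j h z\<^sub>0 * f (act (p h) z\<^sub>0)"

text \<open>The maximal domain, on which the operator is closed.\<close>

definition restr_dom ::
  "real \<Rightarrow> 'g::topological_space monoid \<Rightarrow> ('g \<Rightarrow> complex ^ ('n::finite) option ^ 'n option) \<Rightarrow>
   ('g \<Rightarrow> complex ^ 'n \<Rightarrow> complex) \<Rightarrow> 'g set \<Rightarrow> complex ^ 'n \<Rightarrow> (complex ^ 'n) measure \<Rightarrow>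
   (complex ^ 'n \<Rightarrow> complex) set" where
  "restr_dom s Gt p j Ht z\<^sub>0 \<mu> = {f \<in> bergman_space s. restr p j z\<^sub>0 f \<in> L2_orbit Gt p j Ht z\<^sub>0 \<mu>}"

definition range_closure ::
  "real \<Rightarrow> 'g::topological_space monoid \<Rightarrow> ('g \<Rightarrow> complex ^ ('n::finite) option ^ 'n option) \<Rightarrow>
   ('g \<Rightarrow> complex ^ 'n \<Rightarrow> complex) \<Rightarrow> 'g set \<Rightarrow> complex ^ 'n \<Rightarrow> (complex ^ 'n) measure \<Rightarrow>
   ('g \<Rightarrow> complex) set" where
  "range_closure s Gt p j Ht z\<^sub>0 \<mu> = {f \<in> L2_orbit Gt p j Ht z\<^sub>0 \<mu>.
     \<forall>\<epsilon>>0. \<exists>u\<in>restr_dom s Gt p j Ht z\<^sub>0 \<mu>. orbit_norm p Ht z\<^sub>0 \<mu> (\<lambda>h. f h - restr p j z\<^sub>0 u h) < \<epsilon>}"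

text \<open>
  \<open>g\<close> is a value of the adjoint of the restriction operator at \<open>f\<close>; it is unique as soon as
  the domain of the restriction operator is dense in the Bergman space.
\<close>

definition is_restr_adj ::
  "real \<Rightarrow> 'g::topological_space monoid \<Rightarrow> ('g \<Rightarrow> complex ^ ('n::finite) option ^ 'n option) \<Rightarrow>
   ('g \<Rightarrow> complex ^ 'n \<Rightarrow> complex) \<Rightarrow> 'g set \<Rightarrow> complex ^ 'n \<Rightarrow> (complex ^ 'n) measure \<Rightarrow>
   ('g \<Rightarrow> complex) \<Rightarrow> (complex ^ 'n \<Rightarrow> complex) \<Rightarrow> bool" where
  "is_restr_adj s Gt p j Ht z\<^sub>0 \<mu> f g \<longleftrightarrow> g \<in> bergman_space s \<and>
     (\<forall>u\<in>restr_dom s Gt p j Ht z\<^sub>0 \<mu>.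
        orbit_inner p Ht z\<^sub>0 \<mu> (restr p j z\<^sub>0 u) f = l2_inner (bergman_measure s) u g)"

definition restr_adj_dom ::
  "real \<Rightarrow> 'g::topological_space monoid \<Rightarrow> ('g \<Rightarrow> complex ^ ('n::finite) option ^ 'n option) \<Rightarrow>
   ('g \<Rightarrow> complex ^ 'n \<Rightarrow> complex) \<Rightarrow> 'g set \<Rightarrow> complex ^ 'n \<Rightarrow> (complex ^ 'n) measure \<Rightarrow>
   ('g \<Rightarrow> complex) set" where
  "restr_adj_dom s Gt p j Ht z\<^sub>0 \<mu> =
     {f \<in> L2_orbit Gt p j Ht z\<^sub>0 \<mu>. \<exists>g. is_restr_adj s Gt p j Ht z\<^sub>0 \<mu> f g}"

definition restr_adj ::
  "real \<Rightarrow> 'g::topological_space monoid \<Rightarrow> ('g \<Rightarrow> complex ^ ('n::finite) option ^ 'n option) \<Rightarrow>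
   ('g \<Rightarrow> complex ^ 'n \<Rightarrow> complex) \<Rightarrow> 'g set \<Rightarrow> complex ^ 'n \<Rightarrow> (complex ^ 'n) measure \<Rightarrow>
   ('g \<Rightarrow> complex) \<Rightarrow> complex ^ 'n \<Rightarrow> complex" where
  "restr_adj s Gt p j Ht z\<^sub>0 \<mu> f = (THE g. is_restr_adj s Gt p j Ht z\<^sub>0 \<mu> f g)"

definition nu ::
  "real \<Rightarrow> ('g \<Rightarrow> complex ^ ('n::finite) option ^ 'n option) \<Rightarrow> ('g \<Rightarrow> complex ^ 'n \<Rightarrow> complex) \<Rightarrow>
   complex ^ 'n \<Rightarrow> (complex ^ 'n \<Rightarrow> complex) \<Rightarrow> 'g \<Rightarrow> complex" where
  "nu s p j z\<^sub>0 \<phi> h = j h z\<^sub>0 *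
     l2_inner (bergman_measure s) (\<lambda>z. \<phi> z * bergman_kernel s z\<^sub>0 z) (bergman_kernel s (act (p h) z\<^sub>0))"

end

theory Submission
  imports Defs "HOL-Complex_Analysis.Complex_Analysis"
begin

text \<open>
  The restriction operator turns out to be bounded. By the mean value property
  \<open>|f m|^2 (1 - |m|^2)^s\<close> is at most a constant times the integral of \<open>|f|^2\<close> over a hyperbolic
  ball of fixed radius around \<open>m\<close>; integrating over the orbit and exchanging the integrals, it
  remains to bound \<open>\<mu>\<close> on hyperbolic balls uniformly. A ball that meets the orbit can be moved by the
  group close to the base point, where the integrability of \<open>|j(h,z0)|^2\<close> bounds the measure.
  Hence the adjoint is defined everywhere. By the reproducing property the value of \<open>T R* f\<close> at
  \<open>h z0\<close> is the conjugate of \<open>\<langle>u, R* f\<rangle> = \<langle>R u, f\<rangle>\<close>, where \<open>u\<close> is the projection of the kernel at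
  \<open>h z0\<close> times the conjugate symbol, and the transformation laws of the kernel, of the measure and
  of the cocycle identify the resulting integrand with \<open>f(k) \<nu>(k^-1 h)\<close>.
\<close>

section \<open>Linear changes of variables for the Lebesgue measure\<close>

text \<open>No Jacobian determinant is ever computed. The fractional linear action is lifted to
  linear maps of C^(n+1), whose effect on the Lebesgue measure follows from translation invariance
  and symmetry; the weighted measure on the ball comes back by integrating out the homogeneous
  coordinate. Two further obstacles shape the proof. First, \<open>descend\<close> picks
  representatives arbitrarily, so nothing built with it is visibly measurable; a Borel section of
  the orbit map replaces the choice, obtained from a selection theorem on the closed group followed
  by a Borel section of the covering. Second, the cocycle is a power of a lifted logarithm, so
  identities for it and for the principal branch in the kernel hold at first only up to factors
  exp(2 pi i s k); connectedness removes them. The symbol is invariant only almost everywhere, with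
  a null set depending on the group element, which is why the formula for \<open>nu\<close> is
  derived for each element separately. The radius 1/2 of the mean value becomes the bound 4/3 = 1 /
  (1 - 1/4) on \<open>hdist\<close>.\<close>

lemma nn_integral_lborel_shift:
  fixes f :: "'a::euclidean_space \<Rightarrow> ennreal"
  assumes [measurable]: "f \<in> borel_measurable borel"
  shows "(\<integral>\<^sup>+x. f (a + x) \<partial>lborel) = (\<integral>\<^sup>+x. f x \<partial>lborel)"
proof -
  have "(\<integral>\<^sup>+x. f x \<partial>lborel) = (\<integral>\<^sup>+x. f x \<partial>distr lborel borel (\<lambda>x. a + x))"
    by (simp add: lborel_distr_plus)
  also have "\<dots> = (\<integral>\<^sup>+x. f (a + x) \<partial>lborel)"
    by (subst nn_integral_distr) auto
  finally show ?thesis by simp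
qed

text \<open>The image of the Lebesgue measure is translation invariant; comparing it with the Lebesgue
  measure by Fubini on a unit box shows that the two are proportional.\<close>
lemma distr_lborel_linear:
  fixes T S :: "'a::euclidean_space \<Rightarrow> 'a"
  assumes T: "linear T" and S: "linear S" and TS: "\<And>x. T (S x) = x"
  obtains k where "distr lborel borel T = scale_measure k lborel"
proof -
  have [measurable]: "T \<in> borel_measurable borel"
    using T by (simp add: linear_continuous_on linear_linear borel_measurable_continuous_onI)
  define B :: "'a set" where "B = box 0 One"
  have [measurable]: "B \<in> sets borel" by (simp add: B_def)
  have B1: "emeasure lborel B = 1"
    by (simp add: B_def emeasure_lborel_box_eq)
  \<comment> \<open>The value that the inner integral takes in the end, once A no longer depends on
    x: the measure of the preimage of the unit box under - T.\<close>
  define k where "k = (\<integral>\<^sup>+x. indicator B (- T x) \<partial>lborel)"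
  have Tadd: "T (S y + x) = y + T x" for x y using T TS by (simp add: linear_add)
  have eq: "emeasure lborel (T -` A) = k * emeasure lborel A" if [measurable]: "A \<in> sets borel" for A
  proof -
    \<comment> \<open>The integral 1 of the indicator of the unit box brings in a second variable y.
      Shifting x by \<open>S y\<close> turns \<open>T x\<close> into \<open>y + T x\<close>, and
      shifting y back by \<open>T x\<close> moves the dependence on x from A to the box.\<close>
    have "emeasure lborel (T -` A) = (\<integral>\<^sup>+y. (\<integral>\<^sup>+x. indicator A (T x) * indicator B y \<partial>lborel) \<partial>lborel)"
    proof -
      have "T -` A \<in> sets lborel" using measurable_sets[of T borel borel A] by simp
      then have "emeasure lborel (T -` A) = (\<integral>\<^sup>+x. indicator (T -` A) x \<partial>lborel)" by simp
      also have "\<dots> = (\<integral>\<^sup>+x. indicator A (T x) \<partial>lborel)"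
        by (intro nn_integral_cong) (auto simp: indicator_def)
      finally have "(\<integral>\<^sup>+x. indicator A (T x) \<partial>lborel) = emeasure lborel (T -` A)" by (rule sym)
      then show ?thesis by (simp add: nn_integral_multc nn_integral_cmult B1)
    qed
    also have "\<dots> = (\<integral>\<^sup>+y. (\<integral>\<^sup>+x. indicator A (y + T x) * indicator B y \<partial>lborel) \<partial>lborel)"
    proof (rule nn_integral_cong)
      fix y :: 'a
      show "(\<integral>\<^sup>+x. indicator A (T x) * indicator B y \<partial>lborel) = (\<integral>\<^sup>+x. indicator A (y + T x) * indicator B y \<partial>lborel)"
        using nn_integral_lborel_shift[of "\<lambda>x. indicator A (T x) * indicator B y" "S y"] by (simp add: Tadd)
    qed
    also have "\<dots> = (\<integral>\<^sup>+x. (\<integral>\<^sup>+y. indicator A (y + T x) * indicator B y \<partial>lborel) \<partial>lborel)"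
      by (rule lborel_pair.Fubini') measurable
    also have "\<dots> = (\<integral>\<^sup>+x. (\<integral>\<^sup>+y. indicator A y * indicator B (y - T x) \<partial>lborel) \<partial>lborel)"
    proof (rule nn_integral_cong)
      fix x :: 'a
      show "(\<integral>\<^sup>+y. indicator A (y + T x) * indicator B y \<partial>lborel) = (\<integral>\<^sup>+y. indicator A y * indicator B (y - T x) \<partial>lborel)"
        using nn_integral_lborel_shift[of "\<lambda>y. indicator A y * indicator B (y - T x)" "T x"]
        by (simp add: add.commute)
    qed
    also have "\<dots> = (\<integral>\<^sup>+y. (\<integral>\<^sup>+x. indicator A y * indicator B (y - T x) \<partial>lborel) \<partial>lborel)"
      by (rule lborel_pair.Fubini') measurable
    also have "\<dots> = (\<integral>\<^sup>+y. indicator A y * k \<partial>lborel)"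
    proof (rule nn_integral_cong)
      fix y :: 'a
      have "(\<integral>\<^sup>+x. indicator B (y - T x) \<partial>lborel) = k"
        using nn_integral_lborel_shift[of "\<lambda>x. indicator B (y - T x)" "S y"] by (simp add: Tadd k_def)
      then show "(\<integral>\<^sup>+x. indicator A y * indicator B (y - T x) \<partial>lborel) = indicator A y * k"
        by (simp add: nn_integral_cmult)
    qed
    also have "\<dots> = k * emeasure lborel A"
      by (subst nn_integral_multc) (simp_all add: mult.commute)
    finally show ?thesis .
  qed
  have "distr lborel borel T = scale_measure k lborel"
    by (rule measure_eqI) (auto simp: emeasure_distr eq)
  then show ?thesis using that by blast
qed

lemma emeasure_lborel_unit_ball:
  "emeasure lborel (ball (0::'a::euclidean_space) 1) \<noteq> 0"
  "emeasure lborel (ball (0::'a::euclidean_space) 1) \<noteq> \<infinity>"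
  using content_ball_gt_0_iff[of "0::'a" 1] emeasure_lborel_ball_finite[of "0::'a" 1]
  by (auto simp: measure_def simp del: content_ball_gt_0_iff)

text \<open>The proportionality factor is found by testing on the ball of radius r, whose preimage
  is the unit ball. Real linearity suffices, so this covers multiplication by complex scalars,
  unitary maps and reflections alike.\<close>

lemma nn_integral_lborel_homothety:
  fixes T S :: "'a::euclidean_space \<Rightarrow> 'a"
  assumes T: "linear T" and S: "linear S" and TS: "\<And>x. T (S x) = x"
    and r: "r > 0" and nT: "\<And>x. norm (T x) = r * norm x"
    and [measurable]: "f \<in> borel_measurable borel"
  shows "(\<integral>\<^sup>+x. f x \<partial>lborel) = ennreal (r ^ DIM('a)) * (\<integral>\<^sup>+x. f (T x) \<partial>lborel)"
proof -
  have [measurable]: "T \<in> borel_measurable borel"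
    using T by (simp add: linear_continuous_on linear_linear borel_measurable_continuous_onI)
  obtain k where k: "distr lborel borel T = scale_measure k lborel"
    using distr_lborel_linear[OF T S TS] .
  have "T -` ball 0 r = ball 0 1" using r by (auto simp: nT)
  then have "emeasure lborel (ball (0::'a) 1) = k * emeasure lborel (ball (0::'a) r)"
    using arg_cong[OF k, of "\<lambda>M. emeasure M (ball 0 r)"] by (simp add: emeasure_distr)
  also have "emeasure lborel (ball (0::'a) r) = ennreal (r ^ DIM('a)) * emeasure lborel (ball (0::'a) 1)"
    using r by (simp add: emeasure_ball mult.commute flip: ennreal_mult)
  finally have "(ennreal (r ^ DIM('a)) * k) * emeasure lborel (ball (0::'a) 1) = 1 * emeasure lborel (ball (0::'a) 1)"
    by (simp add: ac_simps)
  then have "ennreal (r ^ DIM('a)) * k = 1"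
    using emeasure_lborel_unit_ball[where 'a='a] by (metis mult_divide_eq_ennreal infinity_ennreal_def)
  moreover have "(\<integral>\<^sup>+x. f (T x) \<partial>lborel) = k * (\<integral>\<^sup>+x. f x \<partial>lborel)"
    using arg_cong[OF k, of "\<lambda>M. nn_integral M f"]
    by (simp add: nn_integral_distr nn_integral_scale_measure)
  ultimately show ?thesis by (metis mult.assoc mult_1)
qed

section \<open>Pseudo-unitary maps\<close>

definition cip :: "complex ^ 'n \<Rightarrow> complex ^ 'n \<Rightarrow> complex" where
  "cip x y = (\<Sum>i\<in>UNIV. x $ i * cnj (y $ i))"

lemma norm_vector_smult: "norm (c *s x) = norm c * norm (x :: complex ^ 'n)"
  by (simp add: norm_vec_def norm_mult L2_set_right_distrib)

lemma cip_add_left: "cip (x + y) z = cip x z + cip y z"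
  by (simp add: cip_def algebra_simps sum.distrib)
lemma cip_smult_left: "cip (c *s x) z = c * cip x z"
  by (simp add: cip_def algebra_simps sum_distrib_left)
lemma cnj_cip: "cnj (cip x y) = cip y x"
  by (simp add: cip_def mult.commute)
lemma cip_add_right: "cip x (y + z) = cip x y + cip x z"
  by (simp add: cip_def algebra_simps sum.distrib)
lemma cip_smult_right: "cip x (c *s y) = cnj c * cip x y"
  by (simp add: cip_def algebra_simps sum_distrib_left)
lemma cip_minus_right: "cip x (- y) = - cip x y"
  by (simp add: cip_def sum_negf)
lemma cip_minus_left: "cip (- x) y = - cip x y"
  by (simp add: cip_def sum_negf)
lemma cip_zero [simp]: "cip 0 y = 0" "cip x 0 = 0"
  by (simp_all add: cip_def)

lemma cip_self: "cip x x = of_real ((norm x)\<^sup>2)"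
  by (simp add: cip_def norm_vec_def L2_set_def sum_nonneg complex_norm_square[symmetric] del: of_real_power)

lemma norm_cip: "norm (cip x y) \<le> norm x * norm y"
proof -
  have "norm (cip x y) \<le> (\<Sum>i\<in>UNIV. \<bar>norm (x $ i)\<bar> * \<bar>norm (y $ i)\<bar>)"
    unfolding cip_def by (rule order_trans[OF norm_sum]) (simp add: norm_mult)
  also have "\<dots> \<le> norm x * norm y"
    unfolding norm_vec_def by (rule L2_set_mult_ineq)
  finally show ?thesis .
qed

lemma norm_cip_less_1:
  assumes "norm x \<le> 1" "norm y < 1"
  shows "norm (cip x y) < 1"
proof -
  have "norm (cip x y) \<le> norm x * norm y" by (rule norm_cip)
  also have "\<dots> \<le> 1 * norm y" using assms by (intro mult_right_mono) auto
  finally show ?thesis using assms by simp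
qed

lemma continuous_on_cip [continuous_intros]:
  assumes "continuous_on S f" "continuous_on S g"
  shows "continuous_on S (\<lambda>x. cip (f x) (g x))"
  unfolding cip_def by (intro continuous_intros assms)

lemma continuous_on_smult [continuous_intros]:
  fixes g :: "'a::topological_space \<Rightarrow> complex ^ 'n"
  assumes "continuous_on S f" "continuous_on S g"
  shows "continuous_on S (\<lambda>x. f x *s g x)"
  unfolding vector_scalar_mult_def by (intro continuous_intros assms)

text \<open>A pair consists of the first n coordinates of a vector of C^(n+1) and the last one,
  which serves as homogeneous coordinate: a point z of the ball is the line through
  \<open>(z, 1)\<close>.\<close>

definition cscale :: "complex \<Rightarrow> (complex ^ 'n) \<times> complex \<Rightarrow> (complex ^ 'n) \<times> complex" where
  "cscale c p = (c *s fst p, c * snd p)"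

definition hform :: "(complex ^ 'n) \<times> complex \<Rightarrow> (complex ^ 'n) \<times> complex \<Rightarrow> complex" where
  "hform p q = snd p * cnj (snd q) - cip (fst p) (fst q)"

text \<open>The group U(n,1), without a condition on the determinant, so that scalar rotations of
  the ball belong to it as well as the elements of SU(n,1).\<close>

definition pseudo_unitary :: "((complex ^ 'n) \<times> complex \<Rightarrow> (complex ^ 'n) \<times> complex) \<Rightarrow> bool" where
  "pseudo_unitary T \<longleftrightarrow> (\<forall>p q. T (p + q) = T p + T q) \<and> (\<forall>c p. T (cscale c p) = cscale c (T p))
     \<and> (\<forall>p q. hform (T p) (T q) = hform p q)"

lemma pseudo_unitaryD:
  assumes "pseudo_unitary T"
  shows "T (p + q) = T p + T q" "T (cscale c p) = cscale c (T p)" "hform (T p) (T q) = hform p q"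
  using assms unfolding pseudo_unitary_def by blast+

lemma scaleR_eq_smult: "r *\<^sub>R (x :: complex ^ 'n) = of_real r *s x"
  by (simp add: vec_eq_iff) (simp add: scaleR_conv_of_real)

lemma scaleR_eq_cscale: "r *\<^sub>R (p :: (complex ^ 'n) \<times> complex) = cscale (of_real r) p"
  by (cases p) (simp add: cscale_def scaleR_eq_smult scaleR_conv_of_real)

lemma pseudo_unitary_linear: "pseudo_unitary T \<Longrightarrow> linear T"
  by (rule linearI) (simp_all add: scaleR_eq_cscale pseudo_unitaryD)

lemma hform_nondegenerate:
  assumes "\<And>q. hform p q = 0"
  shows "p = 0"
proof -
  have "hform p (0, snd p) = 0" "hform p (fst p, 0) = 0" using assms by auto
  then have "snd p * cnj (snd p) = 0" "cip (fst p) (fst p) = 0" by (simp_all add: hform_def)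
  then have "snd p = 0" "fst p = 0" by (simp_all add: cip_self)
  then show ?thesis by (simp add: prod_eq_iff)
qed

text \<open>A map preserving a nondegenerate form has trivial kernel, hence is bijective in finite
  dimension.\<close>

lemma pseudo_unitary_inverse:
  fixes T :: "(complex ^ 'n) \<times> complex \<Rightarrow> (complex ^ ('n::finite)) \<times> complex"
  assumes T: "pseudo_unitary T"
  obtains S where "pseudo_unitary S" "\<And>p. T (S p) = p" "\<And>p. S (T p) = p"
proof -
  have "T p = 0 \<Longrightarrow> p = 0" for p
  proof (rule hform_nondegenerate)
    fix q assume "T p = 0"
    then have "hform (T p) (T q) = 0" by (simp add: hform_def)
    then show "hform p q = 0" using T by (simp add: pseudo_unitaryD)
  qed
  then have inj: "inj T" using linear_injective_0[OF pseudo_unitary_linear[OF T]] by blast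
  obtain S where "linear S" and ST: "\<And>p. S (T p) = p" and TS: "\<And>p. T (S p) = p"
    using linear_injective_isomorphism[OF pseudo_unitary_linear[OF T] inj] by blast
  have "pseudo_unitary S"
    unfolding pseudo_unitary_def
  proof (intro conjI allI)
    fix p q c
    show "S (p + q) = S p + S q" by (metis ST TS T pseudo_unitaryD(1))
    show "S (cscale c p) = cscale c (S p)" by (metis ST TS T pseudo_unitaryD(2))
    show "hform (S p) (S q) = hform p q" by (metis TS T pseudo_unitaryD(3))
  qed
  then show ?thesis using that ST TS by blast
qed

lemma pseudo_unitary_compose:
  "pseudo_unitary T \<Longrightarrow> pseudo_unitary S \<Longrightarrow> pseudo_unitary (\<lambda>p. T (S p))"
  unfolding pseudo_unitary_def by (simp del: split_paired_All)

section \<open>The fractional linear action on the ball\<close>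

definition pden :: "((complex ^ 'n) \<times> complex \<Rightarrow> (complex ^ 'n) \<times> complex) \<Rightarrow> complex ^ 'n \<Rightarrow> complex" where
  "pden T z = snd (T (z, 1))"

definition pact :: "((complex ^ 'n) \<times> complex \<Rightarrow> (complex ^ 'n) \<times> complex) \<Rightarrow> complex ^ 'n \<Rightarrow> complex ^ 'n" where
  "pact T z = inverse (pden T z) *s fst (T (z, 1))"

lemma hform_self: "hform p p = of_real ((norm (snd p))\<^sup>2 - (norm (fst p))\<^sup>2)"
  unfolding hform_def cip_self by (simp add: complex_norm_square[symmetric])

lemma pseudo_unitary_norms:
  assumes "pseudo_unitary T"
  shows "(norm (snd (T p)))\<^sup>2 - (norm (fst (T p)))\<^sup>2 = (norm (snd p))\<^sup>2 - (norm (fst p))\<^sup>2"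
  using pseudo_unitaryD(3)[OF assms, of p p] unfolding hform_self of_real_eq_iff .

lemma norm_sq_less_1: "norm (z::'a::real_normed_vector) < 1 \<Longrightarrow> (norm z)\<^sup>2 < 1"
  by (simp add: power_less_one_iff abs_square_less_1)

text \<open>The vector \<open>(z, 1)\<close> is positive for the form, and so is its image; a vector
  with last coordinate 0 is not positive.\<close>

lemma pden_nonzero:
  assumes "pseudo_unitary T" "z \<in> ball 0 1"
  shows "pden T z \<noteq> 0"
proof
  assume "pden T z = 0"
  then have "- (norm (fst (T (z, 1))))\<^sup>2 = 1 - (norm z)\<^sup>2"
    using pseudo_unitary_norms[OF assms(1), of "(z, 1)"] by (simp add: pden_def)
  moreover have "(norm z)\<^sup>2 < 1" using assms by (simp add: norm_sq_less_1)
  ultimately show False by (smt (verit) zero_le_power2)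
qed

lemma pact_cscale:
  assumes "pseudo_unitary T" "z \<in> ball 0 1"
  shows "T (z, 1) = cscale (pden T z) (pact T z, 1)"
  using pden_nonzero[OF assms]
  by (simp add: prod_eq_iff cscale_def pact_def) (simp add: pden_def)

lemma hform_cscale: "hform (cscale c p) (cscale d q) = c * cnj d * hform p q"
  by (simp add: hform_def cscale_def cip_smult_left cip_smult_right algebra_simps)

text \<open>The left side for the untransformed points is the invariant form on
  \<open>(z, 1)\<close> and \<open>(w, 1)\<close>; normalizing the last coordinate of the images
  produces the denominators. The transformation laws of the norm, of \<open>hdist\<close> and of the
  kernel all come from here.\<close>

lemma one_minus_cip_pact:
  assumes T: "pseudo_unitary T" and z: "z \<in> ball 0 1" and w: "w \<in> ball 0 1"
  shows "1 - cip (pact T z) (pact T w) = (1 - cip z w) / (pden T z * cnj (pden T w))"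
proof -
  have "1 - cip z w = hform (T (z, 1)) (T (w, 1))"
    unfolding pseudo_unitaryD(3)[OF T] by (simp add: hform_def)
  also have "\<dots> = pden T z * cnj (pden T w) * (1 - cip (pact T z) (pact T w))"
    by (simp add: pact_cscale[OF T z] pact_cscale[OF T w] hform_cscale) (simp add: hform_def)
  finally show ?thesis using pden_nonzero[OF T z] pden_nonzero[OF T w] by simp
qed

lemma one_minus_norm_pact:
  assumes T: "pseudo_unitary T" and z: "z \<in> ball 0 1"
  shows "1 - (norm (pact T z))\<^sup>2 = (1 - (norm z)\<^sup>2) / (norm (pden T z))\<^sup>2"
proof -
  have "complex_of_real (1 - (norm (pact T z))\<^sup>2) = of_real ((1 - (norm z)\<^sup>2) / (norm (pden T z))\<^sup>2)"
    using one_minus_cip_pact[OF T z z]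
    unfolding cip_self complex_norm_square[symmetric] by (simp flip: of_real_power)
  then show ?thesis unfolding of_real_eq_iff .
qed

lemma pact_in_ball:
  assumes T: "pseudo_unitary T" and z: "z \<in> ball 0 1"
  shows "pact T z \<in> ball 0 1"
proof -
  have "1 - (norm (pact T z))\<^sup>2 > 0"
    unfolding one_minus_norm_pact[OF assms]
    using z pden_nonzero[OF assms] by (simp add: norm_sq_less_1)
  then show ?thesis by (simp add: abs_square_less_1)
qed

lemma pden_compose:
  assumes T: "pseudo_unitary T" and S: "pseudo_unitary S" and z: "z \<in> ball 0 1"
  shows "pden (\<lambda>p. T (S p)) z = pden T (pact S z) * pden S z"
  unfolding pden_def[of "\<lambda>p. T (S p)"] pact_cscale[OF S z] pseudo_unitaryD(2)[OF T]
  by (simp add: cscale_def pden_def)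

lemma pact_compose:
  assumes T: "pseudo_unitary T" and S: "pseudo_unitary S" and z: "z \<in> ball 0 1"
  shows "pact (\<lambda>p. T (S p)) z = pact T (pact S z)"
  unfolding pact_def[of "\<lambda>p. T (S p)"] pden_compose[OF assms]
  unfolding pact_cscale[OF S z] pseudo_unitaryD(2)[OF T]
  using pden_nonzero[OF S z]
  by (simp add: cscale_def pact_def)

lemma pact_inverse:
  assumes T: "pseudo_unitary T" and S: "pseudo_unitary S" and TS: "\<And>p. T (S p) = p" and z: "z \<in> ball 0 1"
  shows "pact T (pact S z) = z" "pden T (pact S z) * pden S z = 1"
  using pact_compose[OF T S z] pden_compose[OF T S z] unfolding TS by (simp_all add: pact_def pden_def)

lemma continuous_on_linear_pair:
  fixes T :: "'a::euclidean_space \<Rightarrow> 'b::real_normed_vector"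
  assumes "linear T" "continuous_on S f" shows "continuous_on S (\<lambda>x. T (f x))"
  using assms by (metis continuous_on_compose2 linear_continuous_on linear_linear subset_UNIV)

lemma continuous_on_pden:
  assumes "pseudo_unitary (T :: _ \<Rightarrow> (complex ^ ('n::finite)) \<times> complex)"
  shows "continuous_on S (pden T)"
  unfolding pden_def
  by (intro continuous_intros continuous_on_linear_pair[OF pseudo_unitary_linear[OF assms]])

lemma continuous_on_pact:
  assumes "pseudo_unitary (T :: _ \<Rightarrow> (complex ^ ('n::finite)) \<times> complex)"
  shows "continuous_on (ball 0 1) (pact T)"
  unfolding pact_def
  by (intro continuous_intros continuous_on_linear_pair[OF pseudo_unitary_linear[OF assms]]
      continuous_on_pden[OF assms] ballI pden_nonzero[OF assms])

subsection \<open>Boosts\<close>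

text \<open>The Lorentz factor of the velocity w.\<close>

definition gam :: "complex ^ 'n \<Rightarrow> real" where
  "gam w = 1 / sqrt (1 - (norm w)\<^sup>2)"

text \<open>The Lorentz boost with velocity w. The usual coefficient (gam - 1) / |w|^2 is written as
  gam^2 / (1 + gam), which agrees with it and is also meaningful at w = 0.\<close>

definition boost :: "complex ^ 'n \<Rightarrow> (complex ^ 'n) \<times> complex \<Rightarrow> (complex ^ 'n) \<times> complex" where
  "boost w p = (fst p + (of_real ((gam w)\<^sup>2 / (1 + gam w)) * cip (fst p) w + of_real (gam w) * snd p) *s w,
     of_real (gam w) * (cip (fst p) w + snd p))"

lemma gam_facts:
  assumes "w \<in> ball 0 1"
  shows "gam w > 0" "(gam w)\<^sup>2 * (norm w)\<^sup>2 = (gam w)\<^sup>2 - 1"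
    "(gam w)\<^sup>2 / (1 + gam w) * (norm w)\<^sup>2 = gam w - 1"
    "(gam w)\<^sup>2 / (1 + gam w) * (1 + gam w) = (gam w)\<^sup>2"
    "(gam w)\<^sup>2 * (1 - (norm w)\<^sup>2) = 1"
proof -
  have W: "(norm w)\<^sup>2 < 1" using assms by (simp add: norm_sq_less_1)
  show g0: "gam w > 0" using W by (simp add: gam_def)
  have sq: "(gam w)\<^sup>2 = 1 / (1 - (norm w)\<^sup>2)" using W by (simp add: gam_def power_divide)
  show sq1: "(gam w)\<^sup>2 * (1 - (norm w)\<^sup>2) = 1" unfolding sq using W by simp
  then show a: "(gam w)\<^sup>2 * (norm w)\<^sup>2 = (gam w)\<^sup>2 - 1" by (simp add: algebra_simps)
  show "(gam w)\<^sup>2 / (1 + gam w) * (1 + gam w) = (gam w)\<^sup>2" using g0 by simp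
  have "(gam w)\<^sup>2 / (1 + gam w) * (norm w)\<^sup>2 = ((gam w)\<^sup>2 - 1) / (1 + gam w)" using a by simp
  also have "\<dots> = gam w - 1" using g0 by (simp add: field_simps power2_eq_square)
  finally show "(gam w)\<^sup>2 / (1 + gam w) * (norm w)\<^sup>2 = gam w - 1" .
qed

lemma boost_pseudo_unitary:
  assumes w: "w \<in> ball 0 1"
  shows "pseudo_unitary (boost w)"
  unfolding pseudo_unitary_def
proof (intro conjI allI)
  fix p q :: "(complex ^ 'a) \<times> complex" and c
  show "boost w (p + q) = boost w p + boost w q"
    by (simp add: boost_def cip_add_left algebra_simps vec_eq_iff add_divide_distrib)
  show "boost w (cscale c p) = cscale c (boost w p)"
    by (simp add: boost_def cscale_def cip_smult_left algebra_simps vec_eq_iff)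
  \<comment> \<open>Three polynomial relations between g, k and W = |w|^2 hold; modulo them the
    invariance of the form is a polynomial identity.\<close>
  define g k W where "g = complex_of_real (gam w)" and "k = complex_of_real ((gam w)\<^sup>2 / (1 + gam w))"
    and "W = complex_of_real ((norm w)\<^sup>2)"
  have e1: "k * W = g - 1" and e2: "k * (1 + g) = g\<^sup>2" and e3: "g\<^sup>2 * W = g\<^sup>2 - 1"
    using gam_facts(3,4,2)[OF w, THEN arg_cong[of _ _ complex_of_real]]
    by (simp_all only: of_real_mult of_real_diff of_real_add of_real_1 of_real_power k_def W_def g_def)
  have cn: "cnj k = k" "cnj g = g" by (simp_all add: k_def g_def)
  obtain x \<xi> y \<eta> where pq: "p = (x, \<xi>)" "q = (y, \<eta>)" by (cases p, cases q)
  define a b where "a = cip x w" and "b = cip y w"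
  have b': "cip w y = cnj b" by (simp add: b_def cnj_cip)
  have B: "boost w p = (x + (k * a + g * \<xi>) *s w, g * (a + \<xi>))" "boost w q = (y + (k * b + g * \<eta>) *s w, g * (b + \<eta>))"
    by (simp_all add: boost_def pq g_def k_def a_def b_def)
  have ww: "cip w w = W" by (simp add: cip_self W_def)
  have "hform (boost w p) (boost w q) =
      g * (a + \<xi>) * (g * (cnj b + cnj \<eta>)) -
      (cip x y + (k * cnj b + g * cnj \<eta>) * a + (k * a + g * \<xi>) * cnj b + (k * a + g * \<xi>) * (k * cnj b + g * cnj \<eta>) * W)"
    by (simp add: hform_def B cip_add_left cip_add_right cip_smult_left cip_smult_right ww cn b'
        flip: a_def b_def) (simp add: algebra_simps)
  also have "\<dots> = \<xi> * cnj \<eta> - cip x y" using e1 e2 e3 by algebra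
  finally show "hform (boost w p) (boost w q) = hform p q" by (simp add: hform_def pq)
qed

lemma boost_inverse:
  assumes w: "w \<in> ball 0 1"
  shows "boost (- w) (boost w p) = p"
proof -
  define g k W where "g = complex_of_real (gam w)" and "k = complex_of_real ((gam w)\<^sup>2 / (1 + gam w))"
    and "W = complex_of_real ((norm w)\<^sup>2)"
  have e1: "k * W = g - 1" and e2: "k * (1 + g) = g\<^sup>2" and e3: "g\<^sup>2 * W = g\<^sup>2 - 1"
    using gam_facts(3,4,2)[OF w, THEN arg_cong[of _ _ complex_of_real]]
    by (simp_all only: of_real_mult of_real_diff of_real_add of_real_1 of_real_power k_def W_def g_def)
  have gm: "gam (- w) = gam w" by (simp add: gam_def)
  obtain x \<xi> where p: "p = (x, \<xi>)" by (cases p)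
  define a where "a = cip x w"
  define a' where "a' = a + (k * a + g * \<xi>) * W"
  have B: "boost w p = (x + (k * a + g * \<xi>) *s w, g * (a + \<xi>))"
    by (simp add: boost_def p g_def k_def a_def)
  have "cip (x + (k * a + g * \<xi>) *s w) w = a'"
    by (simp add: cip_add_left cip_smult_left cip_self a_def W_def a'_def algebra_simps)
  then have "boost (- w) (boost w p) = (x + (k * a + g * \<xi>) *s w + (k * (- a') + g * (g * (a + \<xi>))) *s (- w),
      g * (- a' + g * (a + \<xi>)))"
    unfolding boost_def[of "-w"] B gm g_def[symmetric] k_def[symmetric] by (simp add: cip_minus_right)
  moreover have "k * a + g * \<xi> - (k * (- a') + g * (g * (a + \<xi>))) = 0"
    unfolding a'_def using e1 e2 e3 by algebra
  then have "x + (k * a + g * \<xi>) *s w + (k * (- a') + g * (g * (a + \<xi>))) *s (- w) = x"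
    by (simp add: vec_eq_iff)
  moreover have "g * (- a' + g * (a + \<xi>)) = \<xi>"
    unfolding a'_def using e1 e2 e3 by algebra
  ultimately show ?thesis using p by simp
qed

lemma pden_boost: "pden (boost w) z = of_real (gam w) * (1 + cip z w)"
  by (simp add: pden_def boost_def add.commute)

lemma pact_boost_0:
  assumes "w \<in> ball 0 1"
  shows "pact (boost w) 0 = w"
  using gam_facts(1)[OF assms] by (simp add: pact_def pden_boost) (simp add: boost_def)

lemma pact_boost_uminus:
  assumes "w \<in> ball 0 1"
  shows "pact (boost (- w)) w = 0"
  using pact_inverse(1)[OF boost_pseudo_unitary boost_pseudo_unitary boost_inverse, of "w" 0] assms
  by (simp add: pact_boost_0)

subsection \<open>Invariance of the Lebesgue measure\<close>

text \<open>\<open>boost (- w)\<close> is both the inverse of \<open>boost w\<close> and its conjugate by a reflection, so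
  the factor by which it scales the Lebesgue measure is 1.\<close>
lemma nn_integral_lborel_boost:
  fixes w :: "complex ^ ('n::finite)"
  assumes w: "w \<in> ball 0 1" and [measurable]: "f \<in> borel_measurable borel"
  shows "(\<integral>\<^sup>+p. f (boost w p) \<partial>lborel) = (\<integral>\<^sup>+p. f p \<partial>lborel)"
proof -
  define \<sigma> where "\<sigma> = (\<lambda>p :: (complex ^ 'n) \<times> complex. (- fst p, snd p))"
  have w': "- w \<in> ball 0 1" using w by simp
  have lin: "linear (boost w)" "linear (boost (- w))"
    using boost_pseudo_unitary[OF w] boost_pseudo_unitary[OF w'] by (simp_all add: pseudo_unitary_linear)
  have inv: "boost w (boost (- w) p) = p" for p using boost_inverse[OF w'] by simp
  obtain k where k: "distr lborel borel (boost w) = scale_measure k lborel"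
    using distr_lborel_linear[OF lin inv] .
  have [measurable]: "boost w \<in> borel_measurable borel" "boost (- w) \<in> borel_measurable borel"
    using lin by (simp_all add: linear_continuous_on linear_linear borel_measurable_continuous_onI)
  have sc: "(\<integral>\<^sup>+p. g (boost w p) \<partial>lborel) = k * (\<integral>\<^sup>+p. g p \<partial>lborel)" if [measurable]: "g \<in> borel_measurable borel" for g
    using arg_cong[OF k, of "\<lambda>M. nn_integral M g"]
    by (simp add: nn_integral_distr nn_integral_scale_measure)
  have ls: "linear \<sigma>" by (rule linearI) (auto simp: \<sigma>_def)
  have [measurable]: "\<sigma> \<in> borel_measurable borel"
    using ls by (simp add: linear_continuous_on linear_linear borel_measurable_continuous_onI)
  have si: "(\<integral>\<^sup>+p. g (\<sigma> p) \<partial>lborel) = (\<integral>\<^sup>+p. g p \<partial>lborel)" if [measurable]: "g \<in> borel_measurable borel" for g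
    using nn_integral_lborel_homothety[OF ls ls, of 1 g] by (simp add: \<sigma>_def norm_prod_def)
  have conj: "boost (- w) p = \<sigma> (boost w (\<sigma> p))" for p
    by (simp add: \<sigma>_def boost_def gam_def cip_minus_left cip_minus_right vec_eq_iff)
  define u where "u = (indicator (ball 0 1) :: (complex ^ 'n) \<times> complex \<Rightarrow> ennreal)"
  have um [measurable]: "u \<in> borel_measurable borel" unfolding u_def by (intro borel_measurable_indicator borel_open open_ball)
  have "(\<integral>\<^sup>+p. u p \<partial>lborel) = (\<integral>\<^sup>+p. u (boost (- w) (boost w p)) \<partial>lborel)"
    by (simp add: boost_inverse[OF w])
  also have "\<dots> = k * (\<integral>\<^sup>+p. u (\<sigma> (boost w (\<sigma> p))) \<partial>lborel)"
    by (subst sc) (simp_all add: conj)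
  also have "\<dots> = k * (k * (\<integral>\<^sup>+p. u p \<partial>lborel))"
    using si[of "\<lambda>p. u (\<sigma> (boost w p))"] sc[of "\<lambda>p. u (\<sigma> p)"] si[of u] by simp
  finally have "(k * k) * (\<integral>\<^sup>+p. u p \<partial>lborel) = 1 * (\<integral>\<^sup>+p. u p \<partial>lborel)" by (simp add: mult.assoc)
  then have "k * k = 1"
    using emeasure_lborel_unit_ball[where 'a="(complex ^ 'n) \<times> complex"]
    unfolding u_def nn_integral_indicator[OF sets_lborel[THEN equalityD2, THEN subsetD, OF open_ball[THEN borel_open]]]
    by (metis mult_divide_eq_ennreal infinity_ennreal_def)
  then have "k = 1"
    by (cases k) (auto simp: ennreal_power ennreal_eq_1 power2_eq_1_iff simp flip: power2_eq_square)
  then show ?thesis using sc[of f] by simp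
qed

text \<open>Composing T with the boost that takes the image of 0 back to 0 gives a map U fixing the
  line of \<open>(0, 1)\<close> and, by orthogonality for the form, its complement. Such a U
  preserves the Euclidean norm, so T is a boost after an isometry, and both preserve the Lebesgue
  measure.\<close>

lemma nn_integral_lborel_pseudo_unitary:
  fixes T :: "(complex ^ ('n::finite)) \<times> complex \<Rightarrow> (complex ^ 'n) \<times> complex"
  assumes T: "pseudo_unitary T" and [measurable]: "f \<in> borel_measurable borel"
  shows "(\<integral>\<^sup>+p. f (T p) \<partial>lborel) = (\<integral>\<^sup>+p. f p \<partial>lborel)"
proof -
  define w where "w = pact T 0"
  have w: "w \<in> ball 0 1" unfolding w_def by (rule pact_in_ball[OF T]) simp
  have w': "- w \<in> ball 0 1" using w by simp
  define U where "U = (\<lambda>p. boost (- w) (T p))"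
  have U: "pseudo_unitary U" unfolding U_def by (rule pseudo_unitary_compose[OF boost_pseudo_unitary[OF w'] T])
  have "pact U 0 = 0"
    unfolding U_def using pact_compose[OF boost_pseudo_unitary[OF w'] T, of 0] pact_boost_uminus[OF w]
    by (simp add: w_def)
  define \<eta> where "\<eta> = pden U 0"
  have U01: "U (0, 1) = (0, \<eta>)"
    using pact_cscale[OF U, of 0] \<open>pact U 0 = 0\<close> by (simp add: cscale_def \<eta>_def)
  have "(norm \<eta>)\<^sup>2 = 1" using pseudo_unitary_norms[OF U, of "(0, 1)"] by (simp add: U01)
  then have n\<eta>: "norm \<eta> = 1" by (simp add: power2_eq_1_iff) (smt (verit) norm_ge_zero)
  have nU: "norm (U p) = 1 * norm p" for p
  proof -
    obtain x \<xi> where p: "p = (x, \<xi>)" by (cases p)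
    \<comment> \<open>Orthogonality to \<open>(0, 1)\<close> is preserved, and
      \<open>U (0, 1)\<close> has only a last coordinate; hence U maps vectors with last coordinate
      0 to such vectors.\<close>
    have "hform (U (x, 0)) (U (0, 1)) = 0"
      unfolding pseudo_unitaryD(3)[OF U] by (simp add: hform_def)
    then have s0: "snd (U (x, 0)) = 0" using n\<eta> unfolding U01 by (auto simp: hform_def)
    have f0: "(norm (fst (U (x, 0))))\<^sup>2 = (norm x)\<^sup>2" using pseudo_unitary_norms[OF U, of "(x, 0)"] s0 by simp
    have "U p = U (x, 0) + U (cscale \<xi> (0, 1))" by (simp add: p cscale_def flip: pseudo_unitaryD(1)[OF U])
    also have "\<dots> = (fst (U (x, 0)), \<xi> * \<eta>)"
      unfolding pseudo_unitaryD(2)[OF U] U01 using s0 by (simp add: cscale_def prod_eq_iff)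
    finally show ?thesis using f0 n\<eta> by (simp add: p norm_prod_def norm_mult)
  qed
  obtain S where S: "pseudo_unitary S" "\<And>p. U (S p) = p" using pseudo_unitary_inverse[OF U] by metis
  have lin: "linear T" "linear (boost w)" "linear U"
    using T U boost_pseudo_unitary[OF w] by (simp_all add: pseudo_unitary_linear)
  have [measurable]: "boost w \<in> borel_measurable borel" "U \<in> borel_measurable borel"
    using lin by (simp_all add: linear_continuous_on linear_linear borel_measurable_continuous_onI)
  have TU: "T p = boost w (U p)" for p using boost_inverse[OF w'] by (simp add: U_def)
  have "(\<integral>\<^sup>+p. f (T p) \<partial>lborel) = (\<integral>\<^sup>+p. f (boost w p) \<partial>lborel)"
    unfolding TU
    using nn_integral_lborel_homothety[OF lin(3) pseudo_unitary_linear[OF S(1)] S(2) _ nU, of "\<lambda>p. f (boost w p)"]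
    by simp
  also have "\<dots> = (\<integral>\<^sup>+p. f p \<partial>lborel)" by (rule nn_integral_lborel_boost[OF w]) simp
  finally show ?thesis .
qed

section \<open>The invariant measure on the ball\<close>

lemma borel_measurable_smult [measurable (raw)]:
  fixes g :: "'a \<Rightarrow> complex ^ ('n::finite)"
  assumes [measurable]: "f \<in> borel_measurable M" "g \<in> borel_measurable M"
  shows "(\<lambda>x. f x *s g x) \<in> borel_measurable M"
  by (rule borel_measurable_continuous_Pair[OF assms]) (intro continuous_intros)

lemma borel_measurable_cip [measurable (raw)]:
  fixes g :: "'a \<Rightarrow> complex ^ ('n::finite)"
  assumes [measurable]: "f \<in> borel_measurable M" "g \<in> borel_measurable M"
  shows "(\<lambda>x. cip (f x) (g x)) \<in> borel_measurable M"
  by (rule borel_measurable_continuous_Pair[OF assms]) (intro continuous_intros)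

lemma borel_measurable_pden:
  fixes T :: "(complex ^ ('n::finite)) \<times> complex \<Rightarrow> (complex ^ 'n) \<times> complex"
  assumes "pseudo_unitary T"
  shows "pden T \<in> borel_measurable borel"
  by (intro borel_measurable_continuous_onI continuous_on_pden assms)

lemma borel_measurable_pact:
  fixes T :: "(complex ^ ('n::finite)) \<times> complex \<Rightarrow> (complex ^ 'n) \<times> complex"
  assumes "pseudo_unitary T"
  shows "pact T \<in> borel_measurable borel"
proof -
  have [measurable]: "(\<lambda>z. fst (T (z, 1))) \<in> borel_measurable borel"
    by (intro borel_measurable_continuous_onI continuous_intros continuous_on_linear_pair[OF pseudo_unitary_linear[OF assms]])
  note [measurable] = borel_measurable_pden[OF assms]
  show ?thesis unfolding pact_def[abs_def] by measurable
qed

lemma ennreal_mult_right_cancel':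
  fixes a b c :: ennreal
  assumes "a * c = b * c" "c \<noteq> 0" "c \<noteq> \<infinity>"
  shows "a = b"
  using assms by (metis mult_divide_eq_ennreal infinity_ennreal_def)

lemma gam_measurable [measurable]: "(gam :: complex ^ ('n::finite) \<Rightarrow> real) \<in> borel_measurable borel"
  unfolding gam_def[abs_def] by measurable

lemma unit_ball_sets [measurable]: "ball (0 :: complex ^ ('n::finite)) 1 \<in> sets borel"
  by simp

text \<open>The form is invariant, so the shell is too. The two bounds cut off the scaling
  direction, along which the integral over the whole cone diverges.\<close>

definition shell :: "((complex ^ ('n::finite)) \<times> complex) set" where
  "shell = {p. 1 < (norm (snd p))\<^sup>2 - (norm (fst p))\<^sup>2 \<and> (norm (snd p))\<^sup>2 - (norm (fst p))\<^sup>2 < 4}"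

lemma sets_shell [measurable]: "shell \<in> sets borel"
  unfolding shell_def by (intro borel_open open_Collect_conj open_Collect_less continuous_intros)

lemma borel_measurable_shell_function:
  fixes F :: "complex ^ ('n::finite) \<Rightarrow> ennreal"
  assumes [measurable]: "F \<in> borel_measurable borel"
  shows "(\<lambda>p. F (inverse (snd p) *s fst p) * indicator shell p) \<in> borel_measurable borel"
proof -
  have [measurable]: "fst \<in> borel_measurable (borel :: ((complex ^ 'n) \<times> complex) measure)"
    "snd \<in> borel_measurable (borel :: ((complex ^ 'n) \<times> complex) measure)"
    by (intro borel_measurable_continuous_onI continuous_intros)+
  show ?thesis by measurable
qed

text \<open>The factor contributed by the homogeneous coordinate, with \<open>n\<close> the real
  dimension of the ball. It is cancelled later, so that only its being positive and finite
  counts.\<close>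

definition shell_const :: "nat \<Rightarrow> ennreal" where
  "shell_const n = (\<integral>\<^sup>+\<zeta>. ennreal (norm (\<zeta>::complex) ^ n) * indicator {\<zeta>. 1 < (norm \<zeta>)\<^sup>2 \<and> (norm \<zeta>)\<^sup>2 < 4} \<zeta> \<partial>lborel)"

lemma sets_annulus [measurable]: "{\<zeta>::complex. 1 < (norm \<zeta>)\<^sup>2 \<and> (norm \<zeta>)\<^sup>2 < 4} \<in> sets borel"
proof -
  have "open {\<zeta>::complex. 1 < (norm \<zeta>)\<^sup>2 \<and> (norm \<zeta>)\<^sup>2 < 4}"
    by (intro open_Collect_conj open_Collect_less continuous_intros)
  then show ?thesis by simp
qed

lemma shell_const_bounds: "shell_const n \<noteq> 0" "shell_const n \<noteq> \<infinity>"
proof -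
  \<comment> \<open>A disc inside the annulus 1 < |\<zeta>| < 2, where the integrand is at least
    1.\<close>
  have sub: "ball (3/2::complex) (1/2) \<subseteq> {\<zeta>. 1 < (norm \<zeta>)\<^sup>2 \<and> (norm \<zeta>)\<^sup>2 < 4}"
  proof
    fix \<zeta> :: complex assume "\<zeta> \<in> ball (3/2) (1/2)"
    then have d: "norm (3/2 - \<zeta>) < 1/2" by (simp add: dist_norm)
    have "norm (3/2::complex) = 3/2" by simp
    then have "1 < norm \<zeta>" "norm \<zeta> < 2"
      using d norm_triangle_ineq2[of "3/2" \<zeta>] norm_triangle_ineq2[of \<zeta> "3/2"] by (simp_all add: norm_minus_commute)
    then show "\<zeta> \<in> {\<zeta>. 1 < (norm \<zeta>)\<^sup>2 \<and> (norm \<zeta>)\<^sup>2 < 4}"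
      using power_strict_mono[of "norm \<zeta>" 2 2] by (simp add: one_less_power)
  qed
  have "0 < emeasure lborel (ball (3/2::complex) (1/2))"
    by (simp add: emeasure_ball zero_less_mult_iff)
  also have "\<dots> = (\<integral>\<^sup>+\<zeta>. indicator (ball (3/2::complex) (1/2)) \<zeta> \<partial>lborel)" by simp
  also have "\<dots> \<le> shell_const n"
    unfolding shell_const_def
  proof (intro nn_integral_mono)
    fix \<zeta> :: complex
    have "1 \<le> norm \<zeta> ^ n" if "1 < (norm \<zeta>)\<^sup>2"
      using that by (metis one_le_power less_imp_le norm_ge_zero one_power2 power2_le_imp_le)
    then show "indicator (ball (3/2) (1/2)) \<zeta> \<le> ennreal (norm \<zeta> ^ n) * indicator {\<zeta>. 1 < (norm \<zeta>)\<^sup>2 \<and> (norm \<zeta>)\<^sup>2 < 4} \<zeta>"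
      using sub by (auto simp: indicator_def subset_iff ennreal_ge_1)
  qed
  finally show "shell_const n \<noteq> 0" by simp
  have "shell_const n \<le> (\<integral>\<^sup>+\<zeta>. ennreal (2 ^ n) * indicator (ball (0::complex) 2) \<zeta> \<partial>lborel)"
    unfolding shell_const_def
  proof (intro nn_integral_mono)
    fix \<zeta> :: complex
    have "norm \<zeta> < 2" if "(norm \<zeta>)\<^sup>2 < 4"
      using that power2_less_imp_less[of "norm \<zeta>" 2] by simp
    then show "ennreal (norm \<zeta> ^ n) * indicator {\<zeta>. 1 < (norm \<zeta>)\<^sup>2 \<and> (norm \<zeta>)\<^sup>2 < 4} \<zeta> \<le> ennreal (2 ^ n) * indicator (ball 0 2) \<zeta>"
      by (auto simp: indicator_def intro!: ennreal_leI power_mono)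
  qed
  also have "\<dots> = ennreal (2 ^ n) * emeasure lborel (ball (0::complex) 2)"
    by (rule nn_integral_cmult_indicator) simp
  also have "\<dots> < \<infinity>" using emeasure_lborel_ball_finite[of "0::complex" 2]
    by (simp add: ennreal_mult_less_top)
  finally show "shell_const n \<noteq> \<infinity>" by simp
qed

text \<open>Integrating a function of \<open>x / \<zeta>\<close> over the shell \<open>1 < |\<zeta>|^2 - |x|^2 < 4\<close>, on which the
  linear group acts, produces the invariant measure of the ball.\<close>
lemma nn_integral_shell:
  fixes F :: "complex ^ ('n::finite) \<Rightarrow> ennreal"
  assumes [measurable]: "F \<in> borel_measurable borel"
  shows "(\<integral>\<^sup>+p. F (inverse (snd p) *s fst p) * indicator shell p \<partial>lborel) =
    shell_const (2 * CARD('n)) * (\<integral>\<^sup>+z. F z * (indicator (ball 0 1) z * ennreal (gam z ^ (2 * CARD('n) + 2))) \<partial>lborel)"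
proof -
  define G where "G = (\<lambda>p::(complex ^ 'n) \<times> complex. F (inverse (snd p) *s fst p) * indicator shell p)"
  have "G \<in> borel_measurable borel" unfolding G_def by (rule borel_measurable_shell_function) simp
  then have Gm [measurable]: "G \<in> borel_measurable (lborel \<Otimes>\<^sub>M lborel)"
    unfolding lborel_prod by simp
  \<comment> \<open>The density after the substitution x = \<zeta> z in a slice of fixed \<zeta>:
    the power of |\<zeta>| is the real Jacobian in dimension 2n, and the shell condition becomes a
    condition on |\<zeta>|^2 (1 - |z|^2).\<close>
  define h where "h = (\<lambda>(z::complex^'n) \<zeta>. ennreal (norm \<zeta> ^ (2 * CARD('n))) *
     indicator {\<zeta>::complex. 1 < (norm \<zeta>)\<^sup>2 * (1 - (norm z)\<^sup>2) \<and> (norm \<zeta>)\<^sup>2 * (1 - (norm z)\<^sup>2) < 4} \<zeta>)"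
  have "open {p::(complex^'n) \<times> complex. 1 < (norm (snd p))\<^sup>2 * (1 - (norm (fst p))\<^sup>2) \<and> (norm (snd p))\<^sup>2 * (1 - (norm (fst p))\<^sup>2) < 4}"
    by (intro open_Collect_conj open_Collect_less continuous_intros)
  then have sm: "{p::(complex^'n) \<times> complex. 1 < (norm (snd p))\<^sup>2 * (1 - (norm (fst p))\<^sup>2) \<and> (norm (snd p))\<^sup>2 * (1 - (norm (fst p))\<^sup>2) < 4} \<in> sets borel"
    by simp
  have "(\<lambda>p::(complex^'n) \<times> complex. ennreal (norm (snd p) ^ (2 * CARD('n))) *
    indicator {p. 1 < (norm (snd p))\<^sup>2 * (1 - (norm (fst p))\<^sup>2) \<and> (norm (snd p))\<^sup>2 * (1 - (norm (fst p))\<^sup>2) < 4} p) \<in> borel_measurable borel"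
    by (intro borel_measurable_times_ennreal measurable_compose[OF _ measurable_ennreal] borel_measurable_indicator sm
        borel_measurable_continuous_onI continuous_intros)
  then have hm: "(\<lambda>p. h (fst p) (snd p)) \<in> borel_measurable (lborel \<Otimes>\<^sub>M lborel)"
    unfolding lborel_prod by (simp add: h_def indicator_def)
  have hm' [measurable]: "(\<lambda>(z, \<zeta>). h z \<zeta>) \<in> borel_measurable (lborel \<Otimes>\<^sub>M lborel)"
    using hm by (simp add: case_prod_beta')
  have hz [measurable]: "h z \<in> borel_measurable borel" for z
    using measurable_Pair2[OF hm'] by simp
  have sl: "(\<integral>\<^sup>+x. G (x, \<zeta>) \<partial>lborel) = (\<integral>\<^sup>+z. F z * h z \<zeta> \<partial>lborel)" for \<zeta>
  proof (cases "\<zeta> = 0")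
    case True
    have "G (x, \<zeta>) = 0" for x using True by (auto simp: G_def shell_def indicator_def) (smt (verit) zero_le_power2)
    moreover have "h z \<zeta> = 0" for z using True by (simp add: h_def)
    ultimately show ?thesis by simp
  next
    case False
    have [measurable]: "(\<lambda>x. G (x, \<zeta>)) \<in> borel_measurable borel"
      using measurable_Pair1[OF Gm] by simp
    have l: "linear (\<lambda>z::complex^'n. c *s z)" for c
      by (rule linearI) (simp_all add: vec_eq_iff algebra_simps)
    have pt: "ennreal (norm \<zeta> ^ DIM(complex^'n)) * G (\<zeta> *s z, \<zeta>) = F z * h z \<zeta>" for z
    proof -
      have "inverse \<zeta> *s (\<zeta> *s z) = z" using False by (simp add: vec_eq_iff)
      moreover have "(norm \<zeta>)\<^sup>2 - (norm (\<zeta> *s z))\<^sup>2 = (norm \<zeta>)\<^sup>2 * (1 - (norm z)\<^sup>2)"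
        by (simp add: norm_vector_smult power_mult_distrib algebra_simps)
      ultimately show ?thesis by (simp add: G_def h_def shell_def indicator_def ac_simps)
    qed
    have "(\<integral>\<^sup>+x. G (x, \<zeta>) \<partial>lborel) = ennreal (norm \<zeta> ^ DIM(complex^'n)) * (\<integral>\<^sup>+z. G (\<zeta> *s z, \<zeta>) \<partial>lborel)"
      by (rule nn_integral_lborel_homothety[OF l[of \<zeta>] l[of "inverse \<zeta>"]])
        (use False in \<open>simp_all add: norm_vector_smult vec_eq_iff\<close>)
    also have "\<dots> = (\<integral>\<^sup>+z. ennreal (norm \<zeta> ^ DIM(complex^'n)) * G (\<zeta> *s z, \<zeta>) \<partial>lborel)"
      by (rule nn_integral_cmult[symmetric]) measurable
    finally show ?thesis unfolding pt .
  qed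
  have hint: "(\<integral>\<^sup>+\<zeta>. h z \<zeta> \<partial>lborel) = shell_const (2 * CARD('n)) * (indicator (ball 0 1) z * ennreal (gam z ^ (2 * CARD('n) + 2)))" for z
  proof (cases "z \<in> ball 0 1")
    case False
    then have "1 - (norm z)\<^sup>2 \<le> 0" by (simp add: one_le_power)
    then have "(norm \<zeta>)\<^sup>2 * (1 - (norm z)\<^sup>2) \<le> 0" for \<zeta> :: complex by (simp add: mult_nonneg_nonpos)
    then have "h z \<zeta> = 0" for \<zeta> unfolding h_def by (smt (verit) indicator_simps(2) mem_Collect_eq mult_zero_right)
    then show ?thesis using False by simp
  next
    case True
    note g = gam_facts[OF True]
    have l: "linear (\<lambda>\<zeta>::complex. c *\<^sub>R \<zeta>)" for c by (rule linearI) (simp_all add: algebra_simps)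
    \<comment> \<open>Scaling \<zeta> by \<open>gam z\<close> makes the annulus independent of z.
      The density contributes 2n powers of \<open>gam z\<close> and the area element two more, which
      explains the exponent 2n + 2.\<close>
    have pt: "h z (gam z *\<^sub>R \<zeta>) = ennreal (gam z ^ (2 * CARD('n))) * (ennreal (norm \<zeta> ^ (2 * CARD('n))) * indicator {\<zeta>. 1 < (norm \<zeta>)\<^sup>2 \<and> (norm \<zeta>)\<^sup>2 < 4} \<zeta>)" for \<zeta>
    proof -
      have "(norm (gam z *\<^sub>R \<zeta>))\<^sup>2 * (1 - (norm z)\<^sup>2) = (norm \<zeta>)\<^sup>2 * ((gam z)\<^sup>2 * (1 - (norm z)\<^sup>2))"
        by (simp add: power_mult_distrib)
      then have "(norm (gam z *\<^sub>R \<zeta>))\<^sup>2 * (1 - (norm z)\<^sup>2) = (norm \<zeta>)\<^sup>2" unfolding g(5) by (simp only: mult_1_right)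
      then show ?thesis using g(1) unfolding h_def indicator_def mem_Collect_eq \<open>_ = (norm \<zeta>)\<^sup>2\<close>
        by (simp add: power_mult_distrib ennreal_mult mult.assoc)
    qed
    have "(\<integral>\<^sup>+\<zeta>. h z \<zeta> \<partial>lborel) = ennreal (gam z ^ DIM(complex)) * (\<integral>\<^sup>+\<zeta>. h z (gam z *\<^sub>R \<zeta>) \<partial>lborel)"
      by (rule nn_integral_lborel_homothety[OF l[of "gam z"] l[of "inverse (gam z)"]]) (use g(1) in simp_all)
    also have "\<dots> = ennreal (gam z ^ 2) * (ennreal (gam z ^ (2 * CARD('n))) * shell_const (2 * CARD('n)))"
      unfolding pt shell_const_def by (subst nn_integral_cmult) simp_all
    finally have i: "(\<integral>\<^sup>+\<zeta>. h z \<zeta> \<partial>lborel) = \<dots>" .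
    have p: "ennreal (gam z ^ (2 * CARD('n) + 2)) = ennreal (gam z ^ 2) * ennreal (gam z ^ (2 * CARD('n)))"
      using g(1) by (simp add: ennreal_mult'[symmetric] power_add mult.commute power2_eq_square)
    show ?thesis unfolding i p using True by (simp add: ac_simps)
  qed
  have "(\<integral>\<^sup>+p. G p \<partial>lborel) = (\<integral>\<^sup>+p. G p \<partial>(lborel \<Otimes>\<^sub>M lborel))" by (simp add: lborel_prod)
  also have "\<dots> = (\<integral>\<^sup>+\<zeta>. (\<integral>\<^sup>+x. G (x, \<zeta>) \<partial>lborel) \<partial>lborel)"
    by (rule lborel_pair.nn_integral_snd[symmetric]) simp
  also have "\<dots> = (\<integral>\<^sup>+\<zeta>. (\<integral>\<^sup>+z. F z * h z \<zeta> \<partial>lborel) \<partial>lborel)" unfolding sl ..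
  also have "\<dots> = (\<integral>\<^sup>+z. (\<integral>\<^sup>+\<zeta>. F z * h z \<zeta> \<partial>lborel) \<partial>lborel)"
    by (rule lborel_pair.Fubini') measurable
  also have "\<dots> = (\<integral>\<^sup>+z. shell_const (2 * CARD('n)) * (F z * (indicator (ball 0 1) z * ennreal (gam z ^ (2 * CARD('n) + 2)))) \<partial>lborel)"
    by (rule nn_integral_cong) (simp add: nn_integral_cmult hint ac_simps)
  also have "\<dots> = shell_const (2 * CARD('n)) * (\<integral>\<^sup>+z. F z * (indicator (ball 0 1) z * ennreal (gam z ^ (2 * CARD('n) + 2))) \<partial>lborel)"
    by (rule nn_integral_cmult) measurable
  finally show ?thesis unfolding G_def .
qed

text \<open>The density is (1 - |z|^2) to the power - (n + 1), the Bergman volume. T preserves the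
  shell and the Lebesgue measure and covers the action on the quotient x / \<zeta>, so both sides
  are the same shell integral up to the constant.\<close>

lemma nn_integral_ball_invariant:
  fixes F :: "complex ^ ('n::finite) \<Rightarrow> ennreal"
  assumes T: "pseudo_unitary T" and [measurable]: "F \<in> borel_measurable borel"
  shows "(\<integral>\<^sup>+z. F (pact T z) * (indicator (ball 0 1) z * ennreal (gam z ^ (2 * CARD('n) + 2))) \<partial>lborel) =
    (\<integral>\<^sup>+z. F z * (indicator (ball 0 1) z * ennreal (gam z ^ (2 * CARD('n) + 2))) \<partial>lborel)" (is "?L = ?R")
proof -
  note [measurable] = borel_measurable_pact[OF T]
  have pt: "F (pact T (inverse (snd p) *s fst p)) * indicator shell p =
      F (inverse (snd (T p)) *s fst (T p)) * indicator shell (T p)" for p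
  proof (cases "p \<in> shell")
    case True
    define z where "z = inverse (snd p) *s fst p"
    have nz: "snd p \<noteq> 0" using True unfolding shell_def mem_Collect_eq by (smt (verit) norm_zero power_zero_numeral zero_le_power2)
    have "(norm (fst p))\<^sup>2 < (norm (snd p))\<^sup>2" using True by (simp add: shell_def)
    then have "norm (fst p) < norm (snd p)" by (simp add: power2_less_imp_less)
    moreover have "norm z = norm (fst p) / norm (snd p)" by (simp add: z_def norm_vector_smult norm_inverse divide_inverse mult.commute)
    ultimately have z: "z \<in> ball 0 1" using nz by simp
    have p: "p = cscale (snd p) (z, 1)" using nz by (simp add: cscale_def z_def prod_eq_iff vec_eq_iff)
    have "T p = cscale (snd p) (T (z, 1))" using pseudo_unitaryD(2)[OF T] p by metis
    then have "inverse (snd (T p)) *s fst (T p) = pact T z"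
      using nz pden_nonzero[OF T z] by (simp add: cscale_def pact_def pden_def vec_eq_iff)
    moreover have "T p \<in> shell" using True by (simp add: shell_def pseudo_unitary_norms[OF T])
    ultimately show ?thesis using True by (simp add: z_def)
  next
    case False
    then have "T p \<notin> shell" by (simp add: shell_def pseudo_unitary_norms[OF T])
    then show ?thesis using False by simp
  qed
  have "shell_const (2 * CARD('n)) * ?L = (\<integral>\<^sup>+p. F (inverse (snd (T p)) *s fst (T p)) * indicator shell (T p) \<partial>lborel)"
    unfolding pt[symmetric] by (rule nn_integral_shell[symmetric]) simp
  also have "\<dots> = (\<integral>\<^sup>+p. F (inverse (snd p) *s fst p) * indicator shell p \<partial>lborel)"
    by (rule nn_integral_lborel_pseudo_unitary[OF T borel_measurable_shell_function[OF assms(2)]])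
  also have "\<dots> = shell_const (2 * CARD('n)) * ?R" by (rule nn_integral_shell) simp
  finally have "?L * shell_const (2 * CARD('n)) = ?R * shell_const (2 * CARD('n))" by (simp add: mult.commute)
  then show ?thesis by (rule ennreal_mult_right_cancel'[OF _ shell_const_bounds])
qed

section \<open>The weight and its total mass\<close>

definition wball :: "real \<Rightarrow> complex ^ ('n::finite) \<Rightarrow> real" where
  "wball s z = indicator (ball 0 1) z * bergman_weight s z"

lemma wball_measurable [measurable]: "(wball s :: complex ^ ('n::finite) \<Rightarrow> real) \<in> borel_measurable borel"
proof -
  have [measurable]: "ball (0 :: complex ^ 'n) 1 \<in> sets borel" by simp
  show ?thesis unfolding wball_def[abs_def] bergman_weight_def by measurable
qed

lemma wball_nonneg: "wball s z \<ge> 0"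
  by (simp add: wball_def bergman_weight_def)

lemma wball_pos: "z \<in> ball 0 1 \<Longrightarrow> wball s z > 0"
  using norm_sq_less_1[of z] by (simp add: wball_def bergman_weight_def)

text \<open>Splits the exponent s - n - 1: the invariant density accounts for - n - 1, and the
  remaining power s transforms by \<open>one_minus_norm_pact\<close>.\<close>

lemma wball_eq:
  fixes z :: "complex ^ ('n::finite)"
  assumes "z \<in> ball 0 1"
  shows "wball s z = (1 - (norm z)\<^sup>2) powr s * gam z ^ (2 * CARD('n) + 2)"
proof -
  define t where "t = 1 - (norm z)\<^sup>2"
  have t: "t > 0" using assms norm_sq_less_1[of z] by (simp add: t_def)
  have g2: "(gam z)\<^sup>2 = 1 / t" using t by (simp add: gam_def t_def power_divide)
  have "gam z ^ (2 * CARD('n) + 2) = ((gam z)\<^sup>2) ^ (CARD('n) + 1)" unfolding power_mult[symmetric] by simp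
  also have "\<dots> = (1 / t) powr real (CARD('n) + 1)" unfolding g2 using t by (subst powr_realpow) auto
  also have "\<dots> = t powr (- real (CARD('n) + 1))" using t by (simp only: powr_divide powr_one_eq_one powr_minus_divide)
  finally show ?thesis using assms t unfolding wball_def bergman_weight_def t_def[symmetric]
    by (simp add: algebra_simps flip: powr_add)
qed

lemma nn_integral_wball_pact:
  fixes F :: "complex ^ ('n::finite) \<Rightarrow> ennreal"
  assumes T: "pseudo_unitary T" and [measurable]: "F \<in> borel_measurable borel"
  shows "(\<integral>\<^sup>+z. F (pact T z) * (ennreal (norm (pden T z) powr (- 2 * s)) * ennreal (wball s z)) \<partial>lborel) =
    (\<integral>\<^sup>+z. F z * ennreal (wball s z) \<partial>lborel)"
proof -
  define H where "H = (\<lambda>z::complex^'n. F z * ennreal ((1 - (norm z)\<^sup>2) powr s))"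
  have [measurable]: "H \<in> borel_measurable borel" unfolding H_def by measurable
  have "F (pact T z) * (ennreal (norm (pden T z) powr (- 2 * s)) * ennreal (wball s z)) =
      H (pact T z) * (indicator (ball 0 1) z * ennreal (gam z ^ (2 * CARD('n) + 2)))" for z
  proof (cases "z \<in> ball 0 1")
    case True
    have t: "1 - (norm z)\<^sup>2 > 0" using True norm_sq_less_1[of z] by simp
    have d: "norm (pden T z) > 0" using pden_nonzero[OF T True] by simp
    have "(1 - (norm (pact T z))\<^sup>2) powr s = (1 - (norm z)\<^sup>2) powr s / ((norm (pden T z))\<^sup>2) powr s"
      unfolding one_minus_norm_pact[OF T True] using t d by (subst powr_divide) auto
    also have "((norm (pden T z))\<^sup>2) powr s = norm (pden T z) powr (2 * s)"
      using d by (simp add: powr_powr flip: powr_numeral)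
    finally have e: "(1 - (norm (pact T z))\<^sup>2) powr s = norm (pden T z) powr (- 2 * s) * (1 - (norm z)\<^sup>2) powr s"
      by (simp add: powr_minus divide_inverse mult.commute)
    have "ennreal (wball s z) = ennreal ((1 - (norm z)\<^sup>2) powr s) * ennreal (gam z ^ (2 * CARD('n) + 2))"
      unfolding wball_eq[OF True] using gam_facts(1)[OF True] by (simp add: ennreal_mult)
    then show ?thesis unfolding H_def e using True by (simp add: ennreal_mult mult.assoc)
  next
    case False then show ?thesis by (simp add: wball_def)
  qed
  then have "(\<integral>\<^sup>+z. F (pact T z) * (ennreal (norm (pden T z) powr (- 2 * s)) * ennreal (wball s z)) \<partial>lborel) =
     (\<integral>\<^sup>+z. H (pact T z) * (indicator (ball 0 1) z * ennreal (gam z ^ (2 * CARD('n) + 2))) \<partial>lborel)" by simp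
  also have "\<dots> = (\<integral>\<^sup>+z. H z * (indicator (ball 0 1) z * ennreal (gam z ^ (2 * CARD('n) + 2))) \<partial>lborel)"
    by (rule nn_integral_ball_invariant[OF T]) simp
  also have "\<dots> = (\<integral>\<^sup>+z. F z * ennreal (wball s z) \<partial>lborel)"
  proof (rule nn_integral_cong)
    fix z :: "complex^'n"
    show "H z * (indicator (ball 0 1) z * ennreal (gam z ^ (2 * CARD('n) + 2))) = F z * ennreal (wball s z)"
    proof (cases "z \<in> ball 0 1")
      case True
      have "ennreal (wball s z) = ennreal ((1 - (norm z)\<^sup>2) powr s) * ennreal (gam z ^ (2 * CARD('n) + 2))"
        unfolding wball_eq[OF True] using gam_facts(1)[OF True] by (simp add: ennreal_mult)
      then show ?thesis unfolding H_def using True by (simp add: mult.assoc)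
    next
      case False then show ?thesis by (simp add: wball_def)
    qed
  qed
  finally show ?thesis .
qed

section \<open>The weighted measure\<close>

text \<open>In real dimension 2n the ball of radius sqrt (1 - e) has the fraction (1 - e)^n of the
  volume of the unit ball, and Bernoulli bounds the rest by n e.\<close>

lemma emeasure_boundary_layer:
  assumes "0 \<le> e" "e \<le> 1"
  shows "emeasure lborel {z :: complex ^ ('n::finite). norm z < 1 \<and> 1 - (norm z)\<^sup>2 \<le> e}
     \<le> ennreal (unit_ball_vol (real DIM(complex ^ 'n)) * (real CARD('n) * e))"
proof -
  define r where "r = sqrt (1 - e)"
  have r: "0 \<le> r" "r \<le> 1" "r\<^sup>2 = 1 - e" using assms by (simp_all add: r_def)
  have eq: "{z :: complex ^ 'n. norm z < 1 \<and> 1 - (norm z)\<^sup>2 \<le> e} = ball 0 1 - ball 0 r"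
  proof -
    have "1 - (norm z)\<^sup>2 \<le> e \<longleftrightarrow> r \<le> norm z" for z :: "complex ^ 'n"
    proof -
      have "1 - (norm z)\<^sup>2 \<le> e \<longleftrightarrow> r\<^sup>2 \<le> (norm z)\<^sup>2" unfolding r(3) by auto
      also have "\<dots> \<longleftrightarrow> r \<le> norm z" using r(1) by (simp add: power2_le_iff_abs_le)
      finally show ?thesis .
    qed
    then show ?thesis unfolding set_eq_iff by (simp add: not_less)
  qed
  have "r ^ DIM(complex ^ 'n) = (r\<^sup>2) ^ CARD('n)" by (simp add: power_mult[symmetric] mult.commute)
  then have rp: "r ^ DIM(complex ^ 'n) = (1 + (- e)) ^ CARD('n)" unfolding r(3) by simp
  have "emeasure lborel (ball 0 1 - ball (0 :: complex ^ 'n) r) = emeasure lborel (ball (0 :: complex ^ 'n) 1) - emeasure lborel (ball (0 :: complex ^ 'n) r)"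
    using r emeasure_lborel_ball_finite[of "0 :: complex ^ 'n" r] by (intro emeasure_Diff) auto
  also have "\<dots> = ennreal (unit_ball_vol (real DIM(complex ^ 'n)) * (1 - r ^ DIM(complex ^ 'n)))"
    using r by (simp add: emeasure_ball ennreal_minus algebra_simps del: DIM_cart)
  also have "\<dots> \<le> ennreal (unit_ball_vol (real DIM(complex ^ 'n)) * (real CARD('n) * e))"
    unfolding rp using Bernoulli_inequality[of "- e" "CARD('n)"] assms
    by (intro ennreal_leI mult_left_mono) auto
  finally show ?thesis unfolding eq .
qed

text \<open>For a negative exponent the weight is dominated on the dyadic boundary layers.\<close>
lemma nn_integral_wball_finite:
  assumes s: "real CARD('n::finite) < s"
  shows "(\<integral>\<^sup>+z. ennreal (wball s (z :: complex ^ 'n)) \<partial>lborel) < \<infinity>"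
proof (cases "s - real CARD('n) - 1 \<ge> 0")
  case True
  have "(\<integral>\<^sup>+z. ennreal (wball s (z :: complex ^ 'n)) \<partial>lborel) \<le> (\<integral>\<^sup>+z. indicator (ball (0 :: complex ^ 'n) 1) z \<partial>lborel)"
  proof (rule nn_integral_mono)
    fix z :: "complex ^ 'n"
    show "ennreal (wball s z) \<le> indicator (ball 0 1) z"
    proof (cases "z \<in> ball 0 1")
      case in_ball: True
      have "(1 - (norm z)\<^sup>2) powr (s - real CARD('n) - 1) \<le> 1 powr (s - real CARD('n) - 1)"
        using in_ball True norm_sq_less_1[of z] by (intro powr_mono2) auto
      then show ?thesis using in_ball by (simp add: wball_def bergman_weight_def)
    qed (simp add: wball_def)
  qed
  also have "\<dots> < \<infinity>" using emeasure_lborel_ball_finite[of "0 :: complex ^ 'n" 1] by simp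
  finally show ?thesis .
next
  case False
  \<comment> \<open>The weight is t powr (- b) with t = 1 - |z|^2; the assumption s > n gives b < 1,
    which makes the singularity integrable.\<close>
  define b where "b = - (s - real CARD('n) - 1)"
  have b: "0 < b" "b < 1" using False s by (auto simp: b_def)
  define V where "V = unit_ball_vol (real DIM(complex ^ 'n)) * real CARD('n)"
  have V: "V \<ge> 0" by (simp add: V_def)
  define L where "L = (\<lambda>k. {z :: complex ^ 'n. norm z < 1 \<and> 1 - (norm z)\<^sup>2 \<le> (1/2) ^ k})"
  have [measurable]: "L k \<in> sets borel" for k unfolding L_def by measurable
  \<comment> \<open>Layer k has weight at most (2 powr b)^(k+1) where it is needed and volume of
    order 2^(- k), so the series is geometric with this ratio.\<close>
  define q where "q = 2 powr b / 2"
  have q: "0 < q" "q < 1" using b powr_less_mono[of b 1 2] by (simp_all add: q_def)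
  have dom: "ennreal (wball s z) \<le> (\<Sum>k. ennreal ((2 powr b) ^ Suc k) * indicator (L k) z)" for z :: "complex ^ 'n"
  proof (cases "z \<in> ball 0 1")
    case True
    define t where "t = 1 - (norm z)\<^sup>2"
    have t: "0 < t" "t \<le> 1" using True norm_sq_less_1[of z] by (simp_all add: t_def)
    \<comment> \<open>The index k with (1/2)^(k+1) < t \<le> (1/2)^k is selected: the upper bound
      puts z into \<open>L k\<close>, the lower one bounds the weight and causes the exponent
      \<open>Suc k\<close>.\<close>
    obtain k0 where "(1/2::real) ^ k0 < t" using t(1) real_arch_pow_inv[of t "1/2"] by auto
    moreover have "\<not> (1/2::real) ^ 0 < t" using t by simp
    ultimately obtain k where k: "\<not> (1/2) ^ k < t" "(1/2) ^ Suc k < t"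
      using ex_least_nat_less[of "\<lambda>k. (1/2) ^ k < t"] by blast
    have "wball s z = t powr (- b)" using True by (simp add: wball_def bergman_weight_def t_def b_def)
    also have "\<dots> \<le> ((1/2) ^ Suc k) powr (- b)" using k b by (intro powr_mono2') auto
    also have "\<dots> = (2 powr b) ^ Suc k"
    proof -
      have "((1/2::real) ^ Suc k) powr (- b) = ((1/2) powr real (Suc k)) powr (- b)" by (subst powr_realpow) auto
      also have "\<dots> = ((1/2) powr (-b)) powr real (Suc k)" by (simp add: powr_powr mult.commute)
      also have "(1/2::real) powr (- b) = 2 powr b" by (simp only: powr_minus_divide powr_divide powr_one_eq_one) simp
      also have "(2 powr b) powr real (Suc k) = (2 powr b) ^ Suc k" by (subst powr_realpow) auto
      finally show ?thesis .
    qed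
    finally have "ennreal (wball s z) \<le> ennreal ((2 powr b) ^ Suc k)" by (rule ennreal_leI)
    also have "\<dots> = (\<Sum>i\<in>{k}. ennreal ((2 powr b) ^ Suc i) * indicator (L i) z)"
      using True k by (simp add: L_def t_def indicator_def)
    also have "\<dots> \<le> (\<Sum>k. ennreal ((2 powr b) ^ Suc k) * indicator (L k) z)"
      by (rule sum_le_suminf) auto
    finally show ?thesis .
  qed (simp add: wball_def)
  have "(\<integral>\<^sup>+z. ennreal (wball s (z :: complex ^ 'n)) \<partial>lborel) \<le> (\<integral>\<^sup>+z. (\<Sum>k. ennreal ((2 powr b) ^ Suc k) * indicator (L k) z) \<partial>lborel)"
    by (intro nn_integral_mono dom)
  also have "\<dots> = (\<Sum>k. ennreal ((2 powr b) ^ Suc k) * emeasure lborel (L k))"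
    by (subst nn_integral_suminf) (auto intro!: suminf_cong nn_integral_cmult_indicator)
  also have "\<dots> \<le> (\<Sum>k. ennreal (V * 2 powr b * q ^ k))"
  proof (intro suminf_le)
    fix k
    have "emeasure lborel (L k) \<le> ennreal (V * (1/2) ^ k)"
      unfolding L_def V_def using emeasure_boundary_layer[where 'n='n, of "(1/2) ^ k"]
      by (simp add: power_le_one mult.assoc)
    then have "ennreal ((2 powr b) ^ Suc k) * emeasure lborel (L k) \<le> ennreal ((2 powr b) ^ Suc k) * ennreal (V * (1/2) ^ k)"
      by (rule mult_left_mono) simp
    also have "\<dots> = ennreal (V * 2 powr b * q ^ k)"
      using V by (simp add: q_def ennreal_mult[symmetric] power_divide power_one_over ac_simps)
    finally show "ennreal ((2 powr b) ^ Suc k) * emeasure lborel (L k) \<le> ennreal (V * 2 powr b * q ^ k)" .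
  qed auto
  also have "\<dots> = ennreal (\<Sum>k. V * 2 powr b * q ^ k)"
    using q V by (intro suminf_ennreal2 summable_mult summable_geometric) auto
  also have "\<dots> < \<infinity>" by simp
  finally show ?thesis .
qed

text \<open>The type argument carries the dimension, which the value does not show.\<close>

definition wmass :: "real \<Rightarrow> ('n::finite) itself \<Rightarrow> real" where
  "wmass s _ = enn2real (\<integral>\<^sup>+z. ennreal (wball s (z :: complex ^ 'n)) \<partial>lborel)"

lemma ennreal_wmass:
  assumes s: "real CARD('n::finite) < s"
  shows "(\<integral>\<^sup>+z. ennreal (wball s (z :: complex ^ 'n)) \<partial>lborel) = ennreal (wmass s TYPE('n))"
    and "wmass s TYPE('n) > 0"
proof -
  show eq: "(\<integral>\<^sup>+z. ennreal (wball s (z :: complex ^ 'n)) \<partial>lborel) = ennreal (wmass s TYPE('n))"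
    using nn_integral_wball_finite[OF s] by (simp add: wmass_def)
  have "(\<integral>\<^sup>+z. ennreal (wball s (z :: complex ^ 'n)) \<partial>lborel) \<noteq> 0"
  proof
    assume "(\<integral>\<^sup>+z. ennreal (wball s (z :: complex ^ 'n)) \<partial>lborel) = 0"
    then have "AE z in lborel. ennreal (wball s (z :: complex ^ 'n)) = 0"
      by (subst (asm) nn_integral_0_iff_AE) auto
    then have "AE z in lborel. (z :: complex ^ 'n) \<notin> ball 0 1"
      by eventually_elim (metis ennreal_eq_0_iff not_le wball_pos)
    then have "emeasure lborel (ball (0 :: complex ^ 'n) 1) = 0"
      by (subst (asm) AE_iff_measurable[OF _ refl]) (auto simp: ball_def)
    then show False using emeasure_lborel_unit_ball(1) by blast
  qed
  then show "wmass s TYPE('n) > 0" unfolding eq using not_le by (auto simp: ennreal_eq_0_iff)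
qed

section \<open>The normalized measure and its transformation law\<close>

definition wdens :: "real \<Rightarrow> complex ^ ('n::finite) \<Rightarrow> real" where
  "wdens s z = wball s z / wmass s TYPE('n)"

lemma wdens_measurable [measurable]: "(wdens s :: complex ^ ('n::finite) \<Rightarrow> real) \<in> borel_measurable borel"
  unfolding wdens_def[abs_def] by measurable

lemma wdens_pos: "real CARD('n::finite) < s \<Longrightarrow> (z :: complex ^ 'n) \<in> ball 0 1 \<Longrightarrow> wdens s z > 0"
  using ennreal_wmass(2)[where 'n='n and s=s] wball_pos[of z s] by (simp add: wdens_def)

lemma wdens_eq_0: "z \<notin> ball 0 1 \<Longrightarrow> wdens s z = 0"
  by (simp add: wdens_def wball_def)

lemma nn_integral_wdens:
  assumes s: "real CARD('n::finite) < s"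
  shows "(\<integral>\<^sup>+z. ennreal (wdens s (z :: complex ^ 'n)) \<partial>lborel) = 1"
proof -
  have "ennreal (wdens s z) = ennreal (wball s z) / ennreal (wmass s TYPE('n))" for z :: "complex ^ 'n"
    using ennreal_wmass(2)[OF s] by (simp add: wdens_def divide_ennreal wball_nonneg)
  then show ?thesis using ennreal_wmass[OF s]
    by (simp add: nn_integral_divide ennreal_divide_self)
qed

text \<open>The volume V of the ball enters both through the normalized Lebesgue measure and through
  the integral of the weight against it, and cancels.\<close>

lemma bergman_measure_eq:
  assumes s: "real CARD('n::finite) < s"
  shows "(bergman_measure s :: (complex ^ 'n) measure) = density lebesgue (\<lambda>z. ennreal (wdens s z))"
proof -
  define v where "v = uniform_measure lebesgue (ball (0 :: complex ^ 'n) 1)"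
  define V where "V = measure lborel (ball (0 :: complex ^ 'n) 1)"
  have V: "emeasure lebesgue (ball (0 :: complex ^ 'n) 1) = ennreal V" "V > 0"
    using emeasure_lborel_unit_ball[where 'a="complex ^ 'n"]
    by (simp_all add: V_def emeasure_eq_ennreal_measure)
  have [measurable]: "bergman_weight s \<in> borel_measurable (lborel :: (complex ^ 'n) measure)"
    unfolding bergman_weight_def[abs_def] by measurable
  then have [measurable]: "bergman_weight s \<in> borel_measurable (lebesgue :: (complex ^ 'n) measure)"
    by (rule measurable_completion)
  have [measurable]: "ball (0 :: complex ^ 'n) 1 \<in> sets lebesgue" by auto
  have v: "v = density lebesgue (\<lambda>z. ennreal (indicator (ball 0 1) z / V))"
    unfolding v_def uniform_measure_def V(1) using V(2)
    by (intro arg_cong2[where f=density] ext refl)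
       (auto simp: indicator_def divide_ennreal simp flip: ennreal_1)
  have "(\<integral>\<^sup>+z. ennreal (bergman_weight s z) \<partial>v) = (\<integral>\<^sup>+z. ennreal (wball s (z :: complex ^ 'n) / V) \<partial>lebesgue)"
  proof -
    have [measurable]: "(\<lambda>z. ennreal (indicator (ball (0 :: complex ^ 'n) 1) z / V)) \<in> borel_measurable lebesgue"
      by measurable
    have "(\<integral>\<^sup>+z. ennreal (bergman_weight s z) \<partial>v) = (\<integral>\<^sup>+z. ennreal (indicator (ball (0 :: complex ^ 'n) 1) z / V) * ennreal (bergman_weight s z) \<partial>lebesgue)"
      unfolding v by (rule nn_integral_density) measurable
    also have "\<dots> = (\<integral>\<^sup>+z. ennreal (wball s (z :: complex ^ 'n) / V) \<partial>lebesgue)"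
      using V(2) by (intro nn_integral_cong) (simp add: wball_def flip: ennreal_mult')
    finally show ?thesis .
  qed
  also have "\<dots> = (\<integral>\<^sup>+z. ennreal (wball s (z :: complex ^ 'n)) / ennreal V \<partial>lborel)"
    using V by (simp add: nn_integral_completion divide_ennreal wball_nonneg)
  also have "\<dots> = ennreal (wmass s TYPE('n) / V)"
    using ennreal_wmass[OF s] V by (simp add: nn_integral_divide divide_ennreal)
  finally have "(LINT z|v. bergman_weight s z) = wmass s TYPE('n) / V"
  proof (subst integral_eq_nn_integral)
    show "bergman_weight s \<in> borel_measurable v" unfolding v by measurable
    show "AE z in v. 0 \<le> bergman_weight s z" by (simp add: bergman_weight_def)
  qed (use V ennreal_wmass[OF s] in simp)
  then have "bergman_measure s = density v (\<lambda>z. ennreal (bergman_weight s z / (wmass s TYPE('n) / V)))"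
    by (simp add: bergman_measure_def Let_def v_def)
  also have "\<dots> = density lebesgue (\<lambda>z. ennreal (indicator (ball 0 1) z / V) * ennreal (bergman_weight s z / (wmass s TYPE('n) / V)))"
    unfolding v by (rule density_density_eq) measurable
  also have "\<dots> = density lebesgue (\<lambda>z. ennreal (wdens s z))"
    using V ennreal_wmass(2)[OF s]
    by (intro arg_cong2[where f=density] ext refl)
       (auto simp: indicator_def wdens_def wball_def bergman_weight_def simp flip: ennreal_mult)
  finally show ?thesis .
qed

lemma sets_bergman_measure [measurable_cong, simp]: "sets (bergman_measure s) = sets lebesgue"
  by (simp add: bergman_measure_def Let_def)

lemma space_bergman_measure [simp]: "space (bergman_measure s) = UNIV"
  using sets_eq_imp_space_eq[OF sets_bergman_measure] by simp

lemma borel_measurable_bergman: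
  fixes f :: "complex ^ ('n::finite) \<Rightarrow> 'b::topological_space"
  assumes "f \<in> borel_measurable borel" shows "f \<in> borel_measurable (bergman_measure s)"
  unfolding measurable_cong_sets[OF sets_bergman_measure refl]
  using assms by (intro measurable_completion) simp

lemma nn_integral_bergman:
  fixes F :: "complex ^ ('n::finite) \<Rightarrow> ennreal"
  assumes s: "real CARD('n) < s" and F: "F \<in> borel_measurable borel"
  shows "(\<integral>\<^sup>+z. F z \<partial>bergman_measure s) = (\<integral>\<^sup>+z. F z * ennreal (wdens s z) \<partial>lborel)"
proof -
  have [measurable]: "F \<in> borel_measurable lebesgue" "wdens s \<in> borel_measurable (lebesgue :: (complex ^ 'n) measure)"
    using F by (auto intro: measurable_completion)
  show ?thesis unfolding bergman_measure_eq[OF s] using F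
    by (subst nn_integral_density) (auto simp: nn_integral_completion mult.commute)
qed

lemma AE_bergman_ball:
  assumes s: "real CARD('n::finite) < s"
  shows "AE z in bergman_measure s. (z :: complex ^ 'n) \<in> ball 0 1"
proof -
  have "AE z in density lebesgue (\<lambda>z. ennreal (wdens s z)). (z :: complex ^ 'n) \<in> ball 0 1"
  proof (subst AE_density)
    show "(\<lambda>z :: complex ^ 'n. ennreal (wdens s z)) \<in> borel_measurable lebesgue"
      by (rule measurable_completion) measurable
    show "AE z in lebesgue. 0 < ennreal (wdens s z) \<longrightarrow> (z :: complex ^ 'n) \<in> ball 0 1"
    proof (intro AE_I2 impI, rule ccontr)
      fix z :: "complex ^ 'n" assume "0 < ennreal (wdens s z)" "z \<notin> ball 0 1"
      then show False using wdens_eq_0[of z s] by simp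
    qed
  qed
  then show ?thesis unfolding bergman_measure_eq[OF s] .
qed

lemma emeasure_bergman_UNIV:
  assumes s: "real CARD('n::finite) < s"
  shows "emeasure (bergman_measure s :: (complex ^ 'n) measure) UNIV = 1"
proof -
  have "emeasure (bergman_measure s :: (complex ^ 'n) measure) UNIV = (\<integral>\<^sup>+z. 1 \<partial>(bergman_measure s :: (complex ^ 'n) measure))"
    by simp
  also have "\<dots> = 1" by (subst nn_integral_bergman[OF s]) (simp_all add: nn_integral_wdens[OF s])
  finally show ?thesis .
qed

lemma finite_measure_bergman:
  assumes s: "real CARD('n::finite) < s"
  shows "finite_measure (bergman_measure s :: (complex ^ 'n) measure)"
  by (rule finite_measureI) (simp add: emeasure_bergman_UNIV[OF s])

text \<open>The identity outside the ball avoids the junk values of the quotient there, so that preimages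
  of null sets are null sets.\<close>
definition tact :: "((complex ^ ('n::finite)) \<times> complex \<Rightarrow> (complex ^ 'n) \<times> complex) \<Rightarrow> complex ^ 'n \<Rightarrow> complex ^ 'n" where
  "tact T z = (if z \<in> ball 0 1 then pact T z else z)"

lemma tact_borel:
  fixes T :: "(complex ^ ('n::finite)) \<times> complex \<Rightarrow> (complex ^ 'n) \<times> complex"
  assumes "pseudo_unitary T" shows "tact T \<in> borel_measurable borel"
proof -
  note [measurable] = borel_measurable_pact[OF assms]
  show ?thesis unfolding tact_def[abs_def] by measurable
qed

text \<open>The factor by which the weighted measure changes. For an element of the covering group
  it is |j(g, z)|^2, but only the modulus of the denominator occurs, so no branch has to be
  chosen.\<close>

definition jac :: "real \<Rightarrow> ((complex ^ ('n::finite)) \<times> complex \<Rightarrow> (complex ^ 'n) \<times> complex) \<Rightarrow> complex ^ 'n \<Rightarrow> real" where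
  "jac s T z = norm (pden T z) powr (- 2 * s)"

lemma jac_borel:
  fixes T :: "(complex ^ ('n::finite)) \<times> complex \<Rightarrow> (complex ^ 'n) \<times> complex"
  assumes "pseudo_unitary T" shows "jac s T \<in> borel_measurable borel"
proof -
  note [measurable] = borel_measurable_pden[OF assms]
  show ?thesis unfolding jac_def[abs_def] by measurable
qed

lemma nn_integral_wdens_tact:
  fixes F :: "complex ^ ('n::finite) \<Rightarrow> ennreal"
  assumes T: "pseudo_unitary T" and s: "real CARD('n) < s" and F [measurable]: "F \<in> borel_measurable borel"
  shows "(\<integral>\<^sup>+z. F (tact T z) * (ennreal (jac s T z) * ennreal (wdens s z)) \<partial>lborel) = (\<integral>\<^sup>+z. F z * ennreal (wdens s z) \<partial>lborel)"
proof -
  note [measurable] = borel_measurable_pact[OF T] jac_borel[OF T]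
  have e: "ennreal (wdens s z) = ennreal (wball s z) / ennreal (wmass s TYPE('n))" for z :: "complex ^ 'n"
    using ennreal_wmass(2)[OF s] by (simp add: wdens_def divide_ennreal wball_nonneg)
  have "F (tact T z) * (ennreal (jac s T z) * ennreal (wdens s z)) =
     F (pact T z) * (ennreal (jac s T z) * ennreal (wball s z)) / ennreal (wmass s TYPE('n))" for z
    unfolding e by (cases "z \<in> ball 0 1") (auto simp: tact_def wball_def ennreal_times_divide)
  then have "(\<integral>\<^sup>+z. F (tact T z) * (ennreal (jac s T z) * ennreal (wdens s z)) \<partial>lborel) =
     (\<integral>\<^sup>+z. F (pact T z) * (ennreal (jac s T z) * ennreal (wball s z)) \<partial>lborel) / ennreal (wmass s TYPE('n))"
    by (simp add: nn_integral_divide)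
  also have "\<dots> = (\<integral>\<^sup>+z. F z * ennreal (wball s z) \<partial>lborel) / ennreal (wmass s TYPE('n))"
    using nn_integral_wball_pact[OF T F, of s] by (simp add: jac_def)
  also have "\<dots> = (\<integral>\<^sup>+z. F z * ennreal (wdens s z) \<partial>lborel)"
    unfolding e ennreal_times_divide by (rule nn_integral_divide[symmetric]) measurable
  finally show ?thesis .
qed

text \<open>The weighted integral over the preimage vanishes by the change of variables, and its
  density is positive on the ball; off the ball the map is the identity. This is what allows
  substitution in functions that are only Lebesgue measurable.\<close>

lemma null_sets_tact:
  fixes T :: "(complex ^ ('n::finite)) \<times> complex \<Rightarrow> (complex ^ 'n) \<times> complex"
  assumes T: "pseudo_unitary T" and N: "N \<in> null_sets lborel"
  shows "tact T -` N \<in> null_sets lborel"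
proof -
  note [measurable] = tact_borel[OF T] jac_borel[OF T]
  have [measurable]: "N \<in> sets borel" using N by auto
  \<comment> \<open>An auxiliary weight, independent of the one in the theorem; for this value the
    weight is constant on the ball.\<close>
  define s where "s = real CARD('n) + 1"
  have s: "real CARD('n) < s" by (simp add: s_def)
  have m [measurable]: "tact T -` N \<in> sets borel" using measurable_sets[OF tact_borel[OF T], of N] by simp
  have "AE z in lborel. z \<notin> N" using N by (simp add: AE_not_in)
  then have "(\<integral>\<^sup>+z. indicator N z * ennreal (wdens s z) \<partial>lborel) = 0"
    by (subst nn_integral_0_iff_AE) auto
  then have "(\<integral>\<^sup>+z. indicator N (tact T z) * (ennreal (jac s T z) * ennreal (wdens s z)) \<partial>lborel) = 0"
    by (subst nn_integral_wdens_tact[OF T s]) auto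
  then have "AE z in lborel. indicator N (tact T z) * (ennreal (jac s T z) * ennreal (wdens s z)) = 0"
    by (subst (asm) nn_integral_0_iff_AE) auto
  moreover have "AE z in lborel. z \<notin> N" by fact
  ultimately have "AE z in lborel. z \<notin> tact T -` N"
  proof eventually_elim
    case (elim z)
    show ?case
    proof (cases "z \<in> ball 0 1")
      case True
      have "jac s T z > 0" using pden_nonzero[OF T True] by (simp add: jac_def)
      then show ?thesis using elim wdens_pos[OF s True] by (auto simp: indicator_def ennreal_eq_0_iff split: if_splits)
    next
      case False then show ?thesis using elim by (auto simp: tact_def)
    qed
  qed
  then show ?thesis using AE_iff_null_sets[of "tact T -` N" lborel] m by simp
qed

text \<open>Symbols and square integrable functions are Lebesgue measurable, so the substitution has
  to be measurable between completed sigma-algebras, which requires preimages of null sets to be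
  null.\<close>

lemma tact_measurable:
  fixes T :: "(complex ^ ('n::finite)) \<times> complex \<Rightarrow> (complex ^ 'n) \<times> complex"
  assumes T: "pseudo_unitary T"
  shows "tact T \<in> bergman_measure s \<rightarrow>\<^sub>M bergman_measure s'"
proof -
  have "tact T \<in> lebesgue \<rightarrow>\<^sub>M lebesgue"
  proof (rule completion.measurable_completion2)
    show t: "tact T \<in> lebesgue \<rightarrow>\<^sub>M lborel" using tact_borel[OF T] by (auto intro: measurable_completion)
    show "null_sets lborel \<subseteq> null_sets (distr lebesgue lborel (tact T))"
    proof
      fix N assume N: "N \<in> null_sets (lborel :: (complex ^ 'n) measure)"
      have "tact T -` N \<in> null_sets lebesgue" using null_sets_tact[OF T N] by (rule null_sets_completionI)
      then show "N \<in> null_sets (distr lebesgue lborel (tact T))"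
        using N by (auto simp: null_sets_distr_iff[OF t] dest: null_setsD2)
    qed
  qed
  then show ?thesis by (simp add: measurable_cong_sets[OF sets_bergman_measure sets_bergman_measure])
qed

lemma AE_tact:
  fixes T :: "(complex ^ ('n::finite)) \<times> complex \<Rightarrow> (complex ^ 'n) \<times> complex"
  assumes T: "pseudo_unitary T" and s: "real CARD('n) < s" and P: "AE z in lebesgue. P z"
  shows "AE z in lebesgue. P (tact T z)"
proof -
  have "AE z in lborel. P z" using P by (simp add: AE_completion_iff)
  then obtain N where N: "N \<in> null_sets lborel" "{z. \<not> P z} \<subseteq> N" by (auto simp: eventually_ae_filter)
  have "AE z in lborel. P (tact T z)"
    unfolding eventually_ae_filter using null_sets_tact[OF T N(1)] N(2) by (intro bexI[of _ "tact T -` N"]) auto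
  then show ?thesis by (rule AE_completion)
qed

text \<open>Extends the identity for Borel integrands to Lebesgue sets: an indicator agrees almost
  everywhere with a Borel function, and this persists after the substitution by
  \<open>AE_tact\<close>.\<close>

lemma distr_bergman_tact:
  fixes T :: "(complex ^ ('n::finite)) \<times> complex \<Rightarrow> (complex ^ 'n) \<times> complex"
  assumes T: "pseudo_unitary T" and s: "real CARD('n) < s"
  shows "distr (density (bergman_measure s) (\<lambda>z. ennreal (jac s T z))) (bergman_measure s) (tact T) = bergman_measure s"
proof (rule measure_eqI)
  let ?B = "bergman_measure s :: (complex ^ 'n) measure"
  fix A assume A: "A \<in> sets (distr (density ?B (\<lambda>z. ennreal (jac s T z))) ?B (tact T))"
  then have A': "A \<in> sets lebesgue" by simp
  note tm [measurable] = tact_measurable[OF T, of s s] tact_borel[OF T] jac_borel[OF T]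
  have [measurable]: "jac s T \<in> borel_measurable ?B" by (rule borel_measurable_bergman) measurable
  have [measurable]: "A \<in> sets ?B" using A' by simp
  have "(\<lambda>z. indicator A z :: ennreal) \<in> borel_measurable lebesgue" using A' by simp
  then obtain g where g [measurable]: "g \<in> borel_measurable borel" and ag: "AE z in lborel. indicator A z = (g z :: ennreal)"
    using completion_ex_borel_measurable[of "\<lambda>z. indicator A z" lborel] by auto
  have ag': "AE z in lebesgue. indicator A z = g z" using ag by (rule AE_completion)
  have toB: "AE z in ?B. P z" if "AE z in lebesgue. P z" for P :: "complex ^ 'n \<Rightarrow> bool"
    unfolding bergman_measure_eq[OF s] using that
    by (subst AE_density) (auto intro: measurable_completion)
  have gt: "(\<lambda>z. g (tact T z)) \<in> borel_measurable borel" by measurable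
  have "emeasure (distr (density ?B (\<lambda>z. ennreal (jac s T z))) ?B (tact T)) A =
      (\<integral>\<^sup>+z. indicator A (tact T z) * ennreal (jac s T z) \<partial>?B)"
  proof -
    have "emeasure (distr (density ?B (\<lambda>z. ennreal (jac s T z))) ?B (tact T)) A =
      (\<integral>\<^sup>+z. indicator A z \<partial>distr (density ?B (\<lambda>z. ennreal (jac s T z))) ?B (tact T))" using A' by simp
    also have "\<dots> = (\<integral>\<^sup>+z. indicator A (tact T z) \<partial>density ?B (\<lambda>z. ennreal (jac s T z)))"
      by (rule nn_integral_distr) (auto simp: A' tm measurable_cong_sets[OF sets_density refl])
    also have "\<dots> = (\<integral>\<^sup>+z. ennreal (jac s T z) * indicator A (tact T z) \<partial>?B)"
      by (rule nn_integral_density) measurable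
    finally show ?thesis by (simp add: mult.commute)
  qed
  also have "\<dots> = (\<integral>\<^sup>+z. g (tact T z) * ennreal (jac s T z) \<partial>?B)"
    by (rule nn_integral_cong_AE, rule AE_mp[OF toB[OF AE_tact[OF T s ag']]]) auto
  also have "\<dots> = (\<integral>\<^sup>+z. g z \<partial>?B)"
    using nn_integral_wdens_tact[OF T s g] by (subst (1 2) nn_integral_bergman[OF s]) (auto simp: mult.assoc)
  also have "\<dots> = (\<integral>\<^sup>+z. indicator A z \<partial>?B)"
    by (rule nn_integral_cong_AE, rule AE_mp[OF toB[OF ag']]) auto
  finally show "emeasure (distr (density ?B (\<lambda>z. ennreal (jac s T z))) ?B (tact T)) A = emeasure ?B A"
    using A' by simp
qed simp

lemma nn_integral_bergman_tact:
  fixes T :: "(complex ^ ('n::finite)) \<times> complex \<Rightarrow> (complex ^ 'n) \<times> complex"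
  assumes T: "pseudo_unitary T" and s: "real CARD('n) < s" and F: "F \<in> borel_measurable (bergman_measure s)"
  shows "(\<integral>\<^sup>+z. F (tact T z) * ennreal (jac s T z) \<partial>bergman_measure s) = (\<integral>\<^sup>+z. F z \<partial>bergman_measure s)"
proof -
  note [measurable] = tact_measurable[OF T, of s s] borel_measurable_bergman[OF jac_borel[OF T], of s s]
  have "(\<integral>\<^sup>+z. F z \<partial>bergman_measure s) = (\<integral>\<^sup>+z. F (tact T z) \<partial>density (bergman_measure s) (\<lambda>z. ennreal (jac s T z)))"
    by (subst distr_bergman_tact[OF T s, symmetric], rule nn_integral_distr)
       (use F in \<open>auto simp: tact_measurable[OF T] measurable_cong_sets[OF sets_density refl]\<close>)
  also have "\<dots> = (\<integral>\<^sup>+z. ennreal (jac s T z) * F (tact T z) \<partial>bergman_measure s)"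
    by (rule nn_integral_density) (use F in measurable)
  finally show ?thesis by (simp add: mult.commute)
qed

lemma
  fixes T :: "(complex ^ ('n::finite)) \<times> complex \<Rightarrow> (complex ^ 'n) \<times> complex"
    and f :: "complex ^ 'n \<Rightarrow> complex"
  assumes T: "pseudo_unitary T" and s: "real CARD('n) < s" and f: "f \<in> borel_measurable (bergman_measure s)"
  shows integrable_bergman_tact: "integrable (bergman_measure s) (\<lambda>z. jac s T z *\<^sub>R f (tact T z)) \<longleftrightarrow> integrable (bergman_measure s) f"
    and integral_bergman_tact: "(LINT z|bergman_measure s. jac s T z *\<^sub>R f (tact T z)) = (LINT z|bergman_measure s. f z)"
proof -
  note [measurable] = tact_measurable[OF T, of s s] borel_measurable_bergman[OF jac_borel[OF T], of s s]
  have tm: "tact T \<in> density (bergman_measure s) (\<lambda>z. ennreal (jac s T z)) \<rightarrow>\<^sub>M bergman_measure s"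
    by (simp add: tact_measurable[OF T] measurable_cong_sets[OF sets_density refl])
  have nn: "AE z in bergman_measure s. 0 \<le> jac s T z" by (simp add: jac_def)
  have "integrable (bergman_measure s) f \<longleftrightarrow> integrable (density (bergman_measure s) (\<lambda>z. ennreal (jac s T z))) (\<lambda>z. f (tact T z))"
    by (subst distr_bergman_tact[OF T s, symmetric], rule integrable_distr_eq[OF tm f])
  also have "\<dots> \<longleftrightarrow> integrable (bergman_measure s) (\<lambda>z. jac s T z *\<^sub>R f (tact T z))"
    by (rule integrable_density) (use f nn in measurable)
  finally show "integrable (bergman_measure s) (\<lambda>z. jac s T z *\<^sub>R f (tact T z)) \<longleftrightarrow> integrable (bergman_measure s) f" ..
  have "(LINT z|bergman_measure s. f z) = (LINT z|density (bergman_measure s) (\<lambda>z. ennreal (jac s T z)). f (tact T z))"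
    by (subst distr_bergman_tact[OF T s, symmetric], rule integral_distr[OF tm f])
  also have "\<dots> = (LINT z|bergman_measure s. jac s T z *\<^sub>R f (tact T z))"
    by (rule integral_density) (use f nn in measurable)
  finally show "(LINT z|bergman_measure s. jac s T z *\<^sub>R f (tact T z)) = (LINT z|bergman_measure s. f z)" ..
qed

section \<open>Mean values and the reproducing kernel\<close>

lemma holomorphic_n_continuous: "holomorphic_n_on f S \<Longrightarrow> continuous_on S f"
  unfolding holomorphic_n_on_def continuous_on_eq_continuous_within
  using has_derivative_continuous continuous_at_imp_continuous_at_within by blast

lemma linear_smult_left: "linear (\<lambda>c. c *s (A :: complex ^ ('n::finite)))"
  by (rule linearI) (simp_all add: vec_eq_iff algebra_simps)

text \<open>Curves of this shape arise as images of complex lines through 0 under a boost, where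
  both coefficients carry the reciprocal of the denominator.\<close>

lemma holomorphic_on_affine_curve:
  fixes A B :: "complex ^ ('n::finite)"
  assumes f: "holomorphic_n_on f S" and U: "open U" and c: "c holomorphic_on U" and d: "d holomorphic_on U"
    and sub: "\<And>\<zeta>. \<zeta> \<in> U \<Longrightarrow> c \<zeta> *s A + d \<zeta> *s B \<in> S"
  shows "(\<lambda>\<zeta>. f (c \<zeta> *s A + d \<zeta> *s B)) holomorphic_on U"
  unfolding holomorphic_on_open[OF U]
proof (intro ballI)
  fix \<zeta> assume \<zeta>: "\<zeta> \<in> U"
  obtain c' d' where c': "(c has_field_derivative c') (at \<zeta>)" and d': "(d has_field_derivative d') (at \<zeta>)"
    using c d \<zeta> unfolding holomorphic_on_open[OF U] by blast
  obtain f' where f': "(f has_derivative f') (at (c \<zeta> *s A + d \<zeta> *s B))" and lin: "\<And>a v. f' (a *s v) = a * f' v"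
    using f sub[OF \<zeta>] unfolding holomorphic_n_on_def by blast
  have bl: "bounded_linear (\<lambda>c. c *s A)" for A :: "complex ^ 'n"
    using linear_smult_left[of A] by (simp add: linear_linear)
  have "((\<lambda>\<zeta>. c \<zeta> *s A + d \<zeta> *s B) has_derivative (\<lambda>h. (c' * h) *s A + (d' * h) *s B)) (at \<zeta>)"
    using c' d' unfolding has_field_derivative_def
    by (intro has_derivative_add bounded_linear.has_derivative[OF bl])
  from has_derivative_compose[OF this f']
  have "((\<lambda>\<zeta>. f (c \<zeta> *s A + d \<zeta> *s B)) has_derivative (\<lambda>h. f' ((c' * h) *s A + (d' * h) *s B))) (at \<zeta>)" .
  moreover have "f' ((c' * h) *s A + (d' * h) *s B) = f' (c' *s A + d' *s B) * h" for h
  proof -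
    have "(c' * h) *s A + (d' * h) *s B = h *s (c' *s A + d' *s B)" by (simp add: vec_eq_iff algebra_simps)
    then show ?thesis unfolding \<open>_ = h *s _\<close> lin by (simp add: mult.commute)
  qed
  ultimately show "\<exists>D. ((\<lambda>\<zeta>. f (c \<zeta> *s A + d \<zeta> *s B)) has_field_derivative D) (at \<zeta>)"
    unfolding has_field_derivative_def by auto
qed

lemma circlepath_0_1: "circlepath 0 1 t = exp (2 * of_real pi * \<i> * of_real t)"
  by (simp add: circlepath)

lemma circlepath_0_1_nonzero: "circlepath 0 1 t \<noteq> 0"
  by (simp add: circlepath_0_1)

text \<open>Cauchy's formula at the centre, with the circle parametrized over [0, 1] and written as
  a Lebesgue integral for use with Fubini.\<close>

lemma circle_mean:
  assumes g: "g holomorphic_on (cball 0 1)"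
  shows "set_integrable lborel {0..1} (\<lambda>t. g (exp (2 * of_real pi * \<i> * of_real t)))"
    and "(LINT t:{0..1}|lborel. g (exp (2 * of_real pi * \<i> * of_real t))) = g 0"
proof -
  have "((\<lambda>u. g u / (u - 0)) has_contour_integral (2 * of_real pi * \<i>) * g 0) (circlepath 0 1)"
    by (rule Cauchy_integral_circlepath_simple[OF g]) simp
  then have "((\<lambda>x. g (circlepath 0 1 x) / circlepath 0 1 x * vector_derivative (circlepath 0 1) (at x within {0..1})) has_integral (2 * of_real pi * \<i>) * g 0) {0..1}"
    by (simp add: has_contour_integral_def)
  then have "((\<lambda>x. (2 * of_real pi * \<i>) * g (exp (2 * of_real pi * \<i> * of_real x))) has_integral (2 * of_real pi * \<i>) * g 0) {0..1}"
    by (rule has_integral_eq[rotated]) (simp add: vector_derivative_circlepath01 circlepath_0_1_nonzero flip: circlepath_0_1)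
  from has_integral_mult_right[OF this, of "inverse (2 * of_real pi * \<i>)"]
  have hi: "((\<lambda>x. g (exp (2 * of_real pi * \<i> * of_real x))) has_integral g 0) {0..1}"
    by (simp add: field_simps)
  have "continuous_on {0..1} (\<lambda>t. g (exp (2 * of_real pi * \<i> * of_real t)))"
    by (rule continuous_on_compose2[OF holomorphic_on_imp_continuous_on[OF g]])
       (auto intro!: continuous_intros simp: norm_exp_eq_Re)
  then show si: "set_integrable lborel {0..1} (\<lambda>t. g (exp (2 * of_real pi * \<i> * of_real t)))"
    by (rule borel_integrable_atLeastAtMost')
  show "(LINT t:{0..1}|lborel. g (exp (2 * of_real pi * \<i> * of_real t))) = g 0"
    unfolding set_borel_integral_eq_integral(2)[OF si] using hi by (rule integral_unique)
qed

text \<open>For |c| = 1 the denominator is 1, so the weighted measure is invariant under z \<mapsto>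
  c z.\<close>

definition rot :: "complex \<Rightarrow> (complex ^ 'n) \<times> complex \<Rightarrow> (complex ^ 'n) \<times> complex" where
  "rot c p = (c *s fst p, snd p)"

lemma rot_pseudo_unitary: "norm c = 1 \<Longrightarrow> pseudo_unitary (rot c)"
proof -
  assume c: "norm c = 1"
  then have "c * cnj c = 1" by (simp add: complex_mult_cnj cmod_def power2_eq_square)
  then have "c * (cnj c * u) = u" for u by (metis mult.assoc mult_1)
  then show ?thesis unfolding pseudo_unitary_def
    by (auto simp: rot_def cscale_def hform_def cip_smult_left cip_smult_right vec_eq_iff algebra_simps)
qed

lemma rot_action: "pden (rot c) z = 1" "pact (rot c) z = c *s z"
  by (simp_all add: pden_def pact_def rot_def)

text \<open>By rotation invariance F may be replaced by its average over the circle through each z,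
  and that average is F 0 by Cauchy. Hence only the restrictions of F to complex lines through 0
  have to be holomorphic.\<close>

lemma mean_value_ball:
  fixes F :: "complex ^ ('n::finite) \<Rightarrow> complex"
  assumes s: "real CARD('n) < s" and r: "r \<le> 1" "0 < r"
    and cont: "continuous_on (ball 0 1) F"
    and hol: "\<And>z. z \<in> ball 0 1 \<Longrightarrow> (\<lambda>\<zeta>. F (\<zeta> *s z)) holomorphic_on (cball 0 1)"
    and int: "integrable (bergman_measure s) (\<lambda>z. indicator (ball 0 r) z *\<^sub>R F z)"
  shows "(LINT z|bergman_measure s. indicator (ball 0 r) z *\<^sub>R F z) = measure (bergman_measure s :: (complex ^ 'n) measure) (ball 0 r) *\<^sub>R F 0"
proof -
  let ?B = "bergman_measure s :: (complex ^ 'n) measure"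
  interpret B: finite_measure ?B by (rule finite_measure_bergman[OF s])
  interpret P: pair_sigma_finite lborel ?B by standard
  define e where "e = (\<lambda>t::real. exp (2 * of_real pi * \<i> * of_real t))"
  have ne: "norm (e t) = 1" for t by (simp add: e_def norm_exp_eq_Re)
  define G where "G = (\<lambda>z. indicator (ball 0 r) z *\<^sub>R F z)"
  have Gb [measurable]: "G \<in> borel_measurable borel"
    unfolding G_def using r cont
    by (intro borel_measurable_continuous_on_indicator) (auto intro: continuous_on_subset)
  have Gm [measurable]: "G \<in> borel_measurable ?B" by (rule borel_measurable_bergman[OF Gb])
  have nv: "norm (c *s z) = norm z" if "norm c = 1" for c and z :: "complex ^ 'n" using that by (simp add: norm_vector_smult)
  have Gt: "jac s (rot c) z *\<^sub>R H (tact (rot c) z) = H (c *s z)" if "norm c = 1" "\<And>z. z \<notin> ball 0 1 \<Longrightarrow> H z = 0"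
    for c z and H :: "complex ^ 'n \<Rightarrow> complex"
    using that nv[OF that(1), of z] by (auto simp: jac_def tact_def rot_action)
  have G0: "z \<notin> ball 0 1 \<Longrightarrow> G z = 0" for z using r by (auto simp: G_def)
  have Gi: "integrable ?B G" using int by (simp add: G_def)
  have int_rot: "integrable ?B (\<lambda>z. G (c *s z))" "(LINT z|?B. G (c *s z)) = (LINT z|?B. G z)"
    "(LINT z|?B. norm (G (c *s z))) = (LINT z|?B. norm (G z))" if "norm c = 1" for c
  proof -
    have Gt': "jac s (rot c) z *\<^sub>R G (tact (rot c) z) = G (c *s z)" for z
      using Gt[OF that, of G] G0 by blast
    show "integrable ?B (\<lambda>z. G (c *s z))"
      using integrable_bergman_tact[OF rot_pseudo_unitary[OF that] s Gm] Gi unfolding Gt' by simp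
    show "(LINT z|?B. G (c *s z)) = (LINT z|?B. G z)"
      using integral_bergman_tact[OF rot_pseudo_unitary[OF that] s Gm] unfolding Gt' .
    have m: "(\<lambda>z. complex_of_real (norm (G z))) \<in> borel_measurable ?B" by measurable
    have "(LINT z|?B. complex_of_real (norm (G (c *s z)))) = (LINT z|?B. complex_of_real (norm (G z)))"
      using integral_bergman_tact[OF rot_pseudo_unitary[OF that] s m]
        Gt[OF that, of "\<lambda>z. complex_of_real (norm (G z))"] G0 by simp
    then show "(LINT z|?B. norm (G (c *s z))) = (LINT z|?B. norm (G z))"
      unfolding integral_complex_of_real of_real_eq_iff .
  qed
  \<comment> \<open>The joint integrand in the angle and the point. Integrated over z first it gives
    the original integral for every angle, over the angle first it gives F 0.\<close>
  define H where "H = (\<lambda>t z. indicator {0..1::real} t *\<^sub>R G (e t *s z))"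
  have [measurable]: "(\<lambda>z::complex^'n. z) \<in> borel_measurable ?B" by (rule borel_measurable_bergman) simp
  have [measurable]: "e \<in> borel_measurable borel"
    unfolding e_def by (intro borel_measurable_continuous_onI continuous_intros)
  have Hm [measurable]: "(\<lambda>(t, z). H t z) \<in> borel_measurable (lborel \<Otimes>\<^sub>M ?B)"
    unfolding H_def by measurable
  have Hint: "integrable (lborel \<Otimes>\<^sub>M ?B) (\<lambda>(t, z). H t z)"
  proof (rule P.Fubini_integrable[OF Hm])
    have "(LINT z|?B. norm (case (t, z) of (t, z) \<Rightarrow> H t z)) = indicator {0..1} t *\<^sub>R (LINT z|?B. norm (G z))" for t
      using int_rot(3)[OF ne] by (simp add: H_def)
    then show "integrable lborel (\<lambda>t. LINT z|?B. norm (case (t, z) of (t, z) \<Rightarrow> H t z))" by simp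
    show "AE t in lborel. integrable ?B (\<lambda>z. case (t, z) of (t, z) \<Rightarrow> H t z)"
      using int_rot(1)[OF ne] by (simp add: H_def)
  qed
  have "(LINT z|?B. (LINT t|lborel. H t z)) = (LINT t|lborel. (LINT z|?B. H t z))"
    by (rule P.Fubini_integral[OF Hint])
  also have "\<dots> = (LINT t|lborel. indicator {0..1::real} t *\<^sub>R (LINT z|?B. G z))"
    unfolding H_def by (simp only: integral_scaleR_right int_rot(2)[OF ne])
  also have "\<dots> = (LINT z|?B. G z)" by simp
  finally have e1: "(LINT z|?B. (LINT t|lborel. H t z)) = (LINT z|?B. G z)" .
  have inner: "(LINT t|lborel. H t z) = indicator (ball 0 r) z *\<^sub>R F 0" for z
  proof (cases "z \<in> ball 0 r")
    case True
    then have z: "z \<in> ball 0 1" using r by simp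
    have "H t z = indicator {0..1} t *\<^sub>R F (e t *s z)" for t
      using True nv[OF ne, of t z] by (simp add: H_def G_def)
    then show ?thesis using circle_mean(2)[OF hol[OF z]] True
      by (simp add: set_lebesgue_integral_def e_def)
  next
    case False
    then have "H t z = 0" for t using nv[OF ne, of t z] by (simp add: H_def G_def)
    then show ?thesis using False by simp
  qed
  have [measurable]: "ball (0 :: complex ^ 'n) r \<in> sets ?B" by simp
  have bs: "ball (0 :: complex ^ 'n) r \<in> sets ?B" by simp
  have "(LINT z|?B. indicator (ball 0 r) z *\<^sub>R F 0) = (LINT z|?B. indicator (ball 0 r) z) *\<^sub>R F 0"
    by (intro integral_scaleR_left integrable_real_indicator bs) (simp add: B.emeasure_eq_measure)
  also have "(LINT z|?B. indicator (ball 0 r) z) = measure ?B (ball 0 r)"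
    by simp
  finally show ?thesis
    using e1 unfolding inner G_def by simp
qed

subsection \<open>The kernel\<close>

lemma bergman_kernel_cip: "bergman_kernel s w z = (1 - cip z w) powr (- of_real s)"
  by (simp add: bergman_kernel_def cip_def)

lemma Re_one_minus_pos: "norm (u::complex) < 1 \<Longrightarrow> 0 < Re (1 - u)"
  using abs_Re_le_cmod[of u] by simp

lemma Re_one_plus_pos: "norm (u::complex) < 1 \<Longrightarrow> 0 < Re (1 + u)"
  using abs_Re_le_cmod[of u] by simp

lemma continuous_on_powr_Re_pos:
  assumes "continuous_on S g" "\<And>z. z \<in> S \<Longrightarrow> 0 < Re (g z)"
  shows "continuous_on S (\<lambda>z. g z powr a)"
  using assms by (intro continuous_on_powr_complex) (force intro: less_imp_le)+

lemma borel_measurable_cnj [measurable (raw)]: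
  assumes "f \<in> borel_measurable M" shows "(\<lambda>x. cnj (f x)) \<in> borel_measurable M"
  by (rule borel_measurable_continuous_on[OF _ assms]) (intro continuous_intros)

lemma norm_powr_of_real: "norm (p powr (of_real a)) = norm (p::complex) powr a"
  by (simp add: norm_powr_real_powr')

lemma norm_powr_minus_of_real: "norm (p powr (- of_real a)) = norm (p::complex) powr (- a)"
  using norm_powr_of_real[of p "- a"] by simp

lemma cnj_bergman_kernel:
  assumes "norm (cip z w) < 1"
  shows "cnj (bergman_kernel s w z) = bergman_kernel s z w"
proof -
  have "cnj (bergman_kernel s w z) = cnj (1 - cip z w) powr cnj (- of_real s)"
    unfolding bergman_kernel_cip using Re_one_minus_pos[OF assms] by (intro cnj_powr) simp
  then show ?thesis by (simp add: bergman_kernel_cip cnj_cip)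
qed

lemma norm_one_minus_cip_ge:
  assumes "norm z \<le> 1" shows "1 - norm w \<le> norm (1 - cip z w)"
proof -
  have "norm (cip z w) \<le> norm z * norm w" by (rule norm_cip)
  also have "\<dots> \<le> 1 * norm w" using assms by (intro mult_right_mono) auto
  finally have "norm (cip z w) \<le> norm w" by simp
  moreover have "norm (1::complex) - norm (cip z w) \<le> norm (1 - cip z w)" by (rule norm_triangle_ineq2)
  ultimately show ?thesis by simp
qed

lemma norm_bergman_kernel_le:
  assumes "norm z \<le> 1" "norm w < 1" "s \<ge> 0"
  shows "norm (bergman_kernel s w z) \<le> (1 - norm w) powr (- s)"
  unfolding bergman_kernel_cip norm_powr_minus_of_real
  using assms norm_one_minus_cip_ge[OF assms(1), of w] by (intro powr_mono2') auto

lemma bergman_kernel_measurable [measurable]: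
  "bergman_kernel s (w :: complex ^ ('n::finite)) \<in> borel_measurable borel"
proof -
  have "(\<lambda>z :: complex ^ 'n. 1 - cip z w) \<in> borel_measurable borel" by measurable
  then show ?thesis unfolding bergman_kernel_cip[abs_def] powr_def by measurable
qed

text \<open>The square of the hyperbolic cosine of the distance in the ball.\<close>
definition hdist :: "complex ^ 'n \<Rightarrow> complex ^ 'n \<Rightarrow> real" where
  "hdist z w = (norm (1 - cip z w))\<^sup>2 / ((1 - (norm z)\<^sup>2) * (1 - (norm w)\<^sup>2))"

lemma hdist_pact:
  assumes T: "pseudo_unitary T" and z: "z \<in> ball 0 1" and w: "w \<in> ball 0 1"
  shows "hdist (pact T z) (pact T w) = hdist z w"
  unfolding hdist_def one_minus_cip_pact[OF assms] one_minus_norm_pact[OF T z] one_minus_norm_pact[OF T w]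
  using pden_nonzero[OF T z] pden_nonzero[OF T w]
  by (simp add: norm_divide norm_mult power_divide power_mult_distrib)

text \<open>With q = 1 + \<langle>z, w\<rangle> the Jacobian is |q|^(-2s) and the conjugate kernel
  is conj(q)^s, up to powers of \<open>gam w\<close> that cancel. The antiholomorphic half
  disappears and q^(-s) remains, which is holomorphic in z and equals 1 at 0.\<close>

lemma boost_kernel:
  fixes w z :: "complex ^ ('n::finite)"
  assumes w: "w \<in> ball 0 1" and z: "z \<in> ball 0 1"
  shows "jac s (boost w) z *\<^sub>R cnj (bergman_kernel s w (pact (boost w) z)) = (1 + cip z w) powr (- of_real s)"
proof -
  define q where "q = 1 + cip z w"
  have "norm (cip z w) < 1" using w z by (intro norm_cip_less_1) auto
  then have Req: "Re q > 0" unfolding q_def by (rule Re_one_plus_pos)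
  then have q0: "q \<noteq> 0" "q \<notin> \<real>\<^sub>\<le>\<^sub>0" by (auto simp: complex_nonpos_Reals_iff)
  note g = gam_facts[OF w]
  have 0: "(0 :: complex ^ 'n) \<in> ball 0 1" by simp
  have "1 - cip (pact (boost w) z) w = 1 - cip (pact (boost w) z) (pact (boost w) 0)"
    by (simp add: pact_boost_0[OF w])
  also have "\<dots> = 1 / (of_real (gam w) * q * of_real (gam w))"
    by (subst one_minus_cip_pact[OF boost_pseudo_unitary[OF w] z 0]) (simp add: pden_boost q_def)
  also have "\<dots> = of_real (1 / (gam w)\<^sup>2) * inverse q" by (simp add: power2_eq_square divide_inverse)
  finally have "bergman_kernel s w (pact (boost w) z) = (of_real (1 / (gam w)\<^sup>2) * inverse q) powr (- of_real s)"
    by (simp add: bergman_kernel_cip)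
  \<comment> \<open>The principal logarithm splits over the product because one factor is a positive
    real.\<close>
  also have "\<dots> = exp (- of_real s * (of_real (ln (1 / (gam w)\<^sup>2)) + Ln (inverse q)))"
  proof -
    have "Ln (of_real (1 / (gam w)\<^sup>2) * inverse q) = of_real (ln (1 / (gam w)\<^sup>2)) + Ln (inverse q)"
      using q0 g(1) Ln_times_of_real[of "1 / (gam w)\<^sup>2" "inverse q"] Ln_of_real[of "1 / (gam w)\<^sup>2"]
      by (simp del: of_real_divide of_real_power)
    moreover have "of_real (1 / (gam w)\<^sup>2) * inverse q \<noteq> 0" using q0 g(1) by simp
    ultimately show ?thesis unfolding powr_def by (simp only: if_False)
  qed
  also have "Ln (inverse q) = - Ln q" by (rule Ln_inverse[OF q0(2)])
  also have "exp (- of_real s * (of_real (ln (1 / (gam w)\<^sup>2)) + - Ln q)) = of_real (gam w powr (2 * s)) * exp (of_real s * Ln q)"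
    using g(1) by (simp add: ln_div ln_realpow powr_def exp_of_real[symmetric] exp_add[symmetric] algebra_simps)
  finally have K: "bergman_kernel s w (pact (boost w) z) = of_real (gam w powr (2 * s)) * exp (of_real s * Ln q)" .
  have "jac s (boost w) z = gam w powr (- 2 * s) * norm q powr (- 2 * s)"
    using g(1) unfolding jac_def pden_boost q_def[symmetric] by (simp add: norm_mult powr_mult)
  then have J: "jac s (boost w) z * gam w powr (2 * s) = norm q powr (- 2 * s)"
    using g(1) by (simp add: powr_minus)
  \<comment> \<open>|q|^(-2s) is written as q^(-s) times its conjugate; the conjugate factor is the
    one that the kernel removes.\<close>
  have nq: "complex_of_real (norm q powr (- 2 * s)) = exp (- of_real s * Ln q) * cnj (exp (- of_real s * Ln q))"
  proof -
    have "norm (exp (- of_real s * Ln q)) = norm q powr (- s)"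
      using q0 norm_powr_minus_of_real[of q s] by (simp add: powr_def)
    then have "(norm (exp (- of_real s * Ln q)))\<^sup>2 = norm q powr (- 2 * s)"
      using q0 by (simp add: power2_eq_square flip: powr_add)
    then show ?thesis by (metis complex_norm_square)
  qed
  have "jac s (boost w) z *\<^sub>R cnj (bergman_kernel s w (pact (boost w) z)) =
      of_real (jac s (boost w) z * gam w powr (2 * s)) * cnj (exp (of_real s * Ln q))"
    unfolding K by (simp add: scaleR_conv_of_real)
  also have "\<dots> = exp (- of_real s * Ln q) * cnj (exp (- of_real s * Ln q) * exp (of_real s * Ln q))"
    unfolding J nq by simp
  also have "\<dots> = exp (- of_real s * Ln q)" by (simp add: exp_add[symmetric])
  finally show ?thesis using q0 by (simp add: powr_def q_def)
qed

text \<open>In homogeneous coordinates the boosted line is \<zeta> A + B, so its image in the ball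
  has coefficients that are quotients by the nonvanishing denominator.\<close>

lemma boost_slice_holomorphic:
  fixes w z :: "complex ^ ('n::finite)"
  assumes f: "holomorphic_n_on f (ball 0 1)" and w: "w \<in> ball 0 1" and z: "z \<in> ball 0 1"
  shows "(\<lambda>\<zeta>. f (pact (boost w) (\<zeta> *s z)) * (1 + cip (\<zeta> *s z) w) powr (- of_real s)) holomorphic_on cball 0 1"
proof -
  \<comment> \<open>An open set containing the closed disc, so that complex derivatives are
    available at its boundary points too.\<close>
  define U where "U = {\<zeta>::complex. norm \<zeta> * norm z < 1}"
  have U: "open U" unfolding U_def by (intro open_Collect_less continuous_intros)
  have nU: "norm (\<zeta> *s z) < 1" if "\<zeta> \<in> U" for \<zeta> using that by (simp add: U_def norm_vector_smult)
  have sub: "cball 0 1 \<subseteq> U"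
  proof
    fix \<zeta> :: complex assume "\<zeta> \<in> cball 0 1"
    then have "norm \<zeta> * norm z \<le> 1 * norm z" by (intro mult_right_mono) auto
    then show "\<zeta> \<in> U" using z by (simp add: U_def)
  qed
  define \<beta> where "\<beta> = (\<lambda>\<zeta>. of_real (gam w) * (1 + \<zeta> * cip z w))"
  have q: "1 + \<zeta> * cip z w \<notin> \<real>\<^sub>\<le>\<^sub>0" if "\<zeta> \<in> U" for \<zeta>
  proof -
    have "norm (cip (\<zeta> *s z) w) < 1" using w nU[OF that] by (intro norm_cip_less_1) auto
    then show ?thesis using Re_one_plus_pos[of "cip (\<zeta> *s z) w"] by (auto simp: complex_nonpos_Reals_iff cip_smult_left)
  qed
  have b0: "\<beta> \<zeta> \<noteq> 0" if "\<zeta> \<in> U" for \<zeta> using q[OF that] gam_facts(1)[OF w] by (auto simp: \<beta>_def)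
  define A where "A = fst (boost w (z, 0))"
  define B where "B = fst (boost w (0, 1))"
  have lin: "boost w (\<zeta> *s z, 1) = cscale \<zeta> (boost w (z, 0)) + boost w (0, 1)" for \<zeta>
    unfolding pseudo_unitaryD(1,2)[OF boost_pseudo_unitary[OF w], symmetric] by (simp add: cscale_def)
  have curve: "pact (boost w) (\<zeta> *s z) = (\<zeta> / \<beta> \<zeta>) *s A + (1 / \<beta> \<zeta>) *s B" for \<zeta>
    unfolding pact_def pden_boost lin
    by (simp add: cscale_def A_def B_def \<beta>_def cip_smult_left vec_eq_iff divide_inverse algebra_simps)
  have h1: "(\<lambda>\<zeta>. f ((\<zeta> / \<beta> \<zeta>) *s A + (1 / \<beta> \<zeta>) *s B)) holomorphic_on U"
  proof (rule holomorphic_on_affine_curve[OF f U])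
    show "(\<lambda>\<zeta>. \<zeta> / \<beta> \<zeta>) holomorphic_on U" "(\<lambda>\<zeta>. 1 / \<beta> \<zeta>) holomorphic_on U"
      using b0 unfolding \<beta>_def by (auto intro!: holomorphic_intros)
    show "(\<zeta> / \<beta> \<zeta>) *s A + (1 / \<beta> \<zeta>) *s B \<in> ball 0 1" if "\<zeta> \<in> U" for \<zeta>
      unfolding curve[symmetric] using nU[OF that] by (intro pact_in_ball boost_pseudo_unitary[OF w]) simp
  qed
  have h2: "(\<lambda>\<zeta>. (1 + \<zeta> * cip z w) powr (- of_real s)) holomorphic_on U"
    using q by (intro holomorphic_intros) auto
  have "(\<lambda>\<zeta>. f (pact (boost w) (\<zeta> *s z)) * (1 + cip (\<zeta> *s z) w) powr (- of_real s)) holomorphic_on U"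
    unfolding curve cip_smult_left by (rule holomorphic_on_mult[OF h1 h2])
  then show ?thesis using sub by (rule holomorphic_on_subset)
qed

text \<open>F is f moved by the boost that takes 0 to w, times the factor left over in
  \<open>boost_kernel\<close>. Radius 1 turns the mean value into the reproducing property, and
  radius 1/2 into the local estimate behind the Carleson bound.\<close>

lemma bergman_mean_value_at:
  fixes w :: "complex ^ ('n::finite)"
  assumes s: "real CARD('n) < s" and f: "holomorphic_n_on f (ball 0 1)" and fi: "integrable (bergman_measure s) f"
    and w: "w \<in> ball 0 1" and r: "0 < r" "r \<le> 1"
  defines "F \<equiv> \<lambda>z. f (pact (boost w) z) * (1 + cip z w) powr (- of_real s)"
  shows "integrable (bergman_measure s) (\<lambda>z. indicator (ball 0 r) z *\<^sub>R F z)"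
    and "(LINT z|bergman_measure s. indicator (ball 0 r) z *\<^sub>R F z) = measure (bergman_measure s :: (complex ^ 'n) measure) (ball 0 r) *\<^sub>R f w"
    and "(LINT z|bergman_measure s. indicator (ball 0 1) z *\<^sub>R F z) = (LINT z|bergman_measure s. f z * cnj (bergman_kernel s w z))"
proof -
  let ?B = "bergman_measure s :: (complex ^ 'n) measure"
  define \<Phi> where "\<Phi> = (\<lambda>z. indicator (ball 0 1) z *\<^sub>R (f z * cnj (bergman_kernel s w z)))"
  have sp: "0 \<le> s" using s by linarith
  have [measurable]: "bergman_kernel s w \<in> borel_measurable ?B" by (rule borel_measurable_bergman) measurable
  have [measurable]: "f \<in> borel_measurable ?B" using fi by auto
  have [measurable]: "(\<lambda>z. indicator (ball (0 :: complex ^ 'n) r) z :: real) \<in> borel_measurable ?B" for r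
    by (intro borel_measurable_bergman borel_measurable_indicator) simp
  have \<Phi>m [measurable]: "\<Phi> \<in> borel_measurable ?B" unfolding \<Phi>_def by measurable
  \<comment> \<open>For fixed w in the ball the kernel is bounded in z, so integrability of f is
    enough.\<close>
  have \<Phi>i: "integrable ?B \<Phi>"
  proof (rule Bochner_Integration.integrable_bound)
    show "integrable ?B (\<lambda>z. of_real ((1 - norm w) powr (- s)) * f z)" using fi by simp
    show "AE z in ?B. norm (\<Phi> z) \<le> norm (of_real ((1 - norm w) powr (- s)) * f z)"
    proof (rule AE_I2)
      fix z :: "complex ^ 'n"
      show "norm (\<Phi> z) \<le> norm (of_real ((1 - norm w) powr (- s)) * f z)"
      proof (cases "z \<in> ball 0 1")
        case True
        have "norm (f z) * norm (bergman_kernel s w z) \<le> norm (f z) * (1 - norm w) powr (- s)"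
          using True w sp by (intro mult_left_mono norm_bergman_kernel_le) auto
        then show ?thesis using True by (simp add: \<Phi>_def norm_mult mult.commute)
      qed (simp add: \<Phi>_def)
    qed
  qed measurable
  have key: "jac s (boost w) z *\<^sub>R \<Phi> (tact (boost w) z) = indicator (ball 0 1) z *\<^sub>R F z" for z
  proof (cases "z \<in> ball 0 1")
    case True
    then have "pact (boost w) z \<in> ball 0 1" by (rule pact_in_ball[OF boost_pseudo_unitary[OF w]])
    then show ?thesis
      using True boost_kernel[OF w True, of s] by (simp add: tact_def \<Phi>_def F_def)
         (metis mult_scaleR_right)
  qed (simp add: tact_def \<Phi>_def)
  have i1: "integrable ?B (\<lambda>z. indicator (ball 0 1) z *\<^sub>R F z)"
    using integrable_bergman_tact[OF boost_pseudo_unitary[OF w] s \<Phi>m] \<Phi>i unfolding key by simp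
  have "(\<lambda>z. indicator (ball 0 r) z *\<^sub>R F z) = (\<lambda>z. indicator (ball 0 r) z *\<^sub>R (indicator (ball 0 1) z *\<^sub>R F z))"
    using r by (auto simp: indicator_def)
  moreover have "integrable ?B (\<lambda>z. indicator (ball 0 r) z *\<^sub>R (indicator (ball 0 1) z *\<^sub>R F z))"
    by (rule integrable_mult_indicator[OF _ i1]) simp
  ultimately show i2: "integrable ?B (\<lambda>z. indicator (ball 0 r) z *\<^sub>R F z)" by simp
  have cF: "continuous_on (ball 0 1) F"
    unfolding F_def
  proof (intro continuous_on_mult continuous_on_powr_Re_pos)
    show "continuous_on (ball 0 1) (\<lambda>z. 1 + cip z w)" by (intro continuous_intros)
    show "continuous_on (ball 0 1) (\<lambda>z. f (pact (boost w) z))"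
      using pact_in_ball[OF boost_pseudo_unitary[OF w]]
      by (intro continuous_on_compose2[OF holomorphic_n_continuous[OF f]] continuous_on_pact boost_pseudo_unitary[OF w]) auto
    fix z :: "complex ^ 'n" assume "z \<in> ball 0 1"
    then have "norm (cip z w) < 1" using w by (intro norm_cip_less_1) auto
    then show "0 < Re (1 + cip z w)" by (rule Re_one_plus_pos)
  qed
  have "F 0 = f w" by (simp add: F_def pact_boost_0[OF w])
  then show "(LINT z|?B. indicator (ball 0 r) z *\<^sub>R F z) = measure ?B (ball 0 r) *\<^sub>R f w"
    using mean_value_ball[OF s r(2,1) cF _ i2] boost_slice_holomorphic[OF f w] by (simp add: F_def)
  have "(LINT z|?B. indicator (ball 0 1) z *\<^sub>R F z) = (LINT z|?B. \<Phi> z)"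
    using integral_bergman_tact[OF boost_pseudo_unitary[OF w] s \<Phi>m] unfolding key .
  also have "\<dots> = (LINT z|?B. f z * cnj (bergman_kernel s w z))"
    by (rule integral_cong_AE) (use AE_bergman_ball[OF s] in \<open>auto simp: \<Phi>_def elim!: eventually_mono\<close>)
  finally show "(LINT z|?B. indicator (ball 0 1) z *\<^sub>R F z) = (LINT z|?B. f z * cnj (bergman_kernel s w z))" .
qed

lemma measure_bergman_ball_1:
  assumes s: "real CARD('n::finite) < s"
  shows "measure (bergman_measure s :: (complex ^ 'n) measure) (ball 0 1) = 1"
proof -
  have "emeasure (bergman_measure s :: (complex ^ 'n) measure) (ball 0 1) = emeasure (bergman_measure s :: (complex ^ 'n) measure) UNIV"
    by (rule emeasure_eq_AE) (use AE_bergman_ball[where 'n='n, OF s] in \<open>auto elim!: eventually_mono\<close>)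
  then show ?thesis by (simp add: measure_def emeasure_bergman_UNIV[OF s])
qed

theorem bergman_reproducing:
  fixes w :: "complex ^ ('n::finite)"
  assumes s: "real CARD('n) < s" and f: "holomorphic_n_on f (ball 0 1)" and fi: "integrable (bergman_measure s) f"
    and w: "w \<in> ball 0 1"
  shows "f w = (LINT z|bergman_measure s. f z * cnj (bergman_kernel s w z))"
  using bergman_mean_value_at(2,3)[OF s f fi w, of 1] by (simp add: measure_bergman_ball_1[OF s])

lemma measure_bergman_ball_pos:
  assumes s: "real CARD('n::finite) < s" and r: "0 < r" "r \<le> 1"
  shows "measure (bergman_measure s :: (complex ^ 'n) measure) (ball 0 r) > 0"
proof (rule ccontr)
  let ?B = "bergman_measure s :: (complex ^ 'n) measure"
  interpret B: finite_measure ?B by (rule finite_measure_bergman[OF s])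
  assume "\<not> measure ?B (ball 0 r) > 0"
  then have "measure ?B (ball 0 r) = 0" by (metis measure_nonneg order_le_less)
  then have "emeasure ?B (ball 0 r) = 0" by (simp add: B.emeasure_eq_measure)
  then have "(\<integral>\<^sup>+z. indicator (ball 0 r) z \<partial>?B) = 0" by (subst nn_integral_indicator) auto
  then have "(\<integral>\<^sup>+z. indicator (ball (0 :: complex ^ 'n) r) z * ennreal (wdens s z) \<partial>lborel) = 0"
    by (subst (asm) nn_integral_bergman[OF s]) (auto intro!: borel_measurable_indicator)
  then have "AE z in lborel. indicator (ball (0 :: complex ^ 'n) r) z * ennreal (wdens s z) = 0"
    by (subst (asm) nn_integral_0_iff_AE) (auto intro!: borel_measurable_times_ennreal borel_measurable_indicator)
  then have "AE z in lborel. (z :: complex ^ 'n) \<notin> ball 0 r"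
  proof eventually_elim
    case (elim z)
    show ?case
    proof
      assume "z \<in> ball 0 r"
      moreover from this have "z \<in> ball 0 1" using r by simp
      ultimately show False using elim wdens_pos[OF s, of z] by (simp add: indicator_def ennreal_eq_0_iff)
    qed
  qed
  then have "emeasure lborel (ball (0 :: complex ^ 'n) r) = 0"
    by (subst (asm) AE_iff_measurable[OF _ refl]) (auto simp: ball_def)
  moreover have "measure lborel (ball (0 :: complex ^ 'n) r) > 0" using content_ball_gt_0_iff[of "0 :: complex ^ 'n" r] r by simp
  ultimately show False by (simp add: measure_def)
qed

section \<open>Hilbert spaces of functions\<close>

lemma tendsto_norm_square_zero:
  assumes "((\<lambda>x. (norm (u x))\<^sup>2) \<longlongrightarrow> (0::real)) F"
  shows "(u \<longlongrightarrow> 0) F"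
proof (rule tendsto_norm_zero_cancel)
  show "((\<lambda>x. norm (u x)) \<longlongrightarrow> 0) F" using tendsto_real_sqrt[OF assms] by simp
qed

text \<open>The form may be degenerate, since square integrable functions are not identified when
  they agree almost everywhere.\<close>

locale semi_inner_space =
  fixes V :: "('a \<Rightarrow> complex) set" and ip :: "('a \<Rightarrow> complex) \<Rightarrow> ('a \<Rightarrow> complex) \<Rightarrow> complex"
  assumes zero_closed: "(\<lambda>x. 0) \<in> V"
    and add_closed: "f \<in> V \<Longrightarrow> g \<in> V \<Longrightarrow> (\<lambda>x. f x + g x) \<in> V"
    and scale_closed: "f \<in> V \<Longrightarrow> (\<lambda>x. c * f x) \<in> V"
    and ip_add: "f \<in> V \<Longrightarrow> g \<in> V \<Longrightarrow> h \<in> V \<Longrightarrow> ip (\<lambda>x. f x + g x) h = ip f h + ip g h"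
    and ip_scale: "f \<in> V \<Longrightarrow> h \<in> V \<Longrightarrow> ip (\<lambda>x. c * f x) h = c * ip f h"
    and ip_cnj: "f \<in> V \<Longrightarrow> g \<in> V \<Longrightarrow> cnj (ip f g) = ip g f"
    and ip_nonneg: "f \<in> V \<Longrightarrow> 0 \<le> Re (ip f f)"
begin

definition sqn :: "('a \<Rightarrow> complex) \<Rightarrow> real" where
  "sqn f = Re (ip f f)"

lemma ip_add_right: "f \<in> V \<Longrightarrow> g \<in> V \<Longrightarrow> h \<in> V \<Longrightarrow> ip f (\<lambda>x. g x + h x) = ip f g + ip f h"
  using ip_cnj[OF add_closed[of g h], of f] ip_add[of g h f] ip_cnj[of g f] ip_cnj[of h f] by simp

lemma ip_scale_right: "f \<in> V \<Longrightarrow> h \<in> V \<Longrightarrow> ip f (\<lambda>x. c * h x) = cnj c * ip f h"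
  using ip_cnj[OF scale_closed[of h c], of f] ip_scale[of h f c] ip_cnj[of h f] by simp

lemma diff_closed: "f \<in> V \<Longrightarrow> g \<in> V \<Longrightarrow> (\<lambda>x. f x - g x) \<in> V"
  using add_closed[OF _ scale_closed, of f g "- 1"] by simp

lemma ip_diff_right: "f \<in> V \<Longrightarrow> g \<in> V \<Longrightarrow> h \<in> V \<Longrightarrow> ip f (\<lambda>x. g x - h x) = ip f g - ip f h"
  using ip_add_right[OF _ _ scale_closed, of f g h "- 1"] ip_scale_right[of f h "- 1"] by simp

lemma ip_diff: "f \<in> V \<Longrightarrow> g \<in> V \<Longrightarrow> h \<in> V \<Longrightarrow> ip (\<lambda>x. f x - g x) h = ip f h - ip g h"
  using ip_add[OF _ scale_closed, of f g h "- 1"] ip_scale[of g h "- 1"] by simp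

lemma sqn_add_scale:
  assumes "f \<in> V" "g \<in> V"
  shows "sqn (\<lambda>x. f x + c * g x) = sqn f + 2 * Re (c * ip g f) + (norm c)\<^sup>2 * sqn g"
proof -
  have cg: "(\<lambda>x. c * g x) \<in> V" using assms by (simp add: scale_closed)
  have "ip (\<lambda>x. f x + c * g x) (\<lambda>x. f x + c * g x) = ip f f + cnj c * ip f g + (c * ip g f + c * cnj c * ip g g)"
    using assms cg by (simp add: ip_add ip_add_right ip_scale ip_scale_right add_closed algebra_simps)
  moreover have "Re (cnj c * ip f g) = Re (c * ip g f)"
    unfolding ip_cnj[OF assms(2,1), symmetric] by (metis complex_cnj_mult cnj.sel(1))
  moreover have "Re (c * cnj c * ip g g) = (norm c)\<^sup>2 * sqn g"
    unfolding complex_norm_square[symmetric] sqn_def by (simp flip: of_real_power)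
  ultimately show ?thesis by (simp add: sqn_def)
qed

lemma cauchy_schwarz:
  assumes f: "f \<in> V" and g: "g \<in> V"
  shows "(norm (ip f g))\<^sup>2 \<le> sqn f * sqn g"
proof (rule field_le_epsilon)
  fix e :: real assume e: "0 < e"
  \<comment> \<open>The optimal coefficient would divide by \<open>sqn g\<close>, which may be 0.
    Adding k keeps the denominator positive, and its size makes the resulting error at most
    e.\<close>
  define k where "k = e / (sqn f + 1)"
  have sf: "sqn f \<ge> 0" and sg: "sqn g \<ge> 0" using ip_nonneg f g by (auto simp: sqn_def)
  then have k: "k > 0" using e by (simp add: k_def)
  define a where "a = ip f g"
  define t where "t = 1 / (sqn g + k)"
  have t: "t > 0" using sg k by (simp add: t_def)
  have "0 \<le> sqn (\<lambda>x. f x + (- (of_real t * a)) * g x)"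
    unfolding sqn_def by (intro ip_nonneg add_closed scale_closed f g)
  also have "\<dots> = sqn f - 2 * t * (norm a)\<^sup>2 + t\<^sup>2 * (norm a)\<^sup>2 * sqn g"
  proof -
    have "- (of_real t * a) * ip g f = - of_real (t * (norm a)\<^sup>2)"
      unfolding ip_cnj[OF f g, symmetric] a_def by (simp add: complex_norm_square del: of_real_power)
    then show ?thesis
      unfolding sqn_add_scale[OF f g] \<open>_ = - of_real _\<close> using t by (simp add: norm_mult power_mult_distrib)
  qed
  also have "t\<^sup>2 * (norm a)\<^sup>2 * sqn g \<le> t * (norm a)\<^sup>2"
  proof -
    have "t * sqn g \<le> 1" using sg k by (simp add: t_def)
    then have "(t * (norm a)\<^sup>2) * (t * sqn g) \<le> (t * (norm a)\<^sup>2) * 1" using t by (intro mult_left_mono) auto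
    then show ?thesis by (simp add: power2_eq_square ac_simps)
  qed
  finally have "t * (norm a)\<^sup>2 \<le> sqn f" by simp
  then have "(norm a)\<^sup>2 \<le> sqn f * (sqn g + k)" using sg k by (simp add: t_def field_simps)
  also have "\<dots> \<le> sqn f * sqn g + e"
    using sf e by (simp add: k_def algebra_simps divide_simps)
  finally show "(norm (ip f g))\<^sup>2 \<le> sqn f * sqn g + e" by (simp add: a_def)
qed

lemma parallelogram:
  assumes f: "f \<in> V" and g: "g \<in> V"
  shows "sqn (\<lambda>x. f x - g x) = 2 * sqn f + 2 * sqn g - 4 * sqn (\<lambda>x. (1/2) * (f x + g x))"
proof -
  have 1: "sqn (\<lambda>x. f x - g x) = sqn f - 2 * Re (ip g f) + sqn g"
    using sqn_add_scale[OF f g, of "- 1"] by simp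
  have "sqn (\<lambda>x. (1/2) * (f x + g x)) = sqn (\<lambda>x. (1/2) * f x + (1/2) * g x)" by (simp add: add_divide_distrib)
  also have "\<dots> = sqn (\<lambda>x. (1/2) * f x) + 2 * Re ((1/2) * ip g (\<lambda>x. (1/2) * f x)) + (norm (1/2::complex))\<^sup>2 * sqn g"
    by (rule sqn_add_scale[OF scale_closed[OF f] g])
  also have "\<dots> = sqn f / 4 + Re (ip g f) / 2 + sqn g / 4"
  proof -
    have i1: "ip (\<lambda>x. (1/2) * f x) (\<lambda>x. (1/2) * f x) = of_real (1/4) * ip f f"
      unfolding ip_scale[OF f scale_closed[OF f]] ip_scale_right[OF f f] by simp
    have i2: "(1/2) * ip g (\<lambda>x. (1/2) * f x) = of_real (1/4) * ip g f"
      unfolding ip_scale_right[OF g f] by simp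
    show ?thesis unfolding sqn_def i1 i2 by (simp add: power2_eq_square)
  qed
  finally show ?thesis using 1 by simp
qed

end

text \<open>Completeness is phrased with squared distances; the limit is a function in V and is
  unique only up to distance 0.\<close>

locale function_hilbert_space = semi_inner_space +
  assumes complete: "(\<And>n. X n \<in> V) \<Longrightarrow> (\<And>e. 0 < e \<Longrightarrow> \<exists>N. \<forall>m\<ge>N. \<forall>n\<ge>N. Re (ip (\<lambda>x. X m x - X n x) (\<lambda>x. X m x - X n x)) < e)
    \<Longrightarrow> \<exists>g\<in>V. (\<lambda>n. Re (ip (\<lambda>x. X n x - g x) (\<lambda>x. X n x - g x))) \<longlonglongrightarrow> (0::real)"
begin

text \<open>The representing element minimizes \<open>|f|^2 - 2 Re (l f)\<close>.\<close>
theorem riesz: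
  fixes l :: "('a \<Rightarrow> complex) \<Rightarrow> complex"
  assumes ladd: "\<And>f g. f \<in> V \<Longrightarrow> g \<in> V \<Longrightarrow> l (\<lambda>x. f x + g x) = l f + l g"
    and lscale: "\<And>f c. f \<in> V \<Longrightarrow> l (\<lambda>x. c * f x) = c * l f"
    and lbound: "\<And>f. f \<in> V \<Longrightarrow> (norm (l f))\<^sup>2 \<le> C * sqn f"
  shows "\<exists>g\<in>V. \<forall>f\<in>V. l f = ip f g"
proof -
  define Q where "Q = (\<lambda>f. sqn f - 2 * Re (l f))"
  \<comment> \<open>From |l f|^2 \<le> |C| sqn f and the inequality between the means, 2 Re (l f) is
    at most |C| + sqn f.\<close>
  have low: "- \<bar>C\<bar> \<le> Q f" if "f \<in> V" for f
  proof -
    have sf: "sqn f \<ge> 0" using ip_nonneg[OF that] by (simp add: sqn_def)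
    have "(Re (l f))\<^sup>2 \<le> (norm (l f))\<^sup>2" by (simp add: abs_Re_le_cmod power2_le_iff_abs_le)
    also have "\<dots> \<le> \<bar>C\<bar> * sqn f" using lbound[OF that] sf by (smt (verit) mult_right_mono)
    finally have "(2 * Re (l f))\<^sup>2 \<le> 4 * (\<bar>C\<bar> * sqn f)" by (simp add: power_mult_distrib)
    also have "\<dots> \<le> (\<bar>C\<bar> + sqn f)\<^sup>2"
    proof -
      have "(\<bar>C\<bar> + sqn f)\<^sup>2 - 4 * (\<bar>C\<bar> * sqn f) = (\<bar>C\<bar> - sqn f)\<^sup>2" by (simp add: power2_eq_square algebra_simps)
      then show ?thesis by (smt (verit) zero_le_power2)
    qed
    finally have "2 * Re (l f) \<le> \<bar>C\<bar> + sqn f" using sf by (meson abs_ge_zero add_nonneg_nonneg power2_le_imp_le)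
    then show ?thesis by (simp add: Q_def)
  qed
  define d where "d = Inf (Q ` V)"
  have bdd: "bdd_below (Q ` V)" using low by (intro bdd_belowI2[where m="- \<bar>C\<bar>"])
  have dle: "d \<le> Q f" if "f \<in> V" for f unfolding d_def using bdd that by (rule cINF_lower)
  have "\<exists>f\<in>V. Q f < d + 1 / real (Suc n)" for n
  proof -
    have "Inf (Q ` V) < d + 1 / real (Suc n)" by (simp add: d_def)
    then show ?thesis using cInf_lessD[of "Q ` V"] zero_closed by blast
  qed
  then obtain X where X: "\<And>n. X n \<in> V" and QX: "\<And>n. Q (X n) < d + 1 / real (Suc n)" by metis
  \<comment> \<open>The midpoint also has Q at least d, so the parallelogram law makes every
    minimizing sequence Cauchy.\<close>
  have cau: "sqn (\<lambda>x. X m x - X n x) < 2 / real (Suc m) + 2 / real (Suc n)" for m n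
  proof -
    define h where "h = (\<lambda>x. (1/2) * (X m x + X n x))"
    have h: "h \<in> V" unfolding h_def by (intro scale_closed add_closed X)
    have "l h = (1/2) * (l (X m) + l (X n))"
      unfolding h_def using lscale[OF add_closed[OF X[of m] X[of n]], of "1/2"] ladd[OF X[of m] X[of n]] by simp
    from arg_cong[OF this, of Re] have "4 * Re (l h) = 2 * Re (l (X m)) + 2 * Re (l (X n))" by simp
    then have "sqn (\<lambda>x. X m x - X n x) = 2 * Q (X m) + 2 * Q (X n) - 4 * Q h"
      unfolding parallelogram[OF X[of m] X[of n]] h_def[symmetric] Q_def by simp
    then show ?thesis using dle[OF h] QX[of m] QX[of n] by (simp add: algebra_simps)
  qed
  have "\<exists>g\<in>V. (\<lambda>n. Re (ip (\<lambda>x. X n x - g x) (\<lambda>x. X n x - g x))) \<longlonglongrightarrow> 0"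
  proof (rule complete[OF X])
    fix e :: real assume e: "0 < e"
    obtain N where N: "4 / e < real N" using reals_Archimedean2 by blast
    have small: "2 / real (Suc n) < e / 2" if "n \<ge> N" for n
    proof -
      have "4 / e < real (Suc n)" using N that by simp
      then show ?thesis using e by (simp add: field_simps)
    qed
    show "\<exists>N. \<forall>m\<ge>N. \<forall>n\<ge>N. Re (ip (\<lambda>x. X m x - X n x) (\<lambda>x. X m x - X n x)) < e"
      using cau small unfolding sqn_def by (intro exI[of _ N]) (smt (verit) field_sum_of_halves)
  qed
  then obtain g where g: "g \<in> V" and lim: "(\<lambda>n. sqn (\<lambda>x. X n x - g x)) \<longlonglongrightarrow> 0" by (auto simp: sqn_def)
  \<comment> \<open>The infimum is tested against X n plus a multiple of f with nearly optimal
    coefficient; the 1 in \<open>t\<close> again guards against sqn f = 0. This yields l f = lim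
    \<langle>f, X n\<rangle> directly, without showing that g attains the infimum.\<close>
  have near: "(norm (ip f (X n) - l f))\<^sup>2 \<le> (sqn f + 1) * (1 / real (Suc n))" if f: "f \<in> V" for f n
  proof -
    define r where "r = ip f (X n) - l f"
    define t where "t = 1 / (sqn f + 1)"
    have sf: "sqn f \<ge> 0" using ip_nonneg[OF f] by (simp add: sqn_def)
    then have t: "t > 0" by (simp add: t_def)
    define c where "c = - (of_real t * cnj r)"
    have "Q (\<lambda>x. X n x + c * f x) = Q (X n) + 2 * Re (c * r) + (norm c)\<^sup>2 * sqn f"
      unfolding Q_def sqn_add_scale[OF X f] ladd[OF X scale_closed[OF f]] lscale[OF f]
      by (simp add: r_def algebra_simps)
    moreover have "c * r = - of_real (t * (norm r)\<^sup>2)"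
      unfolding c_def by (simp add: complex_norm_square ac_simps del: of_real_power)
    then have "Re (c * r) = - (t * (norm r)\<^sup>2)" by simp
    moreover have "(norm c)\<^sup>2 * sqn f \<le> t * (norm r)\<^sup>2"
    proof -
      have "t * sqn f \<le> 1" using sf by (simp add: t_def)
      then have "(t * (norm r)\<^sup>2) * (t * sqn f) \<le> (t * (norm r)\<^sup>2) * 1" using t by (intro mult_left_mono) auto
      then show ?thesis using t by (simp add: c_def norm_mult power_mult_distrib power2_eq_square ac_simps)
    qed
    moreover have "d \<le> Q (\<lambda>x. X n x + c * f x)" by (intro dle add_closed scale_closed X f)
    ultimately have "t * (norm r)\<^sup>2 \<le> 1 / real (Suc n)" using QX[of n] by linarith
    then show ?thesis using sf unfolding r_def[symmetric] t_def by (simp add: field_simps)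
  qed
  have "l f = ip f g" if f: "f \<in> V" for f
  proof -
    have inv0: "(\<lambda>n. 1 / real (Suc n)) \<longlonglongrightarrow> 0" using LIMSEQ_inverse_real_of_nat by (simp add: inverse_eq_divide)
    have a: "(\<lambda>n. (norm (ip f (X n) - l f))\<^sup>2) \<longlonglongrightarrow> 0"
      by (rule tendsto_sandwich[OF _ _ tendsto_const tendsto_mult_right_zero[OF inv0, of "sqn f + 1"]])
        (use near[OF f] in \<open>auto intro!: always_eventually simp del: of_nat_Suc\<close>)
    have b: "(\<lambda>n. (norm (ip f (X n) - ip f g))\<^sup>2) \<longlonglongrightarrow> 0"
    proof (rule tendsto_sandwich[OF _ _ tendsto_const tendsto_mult_right_zero[OF lim]])
      show "\<forall>\<^sub>F n in sequentially. (norm (ip f (X n) - ip f g))\<^sup>2 \<le> sqn f * sqn (\<lambda>x. X n x - g x)"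
        using cauchy_schwarz[OF f diff_closed[OF X g]] by (intro always_eventually allI) (simp add: ip_diff_right f X g)
    qed auto
    show ?thesis
      using LIM_zero_cancel[OF tendsto_norm_square_zero[OF a]] LIM_zero_cancel[OF tendsto_norm_square_zero[OF b]]
      by (rule LIMSEQ_unique)
  qed
  then show ?thesis using g by blast
qed

end

subsection \<open>Square integrable functions\<close>

lemma square_integrableD: "square_integrable M f \<Longrightarrow> f \<in> borel_measurable M"
  "square_integrable M f \<Longrightarrow> integrable M (\<lambda>x. (norm (f x))\<^sup>2)"
  by (simp_all add: square_integrable_def)

lemma square_integrable_bound:
  assumes "integrable M g" "f \<in> borel_measurable M" "AE x in M. (norm (f x))\<^sup>2 \<le> g x"
  shows "square_integrable M f"
  unfolding square_integrable_def
  using assms by (auto intro!: Bochner_Integration.integrable_bound[OF assms(1)] elim!: eventually_mono)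

lemma square_integrable_product:
  assumes f: "square_integrable M f" and g: "square_integrable M g"
  shows "integrable M (\<lambda>x. f x * cnj (g x))"
proof (rule Bochner_Integration.integrable_bound)
  note [measurable] = square_integrableD(1)[OF f] square_integrableD(1)[OF g]
  show "integrable M (\<lambda>x. (norm (f x))\<^sup>2 + (norm (g x))\<^sup>2)" using f g by (simp add: square_integrable_def)
  show "(\<lambda>x. f x * cnj (g x)) \<in> borel_measurable M" by measurable
  have "norm (f x) * norm (g x) \<le> (norm (f x))\<^sup>2 + (norm (g x))\<^sup>2" for x
    using sum_squares_bound[of "norm (f x)" "norm (g x)"] mult_nonneg_nonneg[OF norm_ge_zero[of "f x"] norm_ge_zero[of "g x"]]
    unfolding mult.assoc by linarith
  then show "AE x in M. norm (f x * cnj (g x)) \<le> norm ((norm (f x))\<^sup>2 + (norm (g x))\<^sup>2)"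
    by (simp add: norm_mult)
qed

lemma square_integrable_add:
  assumes f: "square_integrable M f" and g: "square_integrable M g"
  shows "square_integrable M (\<lambda>x. f x + g x)"
proof (rule square_integrable_bound)
  note [measurable] = square_integrableD(1)[OF f] square_integrableD(1)[OF g]
  show "integrable M (\<lambda>x. 2 * (norm (f x))\<^sup>2 + 2 * (norm (g x))\<^sup>2)" using f g by (simp add: square_integrable_def)
  show "(\<lambda>x. f x + g x) \<in> borel_measurable M" by measurable
  have "(norm (f x + g x))\<^sup>2 \<le> 2 * (norm (f x))\<^sup>2 + 2 * (norm (g x))\<^sup>2" for x
  proof -
    have "(norm (f x + g x))\<^sup>2 \<le> (norm (f x) + norm (g x))\<^sup>2" by (intro power_mono norm_triangle_ineq) simp
    also have "\<dots> \<le> 2 * (norm (f x))\<^sup>2 + 2 * (norm (g x))\<^sup>2"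
      using sum_squares_bound[of "norm (f x)" "norm (g x)"] by (simp add: power2_sum)
    finally show ?thesis .
  qed
  then show "AE x in M. (norm (f x + g x))\<^sup>2 \<le> 2 * (norm (f x))\<^sup>2 + 2 * (norm (g x))\<^sup>2" by simp
qed

lemma square_integrable_scale: "square_integrable M f \<Longrightarrow> square_integrable M (\<lambda>x. c * f x)"
  by (auto simp: square_integrable_def norm_mult power_mult_distrib)

lemma semi_inner_space_L2: "semi_inner_space (Collect (square_integrable M)) (l2_inner M)"
proof
  show "(\<lambda>x. 0) \<in> Collect (square_integrable M)" by (simp add: square_integrable_def)
  fix f g h c assume f: "f \<in> Collect (square_integrable M)"
  show "(\<lambda>x. c * f x) \<in> Collect (square_integrable M)" using f square_integrable_scale by blast
  have "l2_inner M f f = (LINT x|M. complex_of_real ((norm (f x))\<^sup>2))"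
    by (simp add: l2_inner_def complex_norm_square del: of_real_power)
  also have "\<dots> = of_real (LINT x|M. (norm (f x))\<^sup>2)" by (rule integral_complex_of_real)
  finally show "0 \<le> Re (l2_inner M f f)" by simp
  assume g: "g \<in> Collect (square_integrable M)"
  show "(\<lambda>x. f x + g x) \<in> Collect (square_integrable M)" using f g square_integrable_add by blast
  show "cnj (l2_inner M f g) = l2_inner M g f"
    unfolding l2_inner_def by (subst Bochner_Integration.integral_cnj[symmetric]) (simp add: mult.commute)
  show "l2_inner M (\<lambda>x. c * f x) g = c * l2_inner M f g"
    unfolding l2_inner_def by (simp add: mult.assoc)
  assume h: "h \<in> Collect (square_integrable M)"
  show "l2_inner M (\<lambda>x. f x + g x) h = l2_inner M f h + l2_inner M g h"
    unfolding l2_inner_def using square_integrable_product[of M f h] square_integrable_product[of M g h] f g h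
    by (simp add: distrib_right)
qed

lemma Re_l2_inner_self: "Re (l2_inner M f f) = (LINT x|M. (norm (f x))\<^sup>2)"
proof -
  have "l2_inner M f f = (LINT x|M. complex_of_real ((norm (f x))\<^sup>2))"
    by (simp add: l2_inner_def complex_norm_square del: of_real_power)
  then show ?thesis by (simp add: integral_complex_of_real del: of_real_power)
qed

lemma l2_cauchy_schwarz:
  assumes "square_integrable M f" "square_integrable M g"
  shows "(norm (l2_inner M f g))\<^sup>2 \<le> (LINT x|M. (norm (f x))\<^sup>2) * (LINT x|M. (norm (g x))\<^sup>2)"
proof -
  interpret L2: semi_inner_space "Collect (square_integrable M)" "l2_inner M" by (rule semi_inner_space_L2)
  show ?thesis using L2.cauchy_schwarz[of f g] assms by (simp add: L2.sqn_def Re_l2_inner_self)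
qed

section \<open>The Bergman space\<close>

lemma has_field_derivative_one_minus_powr:
  assumes "norm (x :: complex) < 1"
  shows "((\<lambda>x. (1 - x) powr a) has_field_derivative (- a * (1 - x) powr (a - 1))) (at x within S)"
proof -
  have nz: "1 - x \<notin> \<real>\<^sub>\<le>\<^sub>0" using Re_one_minus_pos[OF assms] by (auto simp: complex_nonpos_Reals_iff)
  have "((\<lambda>x. (1 - x) powr a) has_field_derivative (a * (1 - x) powr (a - 1) * (- 1))) (at x)"
    by (rule DERIV_chain2[where f="\<lambda>z. z powr a" and g="\<lambda>x. 1 - x", OF has_field_derivative_powr[OF nz]])
       (auto intro!: derivative_eq_intros)
  then show ?thesis by (simp add: has_field_derivative_at_within)
qed

text \<open>The second derivative is bounded on the disc of radius \<rho>, so the remainder is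
  uniform there. This uniformity is what allows differentiation under the integral.\<close>

lemma kernel_taylor:
  fixes u v :: complex
  assumes s: "0 \<le> s" and rho: "\<rho> < 1" and u: "norm u \<le> \<rho>" and v: "norm v \<le> \<rho>"
  shows "norm ((1 - v) powr (- of_real s) - (1 - u) powr (- of_real s) - of_real s * (1 - u) powr (- of_real s - 1) * (v - u))
     \<le> s * (s + 1) * (1 - \<rho>) powr (- s - 2) * (norm (v - u))\<^sup>2"
proof -
  \<comment> \<open>The function and its first two derivatives, indexed as Taylor's theorem
    expects.\<close>
  define f where "f = (\<lambda>(i::nat) x::complex. if i = 0 then (1 - x) powr (- of_real s)
     else if i = 1 then of_real s * (1 - x) powr (- of_real s - 1)
     else of_real s * (of_real s + 1) * (1 - x) powr (- of_real s - 2))"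
  have "norm (f 0 v - (\<Sum>i\<le>1. f i u * (v - u) ^ i / fact i)) \<le>
      (s * (s + 1) * (1 - \<rho>) powr (- s - 2)) * norm (v - u) ^ Suc 1 / fact 1"
  proof (rule complex_Taylor[where S="cball 0 \<rho>"])
    show "convex (cball (0::complex) \<rho>)" by simp
    fix i :: nat and x :: complex assume x: "x \<in> cball 0 \<rho>" and i: "i \<le> 1"
    have x1: "norm x < 1" using x rho by simp
    consider "i = 0" | "i = 1" using i by linarith
    then show "(f i has_field_derivative f (Suc i) x) (at x within cball 0 \<rho>)"
    proof cases
      case 1
      show ?thesis using has_field_derivative_one_minus_powr[OF x1, of "- of_real s"] by (simp add: 1 f_def)
    next
      case 2
      have "((\<lambda>x. of_real s * (1 - x) powr (- of_real s - 1)) has_field_derivative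
          of_real s * (- (- of_real s - 1) * (1 - x) powr (- of_real s - 1 - 1))) (at x within cball 0 \<rho>)"
        by (intro DERIV_cmult has_field_derivative_one_minus_powr x1)
      then show ?thesis by (simp add: 2 f_def algebra_simps)
    qed
  next
    fix x :: complex assume x: "x \<in> cball 0 \<rho>"
    have "1 - \<rho> \<le> norm (1 - x)" using x norm_triangle_ineq2[of 1 x] by simp
    moreover have "- of_real s - 2 = (of_real (- s - 2) :: complex)" by simp
    then have "norm ((1 - x) powr (- of_real s - 2)) = norm (1 - x) powr (- s - 2)" by (metis norm_powr_of_real)
    ultimately have "norm ((1 - x) powr (- of_real s - 2)) \<le> (1 - \<rho>) powr (- s - 2)"
      using s rho by (simp add: powr_mono2')
    moreover have "norm (of_real s * (of_real s + 1) :: complex) = s * (s + 1)"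
      using s by (metis abs_of_nonneg add_nonneg_nonneg mult_nonneg_nonneg norm_of_real of_real_1 of_real_add of_real_mult zero_le_one)
    ultimately show "norm (f (Suc 1) x) \<le> s * (s + 1) * (1 - \<rho>) powr (- s - 2)"
      using s by (simp add: f_def norm_mult mult_left_mono)
  qed (use u v in auto)
  moreover have "f 0 v - (\<Sum>i\<le>1. f i u * (v - u) ^ i / fact i) =
     (1 - v) powr (- of_real s) - (1 - u) powr (- of_real s) - of_real s * (1 - u) powr (- of_real s - 1) * (v - u)"
    by (simp add: f_def)
  ultimately show ?thesis by (simp add: power2_eq_square)
qed

text \<open>The conjugate kernel is (1 - \<langle>w, z\<rangle>)^(-s), holomorphic in w. Its Taylor
  remainder is at most a constant times |v|^2 uniformly in z, so an integrable F permits
  differentiation under the integral.\<close>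

lemma kernel_integral_holomorphic:
  fixes F :: "complex ^ ('n::finite) \<Rightarrow> complex"
  assumes s: "real CARD('n) < s" and F: "integrable (bergman_measure s) F"
  shows "holomorphic_n_on (\<lambda>w. LINT z|bergman_measure s. F z * cnj (bergman_kernel s w z)) (ball 0 1)"
  unfolding holomorphic_n_on_def
proof (intro ballI)
  let ?B = "bergman_measure s :: (complex ^ 'n) measure"
  fix w0 :: "complex ^ 'n" assume w0: "w0 \<in> ball 0 1"
  have sp: "0 \<le> s" using s by linarith
  note AEb = AE_bergman_ball[where 'n='n, OF s]
  have [measurable]: "F \<in> borel_measurable ?B" using F by auto
  have [measurable]: "(\<lambda>z::complex^'n. z) \<in> borel_measurable ?B" by (rule borel_measurable_bergman) simp
  define q where "q = (\<lambda>u. (1 - u) powr (- complex_of_real s))"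
  define q' where "q' = (\<lambda>u. of_real s * (1 - u) powr (- complex_of_real s - 1))"
  have [measurable]: "q \<in> borel_measurable borel" "q' \<in> borel_measurable borel"
    unfolding q_def q'_def powr_def by measurable
  \<comment> \<open>\<rho> lies halfway between |w0| and 1, and \<delta> is the distance to it, so
    that all points within \<delta> of w0 keep the kernel away from its singularity.\<close>
  define \<rho> where "\<rho> = (1 + norm w0) / 2"
  define \<delta> where "\<delta> = (1 - norm w0) / 2"
  have rho: "\<rho> < 1" "norm w0 \<le> \<rho>" "0 \<le> \<rho>" and del: "\<delta> > 0" using w0 by (auto simp: \<rho>_def \<delta>_def)
  have cb: "norm (cip x z) \<le> norm x" if "z \<in> ball 0 1" for x z :: "complex ^ 'n"
  proof -
    have "norm (cip x z) \<le> norm x * norm z" by (rule norm_cip)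
    also have "\<dots> \<le> norm x * 1" using that by (intro mult_left_mono) auto
    finally show ?thesis by simp
  qed
  have qb: "norm (q u) \<le> (1 - \<rho>) powr (- s)" "norm (q' u) \<le> s * (1 - \<rho>) powr (- s - 1)" if "norm u \<le> \<rho>" for u
  proof -
    have ge: "1 - \<rho> \<le> norm (1 - u)" using that norm_triangle_ineq2[of 1 u] by simp
    then show "norm (q u) \<le> (1 - \<rho>) powr (- s)"
      unfolding q_def norm_powr_minus_of_real using sp rho by (intro powr_mono2') auto
    have "- of_real s - 1 = (of_real (- s - 1) :: complex)" by simp
    then have "norm ((1 - u) powr (- of_real s - 1)) = norm (1 - u) powr (- s - 1)" by (metis norm_powr_of_real)
    then have "norm ((1 - u) powr (- of_real s - 1)) \<le> (1 - \<rho>) powr (- s - 1)"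
      using ge sp rho by (simp add: powr_mono2')
    then show "norm (q' u) \<le> s * (1 - \<rho>) powr (- s - 1)"
      using sp by (simp add: q'_def norm_mult mult_left_mono)
  qed
  define g where "g = (\<lambda>w. LINT z|?B. F z * q (cip w z))"
  define D where "D = (\<lambda>v. LINT z|?B. F z * (q' (cip w0 z) * cip v z))"
  have bd: "integrable ?B (\<lambda>z. F z * h z)" if [measurable]: "h \<in> borel_measurable ?B" and "\<And>z. z \<in> ball 0 1 \<Longrightarrow> norm (h z) \<le> C" for h C
  proof (rule Bochner_Integration.integrable_bound)
    show "integrable ?B (\<lambda>z. of_real C * F z)" using F by simp
    show "AE z in ?B. norm (F z * h z) \<le> norm (of_real C * F z)"
      using AEb
    proof eventually_elim
      case (elim z)
      have "norm (F z) * norm (h z) \<le> norm (F z) * \<bar>C\<bar>" using that(2)[OF elim] by (intro mult_left_mono) auto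
      then show ?case by (simp add: norm_mult mult.commute)
    qed
  qed measurable
  have Iq: "integrable ?B (\<lambda>z. F z * q (cip w z))" if "norm w \<le> \<rho>" for w
    by (rule bd[of _ "(1 - \<rho>) powr (- s)"], measurable) (use cb[of _ w] qb(1) that in \<open>meson order_trans\<close>)
  have ID: "integrable ?B (\<lambda>z. F z * (q' (cip w0 z) * cip v z))" for v
  proof (rule bd[of _ "s * (1 - \<rho>) powr (- s - 1) * norm v"], measurable)
    fix z :: "complex ^ 'n" assume z: "z \<in> ball 0 1"
    have "norm (cip w0 z) \<le> \<rho>" using cb[OF z, of w0] rho by simp
    then show "norm (q' (cip w0 z) * cip v z) \<le> s * (1 - \<rho>) powr (- s - 1) * norm v"
      unfolding norm_mult using cb[OF z, of v] qb(2) sp by (intro mult_mono) auto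
  qed
  have Dadd: "D (v + v') = D v + D v'" for v v'
    unfolding D_def cip_add_left distrib_left by (rule Bochner_Integration.integral_add[OF ID ID])
  have Dscale: "D (c *s v) = c * D v" for c v
    unfolding D_def cip_smult_left by (subst integral_mult_right_zero[symmetric]) (simp add: ac_simps)
  have bdn: "norm (LINT z|?B. F z * h z) \<le> (LINT z|?B. norm (F z)) * C"
    if [measurable]: "h \<in> borel_measurable ?B" and C: "\<And>z. z \<in> ball 0 1 \<Longrightarrow> norm (h z) \<le> C" for h C
  proof -
    have I: "integrable ?B (\<lambda>z. F z * h z)" by (rule bd[of h C]) (use that in auto)
    have "norm (LINT z|?B. F z * h z) \<le> (LINT z|?B. norm (F z * h z))" by simp
    also have "\<dots> \<le> (LINT z|?B. norm (F z) * C)"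
    proof (rule integral_mono_AE)
      show "integrable ?B (\<lambda>z. norm (F z * h z))" using I by simp
      show "integrable ?B (\<lambda>z. norm (F z) * C)" using F by simp
      show "AE z in ?B. norm (F z * h z) \<le> norm (F z) * C"
        using AEb by eventually_elim (simp add: norm_mult mult_left_mono C)
    qed
    finally show ?thesis by simp
  qed
  have Dbound: "norm (D v) \<le> norm v * ((LINT z|?B. norm (F z)) * (s * (1 - \<rho>) powr (- s - 1)))" for v
  proof -
    have "norm (D v) \<le> (LINT z|?B. norm (F z)) * (s * (1 - \<rho>) powr (- s - 1) * norm v)"
      unfolding D_def
    proof (rule bdn, measurable)
      fix z :: "complex ^ 'n" assume z: "z \<in> ball 0 1"
      have "norm (cip w0 z) \<le> \<rho>" using cb[OF z, of w0] rho by simp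
      then show "norm (q' (cip w0 z) * cip v z) \<le> s * (1 - \<rho>) powr (- s - 1) * norm v"
        unfolding norm_mult using cb[OF z, of v] qb(2) sp by (intro mult_mono) auto
    qed
    then show ?thesis by (simp add: ac_simps)
  qed
  have "D (r *\<^sub>R v) = r *\<^sub>R D v" for r v
    unfolding scaleR_eq_smult Dscale by (simp add: scaleR_conv_of_real)
  then have bl: "bounded_linear D" by (rule bounded_linear_intro[OF Dadd _ Dbound])
  define c where "c = s * (s + 1) * (1 - \<rho>) powr (- s - 2)"
  have rem: "norm (g (w0 + v) - g w0 - D v) \<le> (LINT z|?B. norm (F z)) * (c * (norm v)\<^sup>2)" if v: "norm v < \<delta>" for v
  proof -
    have wv: "norm (w0 + v) \<le> \<rho>" using v norm_triangle_ineq[of w0 v] by (simp add: \<rho>_def \<delta>_def field_simps)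
    have "g (w0 + v) - g w0 - D v = (LINT z|?B. F z * (q (cip (w0 + v) z) - q (cip w0 z) - q' (cip w0 z) * cip v z))"
      unfolding g_def D_def right_diff_distrib
      using Iq[OF wv] Iq[OF rho(2)] ID by simp
    also have "norm \<dots> \<le> (LINT z|?B. norm (F z)) * (c * (norm v)\<^sup>2)"
    proof (rule bdn, measurable)
      fix z :: "complex ^ 'n" assume z: "z \<in> ball 0 1"
      have n: "norm (cip w0 z) \<le> \<rho>" "norm (cip (w0 + v) z) \<le> \<rho>"
        using cb[OF z, of w0] cb[OF z, of "w0 + v"] rho wv by auto
      have "norm (q (cip (w0 + v) z) - q (cip w0 z) - q' (cip w0 z) * cip v z) \<le> c * (norm (cip v z))\<^sup>2"
        using kernel_taylor[OF sp rho(1) n] unfolding q_def q'_def c_def by (simp add: cip_add_left)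
      also have "\<dots> \<le> c * (norm v)\<^sup>2"
        using sp cb[OF z, of v] unfolding c_def by (intro mult_left_mono power_mono) auto
      finally show "norm (q (cip (w0 + v) z) - q (cip w0 z) - q' (cip w0 z) * cip v z) \<le> c * (norm v)\<^sup>2" .
    qed
    finally show ?thesis .
  qed
  have "(g has_derivative D) (at w0)"
    unfolding has_derivative_at
  proof (intro conjI bl)
    define K where "K = (LINT z|?B. norm (F z)) * c"
    have "((\<lambda>h :: complex ^ 'n. K * norm h) \<longlongrightarrow> K * norm (0 :: complex ^ 'n)) (at 0)" by (intro tendsto_intros)
    then have lim: "((\<lambda>h :: complex ^ 'n. K * norm h) \<longlongrightarrow> 0) (at 0)" by simp
    show "(\<lambda>h. norm (g (w0 + h) - g w0 - D h) / norm h) \<midarrow>0\<rightarrow> 0"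
    proof (rule Lim_null_comparison[OF _ lim])
      show "\<forall>\<^sub>F h in at 0. norm (norm (g (w0 + h) - g w0 - D h) / norm h) \<le> K * norm h"
        unfolding eventually_at
      proof (intro exI[of _ \<delta>] conjI ballI impI del)
        fix h :: "complex ^ 'n" assume h: "h \<noteq> 0 \<and> dist h 0 < \<delta>"
        then have "norm (g (w0 + h) - g w0 - D h) \<le> K * (norm h)\<^sup>2" using rem[of h] by (simp add: K_def mult.assoc)
        then show "norm (norm (g (w0 + h) - g w0 - D h) / norm h) \<le> K * norm h"
          using h by (simp add: divide_simps power2_eq_square mult.assoc)
      qed
    qed
  qed
  moreover have "g w = (LINT z|?B. F z * cnj (bergman_kernel s w z))" if w: "w \<in> ball 0 1" for w
    unfolding g_def
  proof (rule integral_cong_AE)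
    have [measurable]: "bergman_kernel s w \<in> borel_measurable ?B" by (rule borel_measurable_bergman) measurable
    show "(\<lambda>z. F z * q (cip w z)) \<in> borel_measurable ?B" "(\<lambda>z. F z * cnj (bergman_kernel s w z)) \<in> borel_measurable ?B"
      by measurable
    show "AE z in ?B. F z * q (cip w z) = F z * cnj (bergman_kernel s w z)"
      using AEb
    proof eventually_elim
      case (elim z)
      have "norm (cip z w) < 1" using elim w by (intro norm_cip_less_1) auto
      then show ?case by (simp add: cnj_bergman_kernel q_def) (simp add: bergman_kernel_cip)
    qed
  qed
  ultimately have "((\<lambda>w. LINT z|?B. F z * cnj (bergman_kernel s w z)) has_derivative D) (at w0)"
    by (rule has_derivative_transform_within_open[OF _ open_ball w0])
  then show "\<exists>f'. ((\<lambda>w. LINT z|?B. F z * cnj (bergman_kernel s w z)) has_derivative f') (at w0) \<and> (\<forall>c v. f' (c *s v) = c * f' v)"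
    using Dscale by blast
qed

lemma holomorphic_n_on_add:
  assumes "holomorphic_n_on f S" "holomorphic_n_on g S"
  shows "holomorphic_n_on (\<lambda>z. f z + g z) S"
  unfolding holomorphic_n_on_def
proof (intro ballI)
  fix z assume "z \<in> S"
  then obtain f' g' where "(f has_derivative f') (at z)" "\<forall>c v. f' (c *s v) = c * f' v"
    "(g has_derivative g') (at z)" "\<forall>c v. g' (c *s v) = c * g' v"
    using assms unfolding holomorphic_n_on_def by meson
  then show "\<exists>h. ((\<lambda>z. f z + g z) has_derivative h) (at z) \<and> (\<forall>c v. h (c *s v) = c * h v)"
    by (intro exI[of _ "\<lambda>v. f' v + g' v"]) (simp add: has_derivative_add distrib_left)
qed

lemma holomorphic_n_on_scale:
  assumes "holomorphic_n_on f S"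
  shows "holomorphic_n_on (\<lambda>z. c * f z) S"
  unfolding holomorphic_n_on_def
proof (intro ballI)
  fix z assume "z \<in> S"
  then obtain f' where "(f has_derivative f') (at z)" "\<forall>c v. f' (c *s v) = c * f' v"
    using assms unfolding holomorphic_n_on_def by meson
  then show "\<exists>h. ((\<lambda>z. c * f z) has_derivative h) (at z) \<and> (\<forall>d v. h (d *s v) = d * h v)"
    by (intro exI[of _ "\<lambda>v. c * f' v"]) (simp add: has_derivative_mult_right)
qed

lemma holomorphic_n_on_cong_ball:
  assumes "holomorphic_n_on f (ball 0 1)" "\<And>z. z \<in> ball 0 1 \<Longrightarrow> f z = g z"
  shows "holomorphic_n_on g (ball 0 1)"
  unfolding holomorphic_n_on_def
proof (intro ballI)
  fix z :: "complex ^ 'a" assume z: "z \<in> ball 0 1"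
  then obtain f' where f': "(f has_derivative f') (at z)" "\<forall>c v. f' (c *s v) = c * f' v"
    using assms unfolding holomorphic_n_on_def by meson
  have "(g has_derivative f') (at z)"
    by (rule has_derivative_transform_within_open[OF f'(1) open_ball z assms(2)])
  then show "\<exists>h. (g has_derivative h) (at z) \<and> (\<forall>d v. h (d *s v) = d * h v)" using f'(2) by blast
qed

text \<open>Elements of the Bergman space vanish off the ball, so the kernel has to be cut off.\<close>
definition kernel0 :: "real \<Rightarrow> complex ^ ('n::finite) \<Rightarrow> complex ^ 'n \<Rightarrow> complex" where
  "kernel0 s w z = indicator (ball 0 1) z * bergman_kernel s w z"

lemma kernel0_measurable [measurable]: "kernel0 s (w :: complex ^ ('n::finite)) \<in> borel_measurable borel"
  unfolding kernel0_def[abs_def] by measurable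

lemma kernel0_bound:
  fixes w z :: "complex ^ ('n::finite)"
  assumes "w \<in> ball 0 1" "0 \<le> s"
  shows "norm (kernel0 s w z) \<le> (1 - norm w) powr (- s)"
  using norm_bergman_kernel_le[of z w s] assms by (auto simp: kernel0_def indicator_def)

lemma bergman_spaceD:
  assumes "f \<in> bergman_space s"
  shows "holomorphic_n_on f (ball 0 1)" "square_integrable (bergman_measure s) f" "\<And>z. z \<notin> ball 0 1 \<Longrightarrow> f z = 0"
  using assms by (simp_all add: bergman_space_def)

lemma square_integrable_bounded:
  fixes f :: "complex ^ ('n::finite) \<Rightarrow> complex"
  assumes s: "real CARD('n) < s" and [measurable]: "f \<in> borel_measurable (bergman_measure s)" and C: "AE z in bergman_measure s. norm (f z) \<le> C"
  shows "square_integrable (bergman_measure s) f"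
proof -
  interpret B: finite_measure "bergman_measure s :: (complex ^ 'n) measure" by (rule finite_measure_bergman[OF s])
  show ?thesis
  proof (rule square_integrable_bound[OF B.integrable_const[of "C\<^sup>2"]])
    show "AE z in bergman_measure s. (norm (f z))\<^sup>2 \<le> C\<^sup>2" using C by eventually_elim (simp add: power_mono)
  qed measurable
qed

lemma square_integrable_integrable:
  fixes f :: "complex ^ ('n::finite) \<Rightarrow> complex"
  assumes s: "real CARD('n) < s" and f: "square_integrable (bergman_measure s) f"
  shows "integrable (bergman_measure s) f"
  using square_integrable_product[OF f square_integrable_bounded[OF s, of "\<lambda>_. 1" 1]] by simp

lemma square_integrable_kernel0:
  fixes w :: "complex ^ ('n::finite)"
  assumes s: "real CARD('n) < s" and w: "w \<in> ball 0 1"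
  shows "square_integrable (bergman_measure s) (kernel0 s w)"
proof (rule square_integrable_bounded[OF s])
  have "0 \<le> s" using s by linarith
  then show "AE z in bergman_measure s. norm (kernel0 s w z) \<le> (1 - norm w) powr (- s)"
    using kernel0_bound[OF w] by simp
qed (rule borel_measurable_bergman, measurable)

lemma l2_inner_kernel0:
  fixes w :: "complex ^ ('n::finite)"
  assumes s: "real CARD('n) < s" and [measurable]: "f \<in> borel_measurable (bergman_measure s)"
  shows "l2_inner (bergman_measure s) f (kernel0 s w) = (LINT z|bergman_measure s. f z * cnj (bergman_kernel s w z))"
  unfolding l2_inner_def
proof (rule integral_cong_AE)
  have [measurable]: "bergman_kernel s w \<in> borel_measurable (bergman_measure s)" "kernel0 s w \<in> borel_measurable (bergman_measure s)"
    by (auto intro!: borel_measurable_bergman)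
  show "(\<lambda>z. f z * cnj (kernel0 s w z)) \<in> borel_measurable (bergman_measure s)"
    "(\<lambda>z. f z * cnj (bergman_kernel s w z)) \<in> borel_measurable (bergman_measure s)" by measurable
  show "AE z in bergman_measure s. f z * cnj (kernel0 s w z) = f z * cnj (bergman_kernel s w z)"
    using AE_bergman_ball[where 'n='n, OF s] by eventually_elim (simp add: kernel0_def)
qed

lemma bergman_reproducing_kernel0:
  fixes w :: "complex ^ ('n::finite)"
  assumes s: "real CARD('n) < s" and f: "f \<in> bergman_space s" and w: "w \<in> ball 0 1"
  shows "f w = l2_inner (bergman_measure s) f (kernel0 s w)"
  using bergman_reproducing[OF s bergman_spaceD(1)[OF f] square_integrable_integrable[OF s bergman_spaceD(2)[OF f]] w]
    l2_inner_kernel0[OF s square_integrableD(1)[OF bergman_spaceD(2)[OF f]], of w] by simp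

text \<open>Point evaluations are bounded, so convergence in the mean entails pointwise
  convergence.\<close>

lemma bergman_point_bound:
  fixes w :: "complex ^ ('n::finite)"
  assumes s: "real CARD('n) < s" and f: "f \<in> bergman_space s" and w: "w \<in> ball 0 1"
  shows "(norm (f w))\<^sup>2 \<le> (LINT z|bergman_measure s. (norm (f z))\<^sup>2) * (LINT z|bergman_measure s. (norm (kernel0 s w z))\<^sup>2)"
  using l2_cauchy_schwarz[OF bergman_spaceD(2)[OF f] square_integrable_kernel0[OF s w]]
  unfolding bergman_reproducing_kernel0[OF s f w, symmetric] .

lemma kernel0_in_bergman:
  fixes w :: "complex ^ ('n::finite)"
  assumes s: "real CARD('n) < s" and w: "w \<in> ball 0 1"
  shows "kernel0 s w \<in> bergman_space s"
proof -
  have "holomorphic_n_on (bergman_kernel s w) (ball 0 1)"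
    unfolding holomorphic_n_on_def
  proof (intro ballI)
    fix z :: "complex ^ 'n" assume z: "z \<in> ball 0 1"
    have n: "norm (cip z w) < 1" using z w by (intro norm_cip_less_1) auto
    have "linear (\<lambda>z. cip z w)"
      by (rule linearI) (simp_all add: cip_add_left scaleR_eq_smult cip_smult_left scaleR_conv_of_real)
    then have "((\<lambda>z. cip z w) has_derivative (\<lambda>z. cip z w)) (at z)"
      by (simp add: linear_linear bounded_linear_imp_has_derivative)
    from has_derivative_compose[OF this has_field_derivative_one_minus_powr[OF n, of "- of_real s" UNIV, unfolded has_field_derivative_def]]
    have "(bergman_kernel s w has_derivative (\<lambda>v. - (- of_real s) * (1 - cip z w) powr (- of_real s - 1) * cip v w)) (at z)"
      unfolding bergman_kernel_cip[abs_def] .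
    then show "\<exists>f'. (bergman_kernel s w has_derivative f') (at z) \<and> (\<forall>c v. f' (c *s v) = c * f' v)"
      by (intro exI conjI) (auto simp: cip_smult_left)
  qed
  then have "holomorphic_n_on (kernel0 s w) (ball 0 1)"
    by (rule holomorphic_n_on_cong_ball) (simp add: kernel0_def)
  then show ?thesis using square_integrable_kernel0[OF s w] by (simp add: bergman_space_def) (simp add: kernel0_def)
qed

section \<open>Completeness and the orthogonal projection\<close>

lemma bergman_diff:
  assumes "f \<in> bergman_space s" "g \<in> bergman_space s"
  shows "(\<lambda>z. f z - g z) \<in> bergman_space s"
  using holomorphic_n_on_add[OF bergman_spaceD(1)[OF assms(1)] holomorphic_n_on_scale[OF bergman_spaceD(1)[OF assms(2)], of "-1"]]
    square_integrable_add[OF bergman_spaceD(2)[OF assms(1)] square_integrable_scale[OF bergman_spaceD(2)[OF assms(2)], of "-1"]]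
    bergman_spaceD(3)[OF assms(1)] bergman_spaceD(3)[OF assms(2)]
  by (simp add: bergman_space_def)

text \<open>A Cauchy sequence converges pointwise because point evaluations are bounded, and Fatou
  upgrades this to mean convergence. The reproducing formula then passes to the limit, which is thus
  an integral against the kernel and therefore holomorphic.\<close>

theorem bergman_hilbert:
  assumes s: "real CARD('n::finite) < s"
  shows "function_hilbert_space (bergman_space s :: (complex ^ 'n \<Rightarrow> complex) set) (l2_inner (bergman_measure s))"
proof -
  let ?B = "bergman_measure s :: (complex ^ 'n) measure"
  interpret L2: semi_inner_space "Collect (square_integrable ?B)" "l2_inner ?B" by (rule semi_inner_space_L2)
  have sub: "f \<in> bergman_space s \<Longrightarrow> f \<in> Collect (square_integrable ?B)" for f by (simp add: bergman_space_def)
  have sem: "semi_inner_space (bergman_space s) (l2_inner ?B)"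
  proof
    show "(\<lambda>x :: complex ^ 'n. 0) \<in> bergman_space s"
      using bergman_diff[OF kernel0_in_bergman[OF s, of 0] kernel0_in_bergman[OF s, of 0]] by simp
    fix f g h :: "complex ^ 'n \<Rightarrow> complex" and c
    assume f: "f \<in> bergman_space s"
    show "(\<lambda>x. c * f x) \<in> bergman_space s"
      using f by (simp add: bergman_space_def holomorphic_n_on_scale square_integrable_scale)
    show "0 \<le> Re (l2_inner ?B f f)" by (rule L2.ip_nonneg[OF sub[OF f]])
    assume g: "g \<in> bergman_space s"
    show "(\<lambda>x. f x + g x) \<in> bergman_space s"
      using f g by (simp add: bergman_space_def holomorphic_n_on_add square_integrable_add)
    show "cnj (l2_inner ?B f g) = l2_inner ?B g f" by (rule L2.ip_cnj[OF sub[OF f] sub[OF g]])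
    show "l2_inner ?B (\<lambda>x. c * f x) g = c * l2_inner ?B f g" by (rule L2.ip_scale[OF sub[OF f] sub[OF g]])
    assume h: "h \<in> bergman_space s"
    show "l2_inner ?B (\<lambda>x. f x + g x) h = l2_inner ?B f h + l2_inner ?B g h"
      by (rule L2.ip_add[OF sub[OF f] sub[OF g] sub[OF h]])
  qed
  show ?thesis
  proof (intro function_hilbert_space.intro sem function_hilbert_space_axioms.intro)
    fix X :: "nat \<Rightarrow> complex ^ 'n \<Rightarrow> complex"
    assume X: "\<And>n. X n \<in> bergman_space s"
    assume "\<And>e::real. 0 < e \<Longrightarrow> \<exists>N. \<forall>m\<ge>N. \<forall>n\<ge>N. Re (l2_inner ?B (\<lambda>x. X m x - X n x) (\<lambda>x. X m x - X n x)) < e"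
    then have cau: "\<And>e::real. 0 < e \<Longrightarrow> \<exists>N. \<forall>m\<ge>N. \<forall>n\<ge>N. (LINT z|?B. (norm (X m z - X n z))\<^sup>2) < e"
      by (simp add: Re_l2_inner_self)
    have Xm [measurable]: "X n \<in> borel_measurable ?B" for n using square_integrableD(1)[OF bergman_spaceD(2)[OF X]] .
    have conv: "convergent (\<lambda>n. X n w)" for w
    proof (cases "w \<in> ball 0 1")
      case False then show ?thesis using bergman_spaceD(3)[OF X] by (simp add: convergent_const)
    next
      case True
      define K where "K = (LINT z|?B. (norm (kernel0 s w z))\<^sup>2)"
      have K: "K \<ge> 0" unfolding K_def by (intro integral_nonneg_AE) simp
      have "Cauchy (\<lambda>n. X n w)"
      proof (rule metric_CauchyI)
        fix e :: real assume e: "0 < e"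
        obtain N where N: "\<forall>m\<ge>N. \<forall>n\<ge>N. (LINT z|?B. (norm (X m z - X n z))\<^sup>2) < e\<^sup>2 / (K + 1)"
          using cau[of "e\<^sup>2 / (K + 1)"] e K by auto
        show "\<exists>N. \<forall>m\<ge>N. \<forall>n\<ge>N. dist (X m w) (X n w) < e"
        proof (intro exI[of _ N] allI impI)
          fix m n assume mn: "m \<ge> N" "n \<ge> N"
          have "(norm (X m w - X n w))\<^sup>2 \<le> (LINT z|?B. (norm (X m z - X n z))\<^sup>2) * K"
            unfolding K_def by (rule bergman_point_bound[OF s bergman_diff[OF X X] True])
          also have "\<dots> \<le> e\<^sup>2 / (K + 1) * K" using N mn K by (intro mult_right_mono) (auto intro: less_imp_le)
          also have "\<dots> < e\<^sup>2" using K e by (simp add: field_simps)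
          finally show "dist (X m w) (X n w) < e" using e by (simp add: dist_norm power2_less_imp_less)
        qed
      qed
      then show ?thesis by (rule Cauchy_convergent)
    qed
    define g where "g = (\<lambda>w. lim (\<lambda>n. X n w))"
    have lim: "(\<lambda>n. X n w) \<longlonglongrightarrow> g w" for w unfolding g_def using conv convergent_LIMSEQ_iff by blast
    have gm [measurable]: "g \<in> borel_measurable ?B"
      by (rule borel_measurable_LIMSEQ_metric[OF Xm]) (rule lim)
    have diffL: "integrable ?B (\<lambda>z. (norm (X m z - X n z))\<^sup>2)" for m n
      using square_integrableD(2)[OF bergman_spaceD(2)[OF bergman_diff[OF X X]]] .
    \<comment> \<open>Letting m tend to infinity in |X n - X m|^2: the pointwise limit stays within
      the Cauchy bound. Integrability is recorded too, since the integral of a non-integrable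
      function is 0 by convention and the bound alone would say nothing.\<close>
    have fatou: "\<exists>N. \<forall>n\<ge>N. integrable ?B (\<lambda>z. (norm (X n z - g z))\<^sup>2) \<and> (LINT z|?B. (norm (X n z - g z))\<^sup>2) \<le> e" if e: "0 < e" for e :: real
    proof -
      obtain N where N: "\<And>m n. m \<ge> N \<Longrightarrow> n \<ge> N \<Longrightarrow> (LINT z|?B. (norm (X m z - X n z))\<^sup>2) < e" using cau[OF e] by meson
      show ?thesis
      proof (intro exI[of _ N] allI impI)
        fix n assume n: "n \<ge> N"
        have "(\<integral>\<^sup>+z. ennreal ((norm (X n z - g z))\<^sup>2) \<partial>?B) = (\<integral>\<^sup>+z. liminf (\<lambda>m. ennreal ((norm (X n z - X m z))\<^sup>2)) \<partial>?B)"
        proof (rule nn_integral_cong)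
          fix z
          have "(\<lambda>m. ennreal ((norm (X n z - X m z))\<^sup>2)) \<longlonglongrightarrow> ennreal ((norm (X n z - g z))\<^sup>2)"
            by (intro tendsto_intros lim)
          then show "ennreal ((norm (X n z - g z))\<^sup>2) = liminf (\<lambda>m. ennreal ((norm (X n z - X m z))\<^sup>2))"
            by (metis lim_imp_Liminf trivial_limit_sequentially)
        qed
        also have "\<dots> \<le> liminf (\<lambda>m. \<integral>\<^sup>+z. ennreal ((norm (X n z - X m z))\<^sup>2) \<partial>?B)"
          by (rule nn_integral_liminf) measurable
        also have "\<dots> \<le> ennreal e"
        proof (rule Liminf_le)
          show "\<forall>\<^sub>F m in sequentially. (\<integral>\<^sup>+z. ennreal ((norm (X n z - X m z))\<^sup>2) \<partial>?B) \<le> ennreal e"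
            using eventually_ge_at_top[of N]
          proof eventually_elim
            case (elim m)
            show ?case using N[OF n elim] by (subst nn_integral_eq_integral[OF diffL]) (auto intro: ennreal_leI)
          qed
        qed simp
        finally have le: "(\<integral>\<^sup>+z. ennreal ((norm (X n z - g z))\<^sup>2) \<partial>?B) \<le> ennreal e" .
        then have i: "integrable ?B (\<lambda>z. (norm (X n z - g z))\<^sup>2)"
          by (intro integrableI_bounded) (auto intro: le_less_trans[OF _ ennreal_less_top])
        show "integrable ?B (\<lambda>z. (norm (X n z - g z))\<^sup>2) \<and> (LINT z|?B. (norm (X n z - g z))\<^sup>2) \<le> e"
          using le e i by (auto simp: nn_integral_eq_integral)
      qed
    qed
    have gL: "square_integrable ?B g"
    proof -
      obtain n where n: "integrable ?B (\<lambda>z. (norm (X n z - g z))\<^sup>2)" using fatou[of 1] by auto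
      then have "square_integrable ?B (\<lambda>z. X n z - g z)" by (simp add: square_integrable_def)
      then have "square_integrable ?B (\<lambda>z. X n z + (- 1) * (X n z - g z))"
        by (intro square_integrable_add square_integrable_scale bergman_spaceD(2)[OF X])
      then show ?thesis by simp
    qed
    have lim0: "(\<lambda>n. LINT z|?B. (norm (X n z - g z))\<^sup>2) \<longlonglongrightarrow> 0"
    proof (rule LIMSEQ_I)
      fix e :: real assume e: "0 < e"
      obtain N where "\<forall>n\<ge>N. (LINT z|?B. (norm (X n z - g z))\<^sup>2) \<le> e / 2" using fatou[of "e / 2"] e by auto
      moreover have "(LINT z|?B. (norm (X n z - g z))\<^sup>2) \<ge> 0" for n by (intro integral_nonneg_AE) simp
      ultimately show "\<exists>N. \<forall>n\<ge>N. norm ((LINT z|?B. (norm (X n z - g z))\<^sup>2) - 0) < e"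
        using e by (intro exI[of _ N]) (auto intro: le_less_trans)
    qed
    have rep: "g w = (LINT z|?B. g z * cnj (bergman_kernel s w z))" if w: "w \<in> ball 0 1" for w
    proof -
      have "(\<lambda>n. (norm (X n w - l2_inner ?B g (kernel0 s w)))\<^sup>2) \<longlonglongrightarrow> 0"
      proof (rule tendsto_sandwich[OF _ _ tendsto_const tendsto_mult_left_zero[OF lim0]])
        show "\<forall>\<^sub>F n in sequentially. (norm (X n w - l2_inner ?B g (kernel0 s w)))\<^sup>2 \<le>
            (LINT z|?B. (norm (X n z - g z))\<^sup>2) * (LINT z|?B. (norm (kernel0 s w z))\<^sup>2)"
        proof (intro always_eventually allI)
          fix n
          have k: "kernel0 s w \<in> Collect (square_integrable ?B)" using square_integrable_kernel0[OF s w] by simp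
          have "X n w - l2_inner ?B g (kernel0 s w) = l2_inner ?B (\<lambda>z. X n z - g z) (kernel0 s w)"
            using L2.ip_diff[OF sub[OF X] _ k, of g n] gL bergman_reproducing_kernel0[OF s X w, of n] by simp
          moreover have "square_integrable ?B (\<lambda>z. X n z - g z)" using L2.diff_closed[OF sub[OF X], of g n] gL by simp
          ultimately show "(norm (X n w - l2_inner ?B g (kernel0 s w)))\<^sup>2 \<le>
            (LINT z|?B. (norm (X n z - g z))\<^sup>2) * (LINT z|?B. (norm (kernel0 s w z))\<^sup>2)"
            using l2_cauchy_schwarz[of ?B "\<lambda>z. X n z - g z" "kernel0 s w"] k by simp
        qed
      qed simp
      then have "(\<lambda>n. X n w) \<longlonglongrightarrow> l2_inner ?B g (kernel0 s w)"
        by (rule LIM_zero_cancel[OF tendsto_norm_square_zero])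
      then have "g w = l2_inner ?B g (kernel0 s w)" using lim LIMSEQ_unique by blast
      then show ?thesis by (simp add: l2_inner_kernel0[OF s gm])
    qed
    have "holomorphic_n_on g (ball 0 1)"
      by (rule holomorphic_n_on_cong_ball[OF kernel_integral_holomorphic[OF s square_integrable_integrable[OF s gL]]])
         (use rep in simp)
    moreover have "g z = 0" if "z \<notin> ball 0 1" for z
      using lim[of z] bergman_spaceD(3)[OF X that] by (simp add: LIMSEQ_const_iff)
    ultimately have "g \<in> bergman_space s" using gL by (simp add: bergman_space_def)
    then show "\<exists>g\<in>bergman_space s. (\<lambda>n. Re (l2_inner ?B (\<lambda>x. X n x - g x) (\<lambda>x. X n x - g x))) \<longlonglongrightarrow> 0"
      using lim0 by (intro bexI[of _ g]) (simp_all add: Re_l2_inner_self)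
  qed
qed

text \<open>Testing with the kernels gives equality at every point of the ball, and off the ball
  both functions are 0. Hence the definite descriptions behind the projection and the adjoint are
  unique as functions.\<close>

lemma bergman_eqI:
  fixes f g :: "complex ^ ('n::finite) \<Rightarrow> complex"
  assumes s: "real CARD('n) < s" and f: "f \<in> bergman_space s" and g: "g \<in> bergman_space s"
    and eq: "\<And>u. u \<in> bergman_space s \<Longrightarrow> l2_inner (bergman_measure s) u f = l2_inner (bergman_measure s) u g"
  shows "f = g"
proof
  fix z
  interpret H: function_hilbert_space "bergman_space s :: (complex ^ 'n \<Rightarrow> complex) set" "l2_inner (bergman_measure s)"
    by (rule bergman_hilbert[OF s])
  show "f z = g z"
  proof (cases "z \<in> ball 0 1")
    case True
    have k: "kernel0 s z \<in> bergman_space s" by (rule kernel0_in_bergman[OF s True])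
    show ?thesis
      unfolding bergman_reproducing_kernel0[OF s f True] bergman_reproducing_kernel0[OF s g True]
      using eq[OF k] H.ip_cnj[OF k f] H.ip_cnj[OF k g] by metis
  qed (simp add: bergman_spaceD(3)[OF f] bergman_spaceD(3)[OF g])
qed

text \<open>The projection is the Riesz representative of u \<mapsto> \<langle>u, F\<rangle> on the
  Bergman space, which is bounded by Cauchy-Schwarz.\<close>

lemma bergman_proj_props:
  fixes F :: "complex ^ ('n::finite) \<Rightarrow> complex"
  assumes s: "real CARD('n) < s" and F: "square_integrable (bergman_measure s) F"
  shows "bergman_proj s F \<in> bergman_space s"
    and "u \<in> bergman_space s \<Longrightarrow> l2_inner (bergman_measure s) (bergman_proj s F) u = l2_inner (bergman_measure s) F u"
proof -
  let ?B = "bergman_measure s :: (complex ^ 'n) measure"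
  interpret H: function_hilbert_space "bergman_space s :: (complex ^ 'n \<Rightarrow> complex) set" "l2_inner ?B"
    by (rule bergman_hilbert[OF s])
  interpret L2: semi_inner_space "Collect (square_integrable ?B)" "l2_inner ?B" by (rule semi_inner_space_L2)
  have sub: "f \<in> bergman_space s \<Longrightarrow> f \<in> Collect (square_integrable ?B)" for f by (simp add: bergman_space_def)
  have FL: "F \<in> Collect (square_integrable ?B)" using F by simp
  have "\<exists>g\<in>bergman_space s. \<forall>u\<in>bergman_space s. l2_inner ?B u F = l2_inner ?B u g"
  proof (rule H.riesz)
    fix u v :: "complex ^ 'n \<Rightarrow> complex" and c assume u: "u \<in> bergman_space s"
    show "l2_inner ?B (\<lambda>x. c * u x) F = c * l2_inner ?B u F" by (rule L2.ip_scale[OF sub[OF u] FL])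
    show "(norm (l2_inner ?B u F))\<^sup>2 \<le> L2.sqn F * H.sqn u"
      using L2.cauchy_schwarz[OF sub[OF u] FL] by (simp add: L2.sqn_def H.sqn_def mult.commute)
    assume v: "v \<in> bergman_space s"
    show "l2_inner ?B (\<lambda>x. u x + v x) F = l2_inner ?B u F + l2_inner ?B v F"
      by (rule L2.ip_add[OF sub[OF u] sub[OF v] FL])
  qed
  then obtain g where g: "g \<in> bergman_space s" and gF: "\<And>u. u \<in> bergman_space s \<Longrightarrow> l2_inner ?B u F = l2_inner ?B u g"
    by blast
  have orth: "(\<forall>u\<in>bergman_space s. l2_inner ?B (\<lambda>z. F z - h z) u = 0) \<longleftrightarrow> (\<forall>u\<in>bergman_space s. l2_inner ?B u h = l2_inner ?B u F)"
    if h: "h \<in> bergman_space s" for h :: "complex ^ 'n \<Rightarrow> complex"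
  proof (intro ball_cong refl)
    fix u :: "complex ^ 'n \<Rightarrow> complex" assume u: "u \<in> bergman_space s"
    have "l2_inner ?B (\<lambda>z. F z - h z) u = cnj (l2_inner ?B u F) - cnj (l2_inner ?B u h)"
      unfolding L2.ip_diff[OF FL sub[OF h] sub[OF u]] L2.ip_cnj[OF sub[OF u] FL] L2.ip_cnj[OF sub[OF u] sub[OF h]] ..
    then show "l2_inner ?B (\<lambda>z. F z - h z) u = 0 \<longleftrightarrow> l2_inner ?B u h = l2_inner ?B u F"
      by auto
  qed
  have "bergman_proj s F = g"
    unfolding bergman_proj_def
  proof (rule the_equality)
    show "g \<in> bergman_space s \<and> (\<forall>u\<in>bergman_space s. l2_inner ?B (\<lambda>z. F z - g z) u = 0)"
      using g orth[OF g] gF by simp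
    fix h assume h: "h \<in> bergman_space s \<and> (\<forall>u\<in>bergman_space s. l2_inner ?B (\<lambda>z. F z - h z) u = 0)"
    then show "h = g" using orth[of h] gF by (intro bergman_eqI[OF s _ g]) auto
  qed
  then show "bergman_proj s F \<in> bergman_space s" using g by simp
  assume u: "u \<in> bergman_space s"
  have "l2_inner ?B g u = cnj (l2_inner ?B u g)" by (rule H.ip_cnj[OF u g, symmetric])
  also have "\<dots> = l2_inner ?B F u" unfolding gF[OF u, symmetric] by (rule L2.ip_cnj[OF sub[OF u] FL])
  finally show "l2_inner ?B (bergman_proj s F) u = l2_inner ?B F u" using \<open>bergman_proj s F = g\<close> by simp
qed

section \<open>Carleson measures\<close>

lemma hdist_zero_left: "hdist z 0 = 1 / (1 - (norm z)\<^sup>2)"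
  by (simp add: hdist_def)

text \<open>The boost moves w to 0, where the mean value over the ball of radius 1/2 applies;
  Cauchy-Schwarz bounds its square by an integral of |f|^2. In the original coordinates this ball
  lies in \<open>hdist z w\<close> \<le> 1 / (1 - 1/4) = 4/3, whatever w is.\<close>

lemma bergman_submean:
  fixes w :: "complex ^ ('n::finite)"
  assumes s: "real CARD('n) < s" and f: "f \<in> bergman_space s" and w: "w \<in> ball 0 1"
  shows "ennreal (measure (bergman_measure s :: (complex ^ 'n) measure) (ball 0 (1/2)) * ((norm (f w))\<^sup>2 * (1 - (norm w)\<^sup>2) powr s))
    \<le> (\<integral>\<^sup>+z. (if hdist z w \<le> 4/3 then 1 else 0) * ennreal ((norm (f z))\<^sup>2) \<partial>bergman_measure s)"
proof -
  let ?B = "bergman_measure s :: (complex ^ 'n) measure"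
  interpret B: finite_measure ?B by (rule finite_measure_bergman[OF s])
  define \<beta> where "\<beta> = measure ?B (ball 0 (1/2))"
  have \<beta>: "\<beta> > 0" unfolding \<beta>_def by (rule measure_bergman_ball_pos[OF s]) auto
  define T where "T = boost w"
  have T: "pseudo_unitary T" unfolding T_def by (rule boost_pseudo_unitary[OF w])
  note g = gam_facts[OF w]
  define F where "F = (\<lambda>z. f (pact (boost w) z) * (1 + cip z w) powr (- of_real s))"
  note fi = square_integrable_integrable[OF s bergman_spaceD(2)[OF f]]
  note mv = bergman_mean_value_at[OF s bergman_spaceD(1)[OF f] fi w, of "1/2"]
  have [measurable]: "f \<in> borel_measurable ?B" using fi by auto
  have [measurable]: "(\<lambda>z::complex^'n. z) \<in> borel_measurable ?B" by (rule borel_measurable_bergman) simp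
  define G where "G = (\<lambda>z. indicator (ball 0 (1/2)) z *\<^sub>R F z)"
  have Gi: "integrable ?B G" unfolding G_def F_def using mv(1) by simp
  then have Gm [measurable]: "G \<in> borel_measurable ?B" by auto
  have im [measurable]: "(\<lambda>z. indicator (ball (0 :: complex ^ 'n) (1/2)) z :: ennreal) \<in> borel_measurable ?B"
    by (intro borel_measurable_bergman borel_measurable_indicator) simp
  have "\<beta> * norm (f w) = norm (LINT z|?B. G z)"
    using mv(2) \<beta> unfolding G_def F_def \<beta>_def by simp
  also have "\<dots> \<le> (LINT z|?B. norm (G z))" by simp
  finally have "ennreal (\<beta> * norm (f w)) \<le> ennreal (LINT z|?B. norm (G z))" by (rule ennreal_leI)
  also have "\<dots> = (\<integral>\<^sup>+z. ennreal (norm (G z)) \<partial>?B)" using Gi by (simp add: nn_integral_eq_integral)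
  also have "\<dots> = (\<integral>\<^sup>+z. indicator (ball 0 (1/2)) z * ennreal (norm (G z)) \<partial>?B)"
    by (rule nn_integral_cong) (simp add: G_def indicator_def)
  finally have "(ennreal (\<beta> * norm (f w)))\<^sup>2 \<le> (\<integral>\<^sup>+z. indicator (ball 0 (1/2)) z * ennreal (norm (G z)) \<partial>?B)\<^sup>2"
    by (intro power_mono) auto
  \<comment> \<open>The indicator is kept as a separate factor so that Cauchy-Schwarz yields the
    measure of the small ball, not that of the whole space.\<close>
  also have "\<dots> \<le> (\<integral>\<^sup>+z. (indicator (ball 0 (1/2)) z)\<^sup>2 \<partial>?B) * (\<integral>\<^sup>+z. (ennreal (norm (G z)))\<^sup>2 \<partial>?B)"
    by (rule Cauchy_Schwarz_nn_integral) measurable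
  also have "(\<integral>\<^sup>+z. (indicator (ball (0 :: complex ^ 'n) (1/2)) z)\<^sup>2 \<partial>?B) = ennreal \<beta>"
  proof -
    have "(\<lambda>z. (indicator (ball (0 :: complex ^ 'n) (1/2)) z)\<^sup>2 :: ennreal) = indicator (ball 0 (1/2))"
      by (auto simp: indicator_def power2_eq_square)
    then show ?thesis by (simp add: \<beta>_def B.emeasure_eq_measure)
  qed
  also have "(\<integral>\<^sup>+z. (ennreal (norm (G z)))\<^sup>2 \<partial>?B) \<le>
      (\<integral>\<^sup>+z. ennreal (gam w powr (2 * s)) * ((if hdist (tact T z) w \<le> 4/3 then 1 else 0) * ennreal ((norm (f (tact T z)))\<^sup>2) * ennreal (jac s T z)) \<partial>?B)"
  proof (rule nn_integral_mono)
    fix z :: "complex ^ 'n"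
    show "(ennreal (norm (G z)))\<^sup>2 \<le> ennreal (gam w powr (2 * s)) * ((if hdist (tact T z) w \<le> 4/3 then 1 else 0) * ennreal ((norm (f (tact T z)))\<^sup>2) * ennreal (jac s T z))"
    proof (cases "z \<in> ball 0 (1/2)")
      case True
      then have z: "z \<in> ball 0 1" by simp
      have t: "tact T z = pact T z" using z by (simp add: tact_def)
      have "hdist (pact T z) w = hdist (pact T z) (pact T 0)" by (simp add: T_def pact_boost_0[OF w])
      also have "\<dots> = 1 / (1 - (norm z)\<^sup>2)" by (simp add: hdist_pact[OF T z] hdist_zero_left)
      also have "\<dots> \<le> 4/3"
      proof -
        have "(norm z)\<^sup>2 \<le> (1/2)\<^sup>2" using True by (intro power_mono) auto
        then show ?thesis by (simp add: field_simps power2_eq_square)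
      qed
      finally have hd: "hdist (tact T z) w \<le> 4/3" unfolding t .
      have "norm (pden T z) = gam w * norm (1 + cip z w)" using g(1) by (simp add: T_def pden_boost norm_mult)
      then have "jac s T z = gam w powr (- 2 * s) * norm (1 + cip z w) powr (- 2 * s)"
        unfolding jac_def using g(1) by (simp add: powr_mult)
      then have j: "norm (1 + cip z w) powr (- 2 * s) = gam w powr (2 * s) * jac s T z"
        using g(1) by (simp add: powr_minus)
      have "(norm (1 + cip z w) powr (- s))\<^sup>2 = norm (1 + cip z w) powr (- 2 * s)"
        by (simp add: power2_eq_square flip: powr_add)
      then have "(norm (G z))\<^sup>2 = (norm (f (tact T z)))\<^sup>2 * (gam w powr (2 * s) * jac s T z)"
        unfolding j[symmetric] using True
        unfolding t by (simp add: G_def F_def norm_mult norm_powr_minus_of_real power_mult_distrib T_def)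
      then show ?thesis using hd
        by (simp add: ennreal_power ennreal_mult'[symmetric] ennreal_mult''[symmetric] jac_def ac_simps)
    qed (simp add: G_def)
  qed
  also have "\<dots> = ennreal (gam w powr (2 * s)) * (\<integral>\<^sup>+z. (if hdist (tact T z) w \<le> 4/3 then 1 else 0) * ennreal ((norm (f (tact T z)))\<^sup>2) * ennreal (jac s T z) \<partial>?B)"
  proof (rule nn_integral_cmult)
    note [measurable] = tact_measurable[OF T, of s s] borel_measurable_bergman[OF jac_borel[OF T], of s s]
    have [measurable]: "tact T \<in> borel_measurable ?B" by (rule borel_measurable_bergman[OF tact_borel[OF T]])
    show "(\<lambda>z. (if hdist (tact T z) w \<le> 4/3 then 1 else 0) * ennreal ((norm (f (tact T z)))\<^sup>2) * ennreal (jac s T z)) \<in> borel_measurable ?B"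
      unfolding hdist_def by measurable
  qed
  also have "(\<integral>\<^sup>+z. (if hdist (tact T z) w \<le> 4/3 then 1 else 0) * ennreal ((norm (f (tact T z)))\<^sup>2) * ennreal (jac s T z) \<partial>?B)
     = (\<integral>\<^sup>+z. (if hdist z w \<le> 4/3 then 1 else 0) * ennreal ((norm (f z))\<^sup>2) \<partial>?B)"
    by (rule nn_integral_bergman_tact[OF T s, of "\<lambda>z. (if hdist z w \<le> 4/3 then 1 else 0) * ennreal ((norm (f z))\<^sup>2)"])
       (unfold hdist_def, measurable)
  finally have main: "(ennreal (\<beta> * norm (f w)))\<^sup>2 \<le> ennreal \<beta> * (ennreal (gam w powr (2 * s)) *
      (\<integral>\<^sup>+z. (if hdist z w \<le> 4/3 then 1 else 0) * ennreal ((norm (f z))\<^sup>2) \<partial>?B))" (is "_ \<le> _ * (_ * ?I)")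
    by (simp add: mult_left_mono)
  \<comment> \<open>Cancelled at the end: \<open>gam w\<close> powr (2s) is the reciprocal of (1 -
    |w|^2) powr s, and one of the two factors \<beta> comes from Cauchy-Schwarz.\<close>
  define c where "c = \<beta> * gam w powr (2 * s)"
  have c: "c > 0" using \<beta> g(1) by (simp add: c_def)
  have t: "1 - (norm w)\<^sup>2 > 0" using w norm_sq_less_1[of w] by simp
  have "gam w powr (2 * s) = ((gam w)\<^sup>2) powr s" using g(1) by (simp add: powr_powr flip: powr_numeral)
  also have "\<dots> * (1 - (norm w)\<^sup>2) powr s = ((gam w)\<^sup>2 * (1 - (norm w)\<^sup>2)) powr s" using t by (simp add: powr_mult)
  finally have gp: "gam w powr (2 * s) * (1 - (norm w)\<^sup>2) powr s = 1" unfolding g(5) by simp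
  have "(\<beta> * norm (f w))\<^sup>2 = c * (\<beta> * ((norm (f w))\<^sup>2 * (1 - (norm w)\<^sup>2) powr s))"
  proof -
    have "c * (\<beta> * ((norm (f w))\<^sup>2 * (1 - (norm w)\<^sup>2) powr s)) = \<beta>\<^sup>2 * (norm (f w))\<^sup>2 * (gam w powr (2 * s) * (1 - (norm w)\<^sup>2) powr s)"
      by (simp add: c_def power2_eq_square)
    then show ?thesis unfolding gp power_mult_distrib by (simp only: mult_1_right)
  qed
  then have "ennreal c * ennreal (\<beta> * ((norm (f w))\<^sup>2 * (1 - (norm w)\<^sup>2) powr s)) = ennreal ((\<beta> * norm (f w))\<^sup>2)"
    using c by (simp only: ennreal_mult'[symmetric] less_imp_le)
  also have "\<dots> = (ennreal (\<beta> * norm (f w)))\<^sup>2" using \<beta> by (subst ennreal_power) auto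
  also note main
  also have "ennreal \<beta> * (ennreal (gam w powr (2 * s)) * ?I) = ennreal c * ?I"
    unfolding c_def using \<beta> by (subst ennreal_mult) (auto simp: mult.assoc)
  finally have "ennreal c * ennreal (\<beta> * ((norm (f w))\<^sup>2 * (1 - (norm w)\<^sup>2) powr s)) \<le> ennreal c * ?I" .
  then show ?thesis using c unfolding \<beta>_def
    by (subst (asm) ennreal_mult_le_mult_iff) auto
qed

text \<open>Integrate the local mean value estimate over the orbit and exchange the integrals.\<close>
lemma carleson_estimate:
  fixes \<mu> :: "(complex ^ ('n::finite)) measure"
  assumes s: "real CARD('n) < s" and sf: "sigma_finite_measure \<mu>"
    and id [measurable]: "(\<lambda>m. m) \<in> borel_measurable \<mu>" and sub: "space \<mu> \<subseteq> ball 0 1"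
    and C: "\<And>z. z \<in> ball 0 1 \<Longrightarrow> emeasure \<mu> {m \<in> space \<mu>. hdist z m \<le> 4/3} \<le> C"
    and f: "f \<in> bergman_space s"
  shows "(\<integral>\<^sup>+m. ennreal (measure (bergman_measure s :: (complex ^ 'n) measure) (ball 0 (1/2)) * ((norm (f m))\<^sup>2 * (1 - (norm m)\<^sup>2) powr s)) \<partial>\<mu>)
    \<le> C * (\<integral>\<^sup>+z. ennreal ((norm (f z))\<^sup>2) \<partial>bergman_measure s)"
proof -
  let ?B = "bergman_measure s :: (complex ^ 'n) measure"
  interpret B: finite_measure ?B by (rule finite_measure_bergman[OF s])
  interpret \<mu>: sigma_finite_measure \<mu> by (rule sf)
  interpret P: pair_sigma_finite \<mu> ?B by standard
  have [measurable]: "f \<in> borel_measurable ?B" using square_integrableD(1)[OF bergman_spaceD(2)[OF f]] .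
  have [measurable]: "(\<lambda>z::complex^'n. z) \<in> borel_measurable ?B" by (rule borel_measurable_bergman) simp
  have "(\<integral>\<^sup>+m. ennreal (measure ?B (ball 0 (1/2)) * ((norm (f m))\<^sup>2 * (1 - (norm m)\<^sup>2) powr s)) \<partial>\<mu>)
     \<le> (\<integral>\<^sup>+m. (\<integral>\<^sup>+z. (if hdist z m \<le> 4/3 then 1 else 0) * ennreal ((norm (f z))\<^sup>2) \<partial>?B) \<partial>\<mu>)"
    using bergman_submean[OF s f] sub by (intro nn_integral_mono) auto
  also have "\<dots> = (\<integral>\<^sup>+z. (\<integral>\<^sup>+m. (if hdist z m \<le> 4/3 then 1 else 0) * ennreal ((norm (f z))\<^sup>2) \<partial>\<mu>) \<partial>?B)"
    by (rule P.Fubini'[symmetric]) (unfold hdist_def, measurable)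
  also have "\<dots> \<le> (\<integral>\<^sup>+z. C * ennreal ((norm (f z))\<^sup>2) \<partial>?B)"
  proof (rule nn_integral_mono_AE)
    show "AE z in ?B. (\<integral>\<^sup>+m. (if hdist z m \<le> 4/3 then 1 else 0) * ennreal ((norm (f z))\<^sup>2) \<partial>\<mu>) \<le> C * ennreal ((norm (f z))\<^sup>2)"
      using AE_bergman_ball[where 'n='n, OF s]
    proof eventually_elim
      case (elim z)
      have [measurable]: "{m \<in> space \<mu>. hdist z m \<le> 4/3} \<in> sets \<mu>" unfolding hdist_def by measurable
      have "(\<integral>\<^sup>+m. (if hdist z m \<le> 4/3 then 1 else 0) * ennreal ((norm (f z))\<^sup>2) \<partial>\<mu>) =
         (\<integral>\<^sup>+m. ennreal ((norm (f z))\<^sup>2) * indicator {m \<in> space \<mu>. hdist z m \<le> 4/3} m \<partial>\<mu>)"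
        by (rule nn_integral_cong) simp
      also have "\<dots> = ennreal ((norm (f z))\<^sup>2) * emeasure \<mu> {m \<in> space \<mu>. hdist z m \<le> 4/3}"
        by (rule nn_integral_cmult_indicator) measurable
      also have "\<dots> \<le> C * ennreal ((norm (f z))\<^sup>2)" using mult_right_mono[OF C[OF elim], of "ennreal ((norm (f z))\<^sup>2)"] by (simp add: mult.commute)
      finally show ?case .
    qed
  qed
  also have "\<dots> = C * (\<integral>\<^sup>+z. ennreal ((norm (f z))\<^sup>2) \<partial>?B)" by (rule nn_integral_cmult) measurable
  finally show ?thesis .
qed

text \<open>A bound on \<open>hdist\<close> to a point keeps its partner away from the boundary,
  because |1 - \<langle>x, y\<rangle>| is at least 1 - |x| and at least 1 - |y|. This is used from
  z0 to z and again from z to m. Each use contributes 3/4, the reciprocal of 4/3; passing from 1 -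
  |z|^2 to 1 - |z| halves the first one to 3/8.\<close>

lemma hdist_bounded:
  assumes z: "z \<in> ball 0 1" and z0: "z0 \<in> ball 0 1" and m: "m \<in> ball 0 1"
    and 1: "hdist z z0 \<le> 4/3" and 2: "hdist z m \<le> 4/3"
  shows "(3/4) * ((3/8) * (1 - norm z0)\<^sup>2)\<^sup>2 \<le> 1 - (norm m)\<^sup>2"
proof -
  define a where "a = (3/4) * (1 - norm z0)\<^sup>2"
  have p: "1 - (norm z)\<^sup>2 > 0" "1 - (norm z0)\<^sup>2 > 0" "1 - (norm m)\<^sup>2 > 0"
    using z z0 m norm_sq_less_1[of z] norm_sq_less_1[of z0] norm_sq_less_1[of m] by auto
  have key: "(1 - norm w)\<^sup>2 \<le> (4/3) * (1 - (norm v)\<^sup>2)"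
    if "hdist x y \<le> 4/3" "norm (1 - cip x y) \<ge> 1 - norm w" "norm w < 1"
      "(1 - (norm x)\<^sup>2) * (1 - (norm y)\<^sup>2) > 0" "(1 - (norm x)\<^sup>2) * (1 - (norm y)\<^sup>2) \<le> 1 - (norm v)\<^sup>2"
    for x y v w :: "complex ^ 'a"
  proof -
    have "(1 - norm w)\<^sup>2 \<le> (norm (1 - cip x y))\<^sup>2" using that by (intro power_mono) auto
    also have "\<dots> \<le> (4/3) * ((1 - (norm x)\<^sup>2) * (1 - (norm y)\<^sup>2))"
      using that(1,4) unfolding hdist_def by (simp add: pos_divide_le_eq)
    also have "\<dots> \<le> (4/3) * (1 - (norm v)\<^sup>2)" using that(5) by simp
    finally show ?thesis .
  qed
  have "(1 - norm z0)\<^sup>2 \<le> (4/3) * (1 - (norm z)\<^sup>2)"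
  proof (rule key[OF 1])
    show "1 - norm z0 \<le> norm (1 - cip z z0)" using z by (intro norm_one_minus_cip_ge) auto
    show "(1 - (norm z)\<^sup>2) * (1 - (norm z0)\<^sup>2) \<le> 1 - (norm z)\<^sup>2" using p by (intro mult_left_le) auto
  qed (use z0 p in auto)
  then have "a \<le> 1 - (norm z)\<^sup>2" by (simp add: a_def)
  also have "\<dots> \<le> 2 * (1 - norm z)"
  proof -
    have "1 - (norm z)\<^sup>2 = (1 + norm z) * (1 - norm z)" by (simp add: power2_eq_square algebra_simps)
    also have "\<dots> \<le> 2 * (1 - norm z)" using z by (intro mult_right_mono) auto
    finally show ?thesis .
  qed
  finally have a: "a / 2 \<le> 1 - norm z" by simp
  have "(1 - norm z)\<^sup>2 \<le> (4/3) * (1 - (norm m)\<^sup>2)"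
  proof (rule key[OF 2])
    have "cnj (1 - cip m z) = 1 - cip z m" by (simp add: cnj_cip)
    then have "norm (1 - cip z m) = norm (1 - cip m z)" by (metis complex_mod_cnj)
    then show "1 - norm z \<le> norm (1 - cip z m)" using norm_one_minus_cip_ge[of m z] m by simp
    show "(1 - (norm z)\<^sup>2) * (1 - (norm m)\<^sup>2) \<le> 1 - (norm m)\<^sup>2" using p by (intro mult_left_le_one_le) auto
  qed (use z p in auto)
  moreover have "(a / 2)\<^sup>2 \<le> (1 - norm z)\<^sup>2" using a by (intro power_mono) (auto simp: a_def)
  ultimately show ?thesis by (simp add: a_def)
qed

section \<open>Borel sections\<close>

text \<open>The selection theorem of Kuratowski and Ryll-Nardzewski for the fibres of a continuous map on
  a closed set: approximate the fibre by points of a countable dense set.\<close>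
theorem borel_selection:
  fixes X :: "'a::euclidean_space set" and \<pi> :: "'a \<Rightarrow> 'b::{t2_space, second_countable_topology}"
  assumes X: "closed X" and cont: "continuous_on X \<pi>"
  obtains t where "t \<in> borel_measurable (restrict_space borel (\<pi> ` X))" "\<And>m. m \<in> \<pi> ` X \<Longrightarrow> t m \<in> X" "\<And>m. m \<in> \<pi> ` X \<Longrightarrow> \<pi> (t m) = m"
proof -
  define M where "M = restrict_space borel (\<pi> ` X)"
  define \<Phi> where "\<Phi> = (\<lambda>m. {x \<in> X. \<pi> x = m})"
  have cl: "closed (\<Phi> m)" for m
    unfolding \<Phi>_def using X cont by (rule continuous_closed_preimage_constant[rotated])
  obtain D :: "'a set" where D: "countable D" "\<And>U. open U \<Longrightarrow> U \<noteq> {} \<Longrightarrow> \<exists>d\<in>D. d \<in> U"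
    using countable_dense_setE by blast
  then have "D \<noteq> {}" by blast
  define q where "q = from_nat_into D"
  have dense: "\<exists>i. dist (q i) x < e" if e: "0 < e" for x :: 'a and e
  proof -
    obtain d where "d \<in> D" "d \<in> ball x e" using D(2)[OF open_ball, of x e] e by (metis centre_in_ball empty_iff)
    then show ?thesis using from_nat_into_surj[OF D(1)] unfolding q_def by (metis dist_commute mem_ball)
  qed
  have spM: "space M = \<pi> ` X" by (simp add: M_def space_restrict_space)
  \<comment> \<open>The open ball is exhausted by closed ones: X meets a closed ball in a compact
    set, whose image is compact and hence Borel. This is where closedness of X in a Euclidean space
    enters.\<close>
  have near: "Measurable.pred M (\<lambda>m. \<exists>x\<in>\<Phi> m. dist (q i) x < e)" for i e
  proof -
    have "{m \<in> space M. \<exists>x\<in>\<Phi> m. dist (q i) x < e} = (\<Union>n::nat. \<pi> ` (X \<inter> cball (q i) (e - 1 / real (Suc n))))"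
    proof (intro equalityI subsetI)
      fix m assume "m \<in> {m \<in> space M. \<exists>x\<in>\<Phi> m. dist (q i) x < e}"
      then obtain x where x: "x \<in> X" "\<pi> x = m" "dist (q i) x < e" by (auto simp: \<Phi>_def)
      obtain n where "1 / real (Suc n) < e - dist (q i) x" using nat_approx_posE[of "e - dist (q i) x"] x(3) by auto
      then have "x \<in> X \<inter> cball (q i) (e - 1 / real (Suc n))" using x by simp
      then show "m \<in> (\<Union>n::nat. \<pi> ` (X \<inter> cball (q i) (e - 1 / real (Suc n))))" using x(2) by blast
    next
      fix m assume "m \<in> (\<Union>n::nat. \<pi> ` (X \<inter> cball (q i) (e - 1 / real (Suc n))))"
      then obtain n x where x: "x \<in> X" "\<pi> x = m" "dist (q i) x \<le> e - 1 / real (Suc n)" by auto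
      have "0 < 1 / real (Suc n)" by simp
      then have "dist (q i) x < e" using x(3) by linarith
      then show "m \<in> {m \<in> space M. \<exists>x\<in>\<Phi> m. dist (q i) x < e}" using x by (auto simp: \<Phi>_def spM)
    qed
    moreover have "(\<Union>n::nat. \<pi> ` (X \<inter> cball (q i) (e - 1 / real (Suc n)))) \<in> sets borel"
    proof -
      have "compact (\<pi> ` (X \<inter> cball (q i) (e - 1 / real (Suc n))))" for n
        using cont X by (intro compact_continuous_image closed_Int_compact compact_cball) (auto intro: continuous_on_subset)
      then show ?thesis by (intro sets.countable_UN) (auto intro: borel_compact)
    qed
    moreover have "(\<Union>n::nat. \<pi> ` (X \<inter> cball (q i) (e - 1 / real (Suc n)))) \<subseteq> \<pi> ` X" by auto
    ultimately show ?thesis unfolding pred_def by (auto simp: M_def sets_restrict_space)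
  qed
  \<comment> \<open>Index i is admissible at stage k if \<open>q i\<close> is close to the fibre and
    to the previous choice \<open>q j\<close>. At stage 0 there is no previous choice: the second
    condition is void and the argument j is a dummy. Taking the least index keeps the choice
    measurable.\<close>
  define P where "P = (\<lambda>k m j i. (\<exists>x\<in>\<Phi> m. dist (q i) x < (1/2) ^ k) \<and> (0 < k \<longrightarrow> dist (q i) (q j) < 2 * (1/2) ^ (k - 1)))"
  define I where "I = rec_nat (\<lambda>m. LEAST i. P 0 m 0 i) (\<lambda>k f m. LEAST i. P (Suc k) m (f m) i)"
  have I0: "I 0 m = (LEAST i. P 0 m 0 i)" and IS: "I (Suc k) m = (LEAST i. P (Suc k) m (I k m) i)" for k m
    by (simp_all add: I_def)
  have Im [measurable]: "I k \<in> measurable M (count_space UNIV)" for k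
  proof (induction k)
    case 0
    have [measurable]: "Measurable.pred M (\<lambda>m. P 0 m 0 i)" for i using near unfolding P_def by simp
    have "(\<lambda>m. LEAST i. P 0 m 0 i) \<in> measurable M (count_space UNIV)" by measurable
    then show ?case using I0 by (simp add: ext[of "I 0" "\<lambda>m. LEAST i. P 0 m 0 i"])
  next
    case (Suc k)
    note [measurable] = Suc near
    have [measurable]: "Measurable.pred M (\<lambda>m. dist (q i) (q (I k m)) < c)" for i c
      by measurable
    have [measurable]: "Measurable.pred M (\<lambda>m. P (Suc k) m (I k m) i)" for i unfolding P_def by measurable
    have "(\<lambda>m. LEAST i. P (Suc k) m (I k m) i) \<in> measurable M (count_space UNIV)" by measurable
    then show ?case using IS by (simp add: ext[of "I (Suc k)" "\<lambda>m. LEAST i. P (Suc k) m (I k m) i"])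
  qed
  have PI: "(k = 0 \<longrightarrow> P 0 m 0 (I 0 m)) \<and> (\<forall>l. k = Suc l \<longrightarrow> P k m (I l m) (I k m))" if m: "m \<in> \<pi> ` X" for k m
  proof (induction k)
    case 0
    obtain x where x: "x \<in> \<Phi> m" using m by (auto simp: \<Phi>_def)
    have "\<exists>i. P 0 m 0 i" using x dense[of 1 x] by (auto simp: P_def)
    then have "P 0 m 0 (I 0 m)" unfolding I0 by (rule LeastI_ex)
    then show ?case by simp
  next
    case (Suc k)
    have "\<exists>x\<in>\<Phi> m. dist (q (I k m)) x < (1/2) ^ k" using Suc by (cases k) (auto simp: P_def)
    then obtain x where x: "x \<in> \<Phi> m" "dist (q (I k m)) x < (1/2) ^ k" by blast
    \<comment> \<open>Such a point is within 3/2 times (1/2)^k of the previous approximant, which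
      the allowance 2 (1/2)^k in \<open>P\<close> admits.\<close>
    obtain i where i: "dist (q i) x < (1/2) ^ Suc k" using dense[of "(1/2) ^ Suc k" x] by auto
    have "dist (q i) (q (I k m)) \<le> dist (q i) x + dist (q (I k m)) x" by (rule dist_triangle2)
    also have "\<dots> < (1/2) ^ Suc k + (1/2) ^ k" using i x(2) by simp
    also have "\<dots> \<le> 2 * (1/2) ^ k" by simp
    finally have "P (Suc k) m (I k m) i" using x i by (auto simp: P_def)
    then have "P (Suc k) m (I k m) (I (Suc k) m)" unfolding IS by (rule LeastI)
    then show ?case by simp
  qed
  have close: "\<exists>x\<in>\<Phi> m. dist (q (I k m)) x < (1/2) ^ k" if "m \<in> \<pi> ` X" for k m
    using PI[OF that, of k] by (cases k) (auto simp: P_def)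
  have step: "dist (q (I (Suc k) m)) (q (I k m)) < 2 * (1/2) ^ k" if "m \<in> \<pi> ` X" for k m
    using PI[OF that, of "Suc k"] by (auto simp: P_def)
  have conv: "convergent (\<lambda>k. q (I k m))" if m: "m \<in> \<pi> ` X" for m
  proof -
    have "summable (\<lambda>k. norm (q (I (Suc k) m) - q (I k m)))"
    proof (rule summable_comparison_test')
      show "summable (\<lambda>k. 2 * (1/2) ^ k :: real)" by (intro summable_mult summable_geometric) simp
      show "norm (norm (q (I (Suc k) m) - q (I k m))) \<le> 2 * (1/2) ^ k" if "0 \<le> k" for k
        using step[OF m, of k] by (simp add: dist_norm)
    qed
    then have "summable (\<lambda>k. q (I (Suc k) m) - q (I k m))" by (rule summable_norm_cancel)
    then have "convergent (\<lambda>n. q (I n m) - q (I 0 m))"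
      unfolding summable_iff_convergent by (subst (asm) sum_lessThan_telescope)
    from convergent_add[OF this convergent_const[of "q (I 0 m)"]] show ?thesis by simp
  qed
  define t where "t = (\<lambda>m. lim (\<lambda>k. q (I k m)))"
  have lim: "(\<lambda>k. q (I k m)) \<longlonglongrightarrow> t m" if "m \<in> \<pi> ` X" for m
    unfolding t_def using conv[OF that] convergent_LIMSEQ_iff by blast
  have "t \<in> borel_measurable M"
  proof (rule borel_measurable_LIMSEQ_metric[of "\<lambda>k m. q (I k m)"])
    show "(\<lambda>m. q (I k m)) \<in> borel_measurable M" for k by measurable
  qed (use lim spM in auto)
  moreover have "t m \<in> \<Phi> m" if m: "m \<in> \<pi> ` X" for m
  proof -
    obtain y where y: "\<And>k. y k \<in> \<Phi> m" "\<And>k. dist (q (I k m)) (y k) < (1/2) ^ k" using close[OF m] by metis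
    have "(\<lambda>k. dist (q (I k m)) (y k)) \<longlonglongrightarrow> 0"
    proof (rule tendsto_sandwich[OF _ _ tendsto_const LIMSEQ_power_zero[of "1/2::real"]])
      show "\<forall>\<^sub>F k in sequentially. dist (q (I k m)) (y k) \<le> (1/2) ^ k" by (intro always_eventually allI less_imp_le y(2))
    qed auto
    then have "(\<lambda>k. q (I k m) - y k) \<longlonglongrightarrow> 0"
      unfolding dist_norm by (rule tendsto_norm_zero_cancel)
    from tendsto_diff[OF lim[OF m] this] have "y \<longlonglongrightarrow> t m" by simp
    then show ?thesis using cl y(1) closed_sequentially by blast
  qed
  ultimately show ?thesis using that[of t] by (auto simp: M_def \<Phi>_def)
qed

text \<open>By the Lindeloef property countably many evenly covered open sets suffice.\<close>
theorem covering_space_borel_section: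
  fixes p :: "'g::topological_space \<Rightarrow> 'a::second_countable_topology"
  assumes cov: "covering_space C p S"
  obtains \<sigma> where "\<sigma> \<in> restrict_space borel S \<rightarrow>\<^sub>M restrict_space borel C" "\<And>x. x \<in> S \<Longrightarrow> \<sigma> x \<in> C" "\<And>x. x \<in> S \<Longrightarrow> p (\<sigma> x) = x"
proof -
  define Q where "Q = (\<lambda>T q. openin (top_of_set S) T \<and> continuous_on T q \<and> (\<forall>x\<in>T. q x \<in> C \<and> p (q x) = x))"
  have ex: "\<exists>T q. x \<in> T \<and> Q T q" if x: "x \<in> S" for x
  proof -
    obtain T v where T: "x \<in> T" "openin (top_of_set S) T" and v: "\<Union>v = C \<inter> p -` T"
      and hom: "\<And>u. u \<in> v \<Longrightarrow> \<exists>q. homeomorphism u T p q"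
      using cov x unfolding covering_space_def by meson
    have "p ` C = S" using cov by (simp add: covering_space_def)
    then obtain y where "y \<in> C" "p y = x" using x by auto
    then obtain u where u: "u \<in> v" "y \<in> u" using v T(1) by auto
    obtain q where q: "homeomorphism u T p q" using hom[OF u(1)] by blast
    have "u \<subseteq> C" using u(1) v by auto
    then have "Q T q" using q T(2) unfolding Q_def homeomorphism_def by auto
    then show ?thesis using T(1) by blast
  qed
  obtain \<F> where F: "\<F> \<subseteq> {T. \<exists>q. Q T q}" "countable \<F>" "\<Union>\<F> = \<Union>{T. \<exists>q. Q T q}"
    by (rule Lindelof_openin[of "{T. \<exists>q. Q T q}" S]) (auto simp: Q_def)
  have cover: "\<Union>\<F> = S"
  proof
    show "\<Union>\<F> \<subseteq> S" using F(1) by (auto simp: Q_def dest: openin_imp_subset)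
    show "S \<subseteq> \<Union>\<F>" using ex F(3) by blast
  qed
  show ?thesis
  proof (cases "S = {}")
    case True
    show ?thesis by (rule that[of "\<lambda>_. undefined"]) (auto simp: True measurable_def space_restrict_space)
  next
    case False
    then have ne: "\<F> \<noteq> {}" using cover by auto
    define T where "T = from_nat_into \<F>"
    have TF: "T i \<in> \<F>" for i unfolding T_def by (rule from_nat_into[OF ne])
    have "\<exists>q. Q (T i) q" for i using TF[of i] F(1) by blast
    then obtain q where q: "\<And>i. Q (T i) (q i)" by metis
    have UT: "\<exists>i. x \<in> T i" if "x \<in> S" for x
      using that cover from_nat_into_surj[OF F(2)] unfolding T_def by (metis UnionE)
    \<comment> \<open>The first open set of the countable cover that contains x. The sets where n is
      constant form a countable Borel partition, on each part of which the section is
      continuous.\<close>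
    define n where "n = (\<lambda>x. LEAST i. x \<in> T i)"
    define \<sigma> where "\<sigma> = (\<lambda>x. q (n x) x)"
    have nT: "x \<in> T (n x)" if "x \<in> S" for x unfolding n_def using UT[OF that] by (rule LeastI_ex)
    have sT: "T i \<in> sets (restrict_space borel S)" for i
    proof -
      obtain U where "open U" "T i = S \<inter> U" using q[of i] unfolding Q_def openin_open by blast
      then show ?thesis by (auto simp: sets_restrict_space)
    qed
    have nm: "n \<in> measurable (restrict_space borel S) (count_space UNIV)"
    proof -
      have [measurable]: "Measurable.pred (restrict_space borel S) (\<lambda>x. x \<in> T i)" for i
        using sT[of i] by (intro pred_sets2[of _ _ "\<lambda>x. x"]) auto
      show ?thesis unfolding n_def by measurable
    qed
    have "\<sigma> \<in> restrict_space borel S \<rightarrow>\<^sub>M borel"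
    proof (rule measurableI)
      fix A :: "'g set" assume A: "A \<in> sets borel"
      have "\<sigma> -` A \<inter> space (restrict_space borel S) = (\<Union>i. (n -` {i} \<inter> space (restrict_space borel S)) \<inter> (q i -` A \<inter> T i))"
        using nT by (auto simp: \<sigma>_def space_restrict_space)
      moreover have "q i -` A \<inter> T i \<in> sets (restrict_space borel S)" for i
      proof -
        have "q i \<in> borel_measurable (restrict_space borel (T i))"
          using q[of i] by (intro borel_measurable_continuous_on_restrict) (simp add: Q_def)
        then have "q i -` A \<inter> T i \<in> sets (restrict_space borel (T i))"
          using A measurable_sets[of "q i" "restrict_space borel (T i)" borel A] by (simp add: space_restrict_space)
        then obtain B where B: "B \<in> sets borel" "q i -` A \<inter> T i = T i \<inter> B" by (auto simp: sets_restrict_space)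
        have "T i \<subseteq> S" using q[of i] by (auto simp: Q_def dest: openin_imp_subset)
        then have "q i -` A \<inter> T i = T i \<inter> (S \<inter> B)" using B(2) by auto
        moreover have "S \<inter> B \<in> sets (restrict_space borel S)" using B(1) by (auto simp: sets_restrict_space)
        ultimately show ?thesis using sT[of i] by auto
      qed
      moreover have "n -` {i} \<inter> space (restrict_space borel S) \<in> sets (restrict_space borel S)" for i
        by (rule measurable_sets[OF nm]) simp
      ultimately show "\<sigma> -` A \<inter> space (restrict_space borel S) \<in> sets (restrict_space borel S)" by auto
    qed simp
    moreover have C: "\<sigma> x \<in> C" "p (\<sigma> x) = x" if "x \<in> S" for x
      using q[of "n x"] nT[OF that] unfolding \<sigma>_def Q_def by auto
    ultimately have "\<sigma> \<in> restrict_space borel S \<rightarrow>\<^sub>M restrict_space borel C"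
      by (intro measurable_restrict_space2) (auto simp: space_restrict_space)
    then show ?thesis using that C by blast
  qed
qed

section \<open>Continuous logarithms\<close>

text \<open>Constant loops at two points are homotopic as loops, and the track of their base point
  during the homotopy is a path between the points.\<close>

lemma simply_connected_imp_connected_topological:
  assumes "simply_connected (S :: 'a::topological_space set)"
  shows "connected S"
proof -
  have "path_connected S"
    unfolding path_connected_def
  proof (intro ballI)
    fix x y assume "x \<in> S" "y \<in> S"
    then have "homotopic_loops S (\<lambda>_. x) (\<lambda>_. y)"
      using assms[unfolded simply_connected_def, rule_format, of "\<lambda>_. x" "\<lambda>_. y"]
      by (simp add: path_def path_image_def pathstart_def pathfinish_def image_constant_conv)
    then obtain h where h: "continuous_on ({0..1::real} \<times> {0..1::real}) h" "h ` ({0..1} \<times> {0..1}) \<subseteq> S"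
      "\<And>t. t \<in> {0..1} \<Longrightarrow> h (0, t) = x" "\<And>t. t \<in> {0..1} \<Longrightarrow> h (1, t) = y"
      unfolding homotopic_loops by (metis image_subset_iff_funcset)
    define g where "g = (\<lambda>t. h (t, 0::real))"
    have "path g" unfolding path_def g_def
      by (rule continuous_on_compose2[OF h(1)]) (auto intro!: continuous_intros)
    moreover have "path_image g \<subseteq> S" using h(2) by (auto simp: path_image_def g_def)
    ultimately show "\<exists>g. path g \<and> path_image g \<subseteq> S \<and> pathstart g = x \<and> pathfinish g = y"
      using h(3,4) by (intro exI[of _ g]) (auto simp: g_def pathstart_def pathfinish_def)
  qed
  then show ?thesis by (rule path_connected_imp_connected)
qed

text \<open>The values lie in the discrete set of integer multiples of 2 pi i.\<close>

lemma continuous_log_constant: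
  fixes f :: "'a::topological_space \<Rightarrow> complex"
  assumes S: "connected S" and cont: "continuous_on S f" and exp1: "\<And>x. x \<in> S \<Longrightarrow> exp (f x) = 1"
    and x: "x \<in> S" and y: "y \<in> S"
  shows "f x = f y"
proof -
  have "f constant_on S"
  proof (rule continuous_discrete_range_constant[OF S cont])
    fix x assume x: "x \<in> S"
    show "\<exists>e>0. \<forall>y. y \<in> S \<and> f y \<noteq> f x \<longrightarrow> e \<le> norm (f y - f x)"
    proof (intro exI[of _ "2 * pi"] conjI allI impI)
      fix y assume y: "y \<in> S \<and> f y \<noteq> f x"
      have "exp (f y) = exp (f x)" using exp1 x y by simp
      then obtain n :: int where n: "f y = f x + of_real (of_int (2 * n) * pi) * \<i>" unfolding exp_eq by blast
      then have "n \<noteq> 0" using y by auto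
      then have "1 \<le> \<bar>real_of_int n\<bar>" by linarith
      moreover have "norm (f y - f x) = 2 * pi * \<bar>real_of_int n\<bar>" unfolding n by (simp add: norm_mult)
      ultimately show "2 * pi \<le> norm (f y - f x)" by simp
    qed simp
  qed
  then show ?thesis using x y unfolding constant_on_def by metis
qed

section \<open>The group and its cocycle\<close>

definition hvec :: "(complex ^ 'n) \<times> complex \<Rightarrow> complex ^ ('n::finite) option" where
  "hvec p = (\<chi> i. case i of None \<Rightarrow> snd p | Some k \<Rightarrow> fst p $ k)"

text \<open>A matrix acting on option-indexed vectors, read as a map of pairs, so that the results
  on pseudo-unitary maps apply to the group.\<close>

definition mlin :: "complex ^ ('n::finite) option ^ 'n option \<Rightarrow> (complex ^ 'n) \<times> complex \<Rightarrow> (complex ^ 'n) \<times> complex" where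
  "mlin g p = (\<chi> i. (g *v hvec p) $ Some i, (g *v hvec p) $ None)"

lemma hvec_nth [simp]: "hvec p $ None = snd p" "hvec p $ Some i = fst p $ i"
  by (simp_all add: hvec_def)

lemma hvec_mlin: "hvec (mlin g p) = g *v hvec p"
  unfolding vec_eq_iff
proof
  fix i show "hvec (mlin g p) $ i = (g *v hvec p) $ i" by (cases i) (simp_all add: mlin_def)
qed

lemma hvec_inject: "hvec p = hvec q \<longleftrightarrow> p = q"
proof
  assume e: "hvec p = hvec q"
  have "snd p = snd q" using arg_cong[OF e, of "\<lambda>v. v $ None"] by simp
  moreover have "fst p $ i = fst q $ i" for i using arg_cong[OF e, of "\<lambda>v. v $ Some i"] by simp
  ultimately show "p = q" by (simp add: prod_eq_iff vec_eq_iff)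
qed simp

lemma hvec_add: "hvec (p + q) = hvec p + hvec q"
  unfolding vec_eq_iff by (auto simp: split_option_all)

lemma hvec_cscale: "hvec (cscale c p) = c *s hvec p"
  unfolding vec_eq_iff by (auto simp: split_option_all cscale_def)

lemma herm_form_hvec: "herm_form (hvec p) (hvec q) = hform p q"
  by (simp add: herm_form_def hform_def cip_def)

lemma sum_UNIV_option: "(\<Sum>i\<in>UNIV. f i) = f None + (\<Sum>i\<in>(UNIV :: 'n::finite set). f (Some i))"
  by (simp add: UNIV_option_conv sum.reindex)

lemma mlin_mult: "mlin (g ** h) p = mlin g (mlin h p)"
  unfolding hvec_inject[symmetric] hvec_mlin by (simp add: matrix_vector_mul_assoc)

lemma mlin_one: "mlin (mat 1) p = p"
  unfolding hvec_inject[symmetric] hvec_mlin by simp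

lemma denom_eq_pden: "denom g z = pden (mlin g) z"
  by (simp add: denom_def pden_def mlin_def matrix_vector_mult_def sum_UNIV_option)

lemma act_eq_pact: "act g z = pact (mlin g) z"
  unfolding act_def pact_def denom_eq_pden
  by (simp add: mlin_def matrix_vector_mult_def sum_UNIV_option vec_eq_iff divide_inverse algebra_simps)

lemma mlin_pseudo_unitary:
  assumes "g \<in> carrier SU_n1"
  shows "pseudo_unitary (mlin g)"
  unfolding pseudo_unitary_def
proof (intro conjI allI)
  fix p q :: "(complex ^ 'a) \<times> complex" and c
  show "mlin g (p + q) = mlin g p + mlin g q"
    unfolding hvec_inject[symmetric] hvec_mlin hvec_add by (simp add: matrix_vector_right_distrib)
  show "mlin g (cscale c p) = cscale c (mlin g p)"
    unfolding hvec_inject[symmetric] hvec_mlin hvec_cscale by (simp add: vector_scalar_commute)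
  show "hform (mlin g p) (mlin g q) = hform p q"
    unfolding herm_form_hvec[symmetric] hvec_mlin using assms by (simp add: SU_n1_def)
qed

text \<open>Makes a closed subgroup closed in the Euclidean space of all matrices, as
  \<open>borel_selection\<close> requires.\<close>

lemma closed_SU: "closed (carrier SU_n1 :: (complex ^ ('n::finite) option ^ 'n option) set)"
proof -
  have "continuous_on UNIV (\<lambda>g :: complex ^ 'n option ^ 'n option. det g)"
    unfolding det_def by (intro continuous_intros)
  then have "closed {g :: complex ^ 'n option ^ 'n option. det g = 1}"
    by (intro closed_Collect_eq continuous_intros)
  moreover have "closed {g :: complex ^ 'n option ^ 'n option. herm_form (g *v z) (g *v w) = herm_form z w}" for z w
    unfolding herm_form_def matrix_vector_mult_def by (intro closed_Collect_eq continuous_intros)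
  then have "closed {g :: complex ^ 'n option ^ 'n option. \<forall>z w. herm_form (g *v z) (g *v w) = herm_form z w}"
    by (intro closed_Collect_all)
  ultimately show ?thesis unfolding SU_n1_def by (simp add: closed_Collect_conj)
qed

section \<open>The covering group and the lifted cocycle\<close>

locale covering_cocycle =
  fixes s :: real
    and Gt :: "'g::topological_space monoid"
    and p :: "'g \<Rightarrow> complex ^ ('n::finite) option ^ 'n option"
    and j :: "'g \<Rightarrow> complex ^ 'n \<Rightarrow> complex"
  assumes cov: "universal_covering_group SU_n1 Gt p"
    and coc: "is_cocycle s Gt p j"
begin

lemma grp: "group Gt"
  using cov by (simp add: universal_covering_group_def topological_group_def)

sublocale Gt: group Gt by (rule grp)

lemma p_carrier: "g \<in> carrier Gt \<Longrightarrow> p g \<in> carrier SU_n1"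
  and p_mult: "g \<in> carrier Gt \<Longrightarrow> h \<in> carrier Gt \<Longrightarrow> p (g \<otimes>\<^bsub>Gt\<^esub> h) = p g ** p h"
  using cov by (auto simp: universal_covering_group_def hom_def SU_n1_def)

lemma continuous_p: "continuous_on (carrier Gt) p"
  using cov by (simp add: universal_covering_group_def covering_space_def)

lemma continuous_mult: "continuous_on (carrier Gt \<times> carrier Gt) (\<lambda>(x, y). x \<otimes>\<^bsub>Gt\<^esub> y)"
  using cov by (simp add: universal_covering_group_def topological_group_def)

lemma connected_carrier: "connected (carrier Gt)"
  using cov by (intro simply_connected_imp_connected_topological) (simp add: universal_covering_group_def)

text \<open>An idempotent invertible matrix is the identity.\<close>

lemma p_one: "p \<one>\<^bsub>Gt\<^esub> = mat 1"
proof -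
  have "det (p \<one>\<^bsub>Gt\<^esub>) = 1" using p_carrier[OF Gt.one_closed] by (simp add: SU_n1_def)
  then have "invertible (p \<one>\<^bsub>Gt\<^esub>)" by (simp add: invertible_det_nz)
  then obtain B where "B ** p \<one>\<^bsub>Gt\<^esub> = mat 1" unfolding invertible_def by blast
  moreover have "p \<one>\<^bsub>Gt\<^esub> ** p \<one>\<^bsub>Gt\<^esub> = p \<one>\<^bsub>Gt\<^esub>" using p_mult[OF Gt.one_closed Gt.one_closed] by simp
  ultimately show ?thesis by (metis matrix_mul_assoc matrix_mul_lid)
qed

abbreviation T :: "'g \<Rightarrow> (complex ^ 'n) \<times> complex \<Rightarrow> (complex ^ 'n) \<times> complex" where
  "T g \<equiv> mlin (p g)"

lemma T_pu: "g \<in> carrier Gt \<Longrightarrow> pseudo_unitary (T g)"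
  by (intro mlin_pseudo_unitary p_carrier)

lemma act_in_ball: "g \<in> carrier Gt \<Longrightarrow> z \<in> ball 0 1 \<Longrightarrow> act (p g) z \<in> ball 0 1"
  unfolding act_eq_pact by (intro pact_in_ball T_pu)

lemma act_mult:
  assumes "g \<in> carrier Gt" "h \<in> carrier Gt" "z \<in> ball 0 1"
  shows "act (p (g \<otimes>\<^bsub>Gt\<^esub> h)) z = act (p g) (act (p h) z)"
proof -
  have "T (g \<otimes>\<^bsub>Gt\<^esub> h) = (\<lambda>q. T g (T h q))" using assms by (simp add: p_mult mlin_mult fun_eq_iff)
  then show ?thesis unfolding act_eq_pact using pact_compose[OF T_pu T_pu] assms by metis
qed

lemma denom_mult:
  assumes "g \<in> carrier Gt" "h \<in> carrier Gt" "z \<in> ball 0 1"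
  shows "denom (p (g \<otimes>\<^bsub>Gt\<^esub> h)) z = denom (p g) (act (p h) z) * denom (p h) z"
proof -
  have "T (g \<otimes>\<^bsub>Gt\<^esub> h) = (\<lambda>q. T g (T h q))" using assms by (simp add: p_mult mlin_mult fun_eq_iff)
  then show ?thesis unfolding act_eq_pact denom_eq_pden using pden_compose[OF T_pu T_pu] assms by metis
qed

lemma act_one: "act (p \<one>\<^bsub>Gt\<^esub>) z = z" and denom_one: "denom (p \<one>\<^bsub>Gt\<^esub>) z = 1"
  unfolding act_eq_pact denom_eq_pden by (simp_all add: pact_def pden_def p_one mlin_one)

lemma act_inv:
  assumes "g \<in> carrier Gt" "z \<in> ball 0 1"
  shows "act (p (inv\<^bsub>Gt\<^esub> g)) (act (p g) z) = z" "act (p g) (act (p (inv\<^bsub>Gt\<^esub> g)) z) = z"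
  using act_mult[of "inv\<^bsub>Gt\<^esub> g" g z] act_mult[of g "inv\<^bsub>Gt\<^esub> g" z] assms by (simp_all add: act_one)

lemma denom_nonzero: "g \<in> carrier Gt \<Longrightarrow> z \<in> ball 0 1 \<Longrightarrow> denom (p g) z \<noteq> 0"
  unfolding denom_eq_pden by (intro pden_nonzero T_pu)

lemma continuous_on_denom:
  assumes "continuous_on S g" "continuous_on S f" "\<And>x. x \<in> S \<Longrightarrow> g x \<in> carrier Gt"
  shows "continuous_on S (\<lambda>x. denom (p (g x)) (f x))"
proof -
  have [continuous_intros]: "continuous_on S (\<lambda>x. p (g x))"
    using assms by (intro continuous_on_compose2[OF continuous_p]) auto
  show ?thesis unfolding denom_def by (intro continuous_intros assms)
qed

lemma continuous_on_act:
  assumes "continuous_on S g" "continuous_on S f" "\<And>x. x \<in> S \<Longrightarrow> g x \<in> carrier Gt" "\<And>x. x \<in> S \<Longrightarrow> f x \<in> ball 0 1"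
  shows "continuous_on S (\<lambda>x. act (p (g x)) (f x))"
proof -
  have [continuous_intros]: "continuous_on S (\<lambda>x. p (g x))"
    using assms by (intro continuous_on_compose2[OF continuous_p]) auto
  show ?thesis unfolding act_def
    by (intro continuous_intros assms continuous_on_denom ballI denom_nonzero)
qed

text \<open>One fixed continuous logarithm of the denominator. At the identity it is only known to
  be a multiple of 2 pi i; the normalization concerns exp (- s L) alone.\<close>

definition L :: "'g \<times> (complex ^ 'n) \<Rightarrow> complex" where
  "L = (SOME L. continuous_on (carrier Gt \<times> ball 0 1) L \<and>
      (\<forall>g\<in>carrier Gt. \<forall>z\<in>ball 0 1. exp (L (g, z)) = denom (p g) z \<and> j g z = exp (- of_real s * L (g, z))))"

lemma L_props: "continuous_on (carrier Gt \<times> ball 0 1) L \<and>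
      (\<forall>g\<in>carrier Gt. \<forall>z\<in>ball 0 1. exp (L (g, z)) = denom (p g) z \<and> j g z = exp (- of_real s * L (g, z)))"
proof -
  have ex: "\<exists>L. continuous_on (carrier Gt \<times> ball 0 1) L \<and>
      (\<forall>g\<in>carrier Gt. \<forall>z\<in>ball 0 1. exp (L (g, z)) = denom (p g) z \<and> j g z = exp (- of_real s * L (g, z)))"
    using coc unfolding is_cocycle_def by blast
  show ?thesis unfolding L_def by (rule someI_ex[OF ex])
qed

lemma exp_L: "g \<in> carrier Gt \<Longrightarrow> z \<in> ball 0 1 \<Longrightarrow> exp (L (g, z)) = denom (p g) z"
  and j_eq: "g \<in> carrier Gt \<Longrightarrow> z \<in> ball 0 1 \<Longrightarrow> j g z = exp (- of_real s * L (g, z))"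
  using L_props by blast+

lemma j_one: "z \<in> ball 0 1 \<Longrightarrow> j \<one>\<^bsub>Gt\<^esub> z = 1"
  using coc unfolding is_cocycle_def by blast

lemma continuous_on_L:
  assumes "continuous_on S g" "continuous_on S f" "\<And>x. x \<in> S \<Longrightarrow> g x \<in> carrier Gt" "\<And>x. x \<in> S \<Longrightarrow> f x \<in> ball 0 1"
  shows "continuous_on S (\<lambda>x. L (g x, f x))"
proof (rule continuous_on_compose2[OF conjunct1[OF L_props]])
  show "continuous_on S (\<lambda>x. (g x, f x))" by (rule continuous_on_Pair[OF assms(1,2)])
  show "(\<lambda>x. (g x, f x)) ` S \<subseteq> carrier Gt \<times> ball 0 1" using assms(3,4) by blast
qed

lemma norm_j_sq:
  assumes "g \<in> carrier Gt" "z \<in> ball 0 1"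
  shows "(norm (j g z))\<^sup>2 = jac s (T g) z"
proof -
  have "norm (denom (p g) z) = exp (Re (L (g, z)))" unfolding exp_L[OF assms, symmetric] by (simp add: norm_exp_eq_Re)
  then show ?thesis unfolding j_eq[OF assms] jac_def denom_eq_pden[symmetric]
    by (simp add: norm_exp_eq_Re powr_def power2_eq_square flip: exp_add)
qed

text \<open>Here and in the next theorem continuous logarithms of both sides are compared on a connected set.\<close>
theorem j_mult:
  assumes g: "g \<in> carrier Gt" and h: "h \<in> carrier Gt" and z: "z \<in> ball 0 1"
  shows "j (g \<otimes>\<^bsub>Gt\<^esub> h) z = j g (act (p h) z) * j h z"
proof -
  define S where "S = carrier Gt \<times> carrier Gt \<times> ball (0 :: complex ^ 'n) 1"
  define f where "f = (\<lambda>(g, h, z). L (g \<otimes>\<^bsub>Gt\<^esub> h, z) - L (g, act (p h) z) - L (h, z))"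
  have "continuous_on S (\<lambda>x. (\<lambda>(x, y). x \<otimes>\<^bsub>Gt\<^esub> y) (fst x, fst (snd x)))"
    by (rule continuous_on_compose2[OF continuous_mult]) (auto simp: S_def intro!: continuous_intros)
  then have cm: "continuous_on S (\<lambda>x. fst x \<otimes>\<^bsub>Gt\<^esub> fst (snd x))" by simp
  have cf: "continuous_on S f"
    unfolding f_def case_prod_beta'
    by (intro continuous_on_diff continuous_on_L continuous_on_act cm continuous_intros)
       (auto simp: S_def intro: act_in_ball[simplified])
  have conn: "connected S" unfolding S_def
    by (intro connected_Times connected_carrier convex_connected convex_ball)
  have e1: "exp (f x) = 1" if "x \<in> S" for x
  proof -
    obtain g h z where x: "x = (g, h, z)" "g \<in> carrier Gt" "h \<in> carrier Gt" "z \<in> ball 0 1" using \<open>x \<in> S\<close> by (auto simp: S_def)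
    have "exp (f x) = denom (p (g \<otimes>\<^bsub>Gt\<^esub> h)) z / denom (p g) (act (p h) z) / denom (p h) z"
      using x by (simp add: f_def exp_diff exp_L act_in_ball[simplified])
    also have "\<dots> = 1" using x denom_nonzero act_in_ball by (simp add: denom_mult)
    finally show ?thesis .
  qed
  have "f (g, h, z) = f (\<one>\<^bsub>Gt\<^esub>, \<one>\<^bsub>Gt\<^esub>, 0)"
    by (rule continuous_log_constant[OF conn cf e1]) (use g h z in \<open>auto simp: S_def\<close>)
  \<comment> \<open>This value need not vanish, but it drops out after exponentiation with - s,
    because j is 1 at the identity.\<close>
  also have "\<dots> = - L (\<one>\<^bsub>Gt\<^esub>, 0)" by (simp add: f_def act_one)
  finally have eq: "L (g \<otimes>\<^bsub>Gt\<^esub> h, z) = L (g, act (p h) z) + L (h, z) - L (\<one>\<^bsub>Gt\<^esub>, 0)"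
    by (simp add: f_def algebra_simps)
  have "- of_real s * L (g \<otimes>\<^bsub>Gt\<^esub> h, z) = - of_real s * L (g, act (p h) z) + - of_real s * L (h, z) - (- of_real s * L (\<one>\<^bsub>Gt\<^esub>, 0))"
    unfolding eq by (simp only: right_diff_distrib distrib_left)
  then have "exp (- of_real s * L (g \<otimes>\<^bsub>Gt\<^esub> h, z)) = exp (- of_real s * L (g, act (p h) z)) * exp (- of_real s * L (h, z)) / exp (- of_real s * L (\<one>\<^bsub>Gt\<^esub>, 0))"
    by (simp only: exp_diff exp_add)
  then have "j (g \<otimes>\<^bsub>Gt\<^esub> h) z = j g (act (p h) z) * j h z / j \<one>\<^bsub>Gt\<^esub> 0"
    using g h z act_in_ball[OF h z] by (simp add: j_eq)
  then show ?thesis by (simp add: j_one)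
qed

theorem kernel_transform:
  assumes g: "g \<in> carrier Gt" and z: "z \<in> ball 0 1" and w: "w \<in> ball 0 1"
  shows "bergman_kernel s (act (p g) w) (act (p g) z) * (j g z * cnj (j g w)) = bergman_kernel s w z"
proof -
  define S where "S = carrier Gt \<times> ball (0 :: complex ^ 'n) 1 \<times> ball (0 :: complex ^ 'n) 1"
  define c where "c = (\<lambda>g z w. cip (act (p g) z) (act (p g) w))"
  \<comment> \<open>The principal logarithms are continuous here because 1 minus a number of modulus
    less than 1 has positive real part; exponentiating f gives 1 by
    \<open>one_minus_cip_pact\<close>.\<close>
  define f where "f = (\<lambda>(g, z, w). Ln (1 - c g z w) + L (g, z) + cnj (L (g, w)) - Ln (1 - cip z w))"
  have n1: "norm (cip z w) < 1" if "z \<in> ball 0 1" "w \<in> ball 0 1" for z w :: "complex ^ 'n"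
    using that by (intro norm_cip_less_1) auto
  have n2: "norm (c g z w) < 1" if "g \<in> carrier Gt" "z \<in> ball 0 1" "w \<in> ball 0 1" for g z w
    unfolding c_def by (intro n1 act_in_ball that)
  have np: "1 - u \<notin> \<real>\<^sub>\<le>\<^sub>0" "1 - u \<noteq> 0" if "norm u < 1" for u :: complex
    using Re_one_minus_pos[OF that] by (auto simp: complex_nonpos_Reals_iff)
  have cf: "continuous_on S f"
    unfolding f_def case_prod_beta' c_def
  proof (intro continuous_on_diff continuous_on_add continuous_on_L continuous_on_cnj continuous_on_Ln continuous_on_cip continuous_on_act continuous_intros)
    fix x assume "x \<in> S"
    then show "1 - cip (act (p (fst x)) (fst (snd x))) (act (p (fst x)) (snd (snd x))) \<notin> \<real>\<^sub>\<le>\<^sub>0"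
      "1 - cip (fst (snd x)) (snd (snd x)) \<notin> \<real>\<^sub>\<le>\<^sub>0"
      by (auto simp: S_def simp del: mem_ball intro!: np(1) n1 act_in_ball)
  qed (auto simp: S_def)
  have conn: "connected S" unfolding S_def
    by (intro connected_Times connected_carrier convex_connected convex_ball)
  have e1: "exp (f x) = 1" if "x \<in> S" for x
  proof -
    obtain g z w where x: "x = (g, z, w)" "g \<in> carrier Gt" "z \<in> ball 0 1" "w \<in> ball 0 1" using \<open>x \<in> S\<close> by (auto simp: S_def)
    have "exp (f x) = (1 - c g z w) * denom (p g) z * cnj (denom (p g) w) / (1 - cip z w)"
      using x np(2)[OF n1[OF x(3,4)]] np(2)[OF n2[OF x(2-4)]]
      by (simp add: f_def exp_diff exp_add exp_L flip: exp_cnj)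
    also have "1 - c g z w = (1 - cip z w) / (denom (p g) z * cnj (denom (p g) w))"
      unfolding c_def act_eq_pact denom_eq_pden by (rule one_minus_cip_pact[OF T_pu[OF x(2)] x(3,4)])
    finally show ?thesis using denom_nonzero[OF x(2,3)] denom_nonzero[OF x(2,4)] np(2)[OF n1[OF x(3,4)]] by simp
  qed
  have "f (g, z, w) = f (\<one>\<^bsub>Gt\<^esub>, 0, 0)"
    by (rule continuous_log_constant[OF conn cf e1]) (use g z w in \<open>auto simp: S_def\<close>)
  \<comment> \<open>The logarithm at the identity is purely imaginary, so it cancels against its
    conjugate.\<close>
  also have "\<dots> = 0"
  proof -
    have "exp (L (\<one>\<^bsub>Gt\<^esub>, 0)) = 1" by (simp add: exp_L denom_one)
    then have "norm (exp (L (\<one>\<^bsub>Gt\<^esub>, 0))) = 1" by simp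
    then have "Re (L (\<one>\<^bsub>Gt\<^esub>, 0)) = 0" by (simp add: norm_exp_eq_Re)
    then have "L (\<one>\<^bsub>Gt\<^esub>, 0) + cnj (L (\<one>\<^bsub>Gt\<^esub>, 0)) = 0" by (simp add: complex_add_cnj)
    then show ?thesis by (simp add: f_def c_def act_one)
  qed
  finally have "Ln (1 - c g z w) + L (g, z) + cnj (L (g, w)) = Ln (1 - cip z w)" by (simp add: f_def)
  then have "exp (- of_real s * (Ln (1 - c g z w) + L (g, z) + cnj (L (g, w)))) = exp (- of_real s * Ln (1 - cip z w))" by simp
  then have "exp (- of_real s * Ln (1 - c g z w)) * (exp (- of_real s * L (g, z)) * cnj (exp (- of_real s * L (g, w)))) = exp (- of_real s * Ln (1 - cip z w))"
    unfolding exp_cnj by (simp only: distrib_left exp_add complex_cnj_mult complex_cnj_minus complex_cnj_complex_of_real mult.assoc)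
  then show ?thesis
    unfolding bergman_kernel_cip j_eq[OF g z] j_eq[OF g w] powr_def
    using np(2)[OF n1[OF z w]] np(2)[OF n2[OF g z w]] by (simp add: c_def)
qed

lemma continuous_on_j:
  assumes "z \<in> ball 0 1" "S \<subseteq> carrier Gt"
  shows "continuous_on S (\<lambda>g. j g z)"
proof -
  have "continuous_on S (\<lambda>g. exp (- of_real s * L (g, z)))"
    using assms by (intro continuous_intros continuous_on_L) auto
  then show ?thesis using assms by (subst continuous_on_cong[OF refl j_eq]) auto
qed

end

lemma continuous_on_act_SU:
  fixes z :: "complex ^ ('n::finite)"
  assumes "z \<in> ball 0 1"
  shows "continuous_on (carrier SU_n1) (\<lambda>h. act h z)"
proof -
  have "denom h z \<noteq> 0" if "h \<in> carrier SU_n1" for h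
    unfolding denom_eq_pden by (rule pden_nonzero[OF mlin_pseudo_unitary[OF that] assms])
  moreover have "continuous_on (carrier SU_n1) (\<lambda>h. denom h z)"
    unfolding denom_def by (intro continuous_intros)
  ultimately show ?thesis unfolding act_def by (intro continuous_intros ballI) auto
qed

lemma (in covering_cocycle) p_inv:
  assumes g: "g \<in> carrier Gt"
  shows "inv\<^bsub>SU_n1\<^esub> (p g) = p (inv\<^bsub>Gt\<^esub> g)"
  unfolding m_inv_def[of SU_n1]
proof (rule the_equality)
  have "p g ** p (inv\<^bsub>Gt\<^esub> g) = mat 1" "p (inv\<^bsub>Gt\<^esub> g) ** p g = mat 1"
    using p_mult[OF g Gt.inv_closed[OF g]] p_mult[OF Gt.inv_closed[OF g] g] g by (simp_all add: p_one)
  then show "p (inv\<^bsub>Gt\<^esub> g) \<in> carrier SU_n1 \<and> p g \<otimes>\<^bsub>SU_n1\<^esub> p (inv\<^bsub>Gt\<^esub> g) = \<one>\<^bsub>SU_n1\<^esub> \<and> p (inv\<^bsub>Gt\<^esub> g) \<otimes>\<^bsub>SU_n1\<^esub> p g = \<one>\<^bsub>SU_n1\<^esub>"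
    using p_carrier[OF Gt.inv_closed[OF g]] by (simp add: SU_n1_def)
  fix y assume "y \<in> carrier SU_n1 \<and> p g \<otimes>\<^bsub>SU_n1\<^esub> y = \<one>\<^bsub>SU_n1\<^esub> \<and> y \<otimes>\<^bsub>SU_n1\<^esub> p g = \<one>\<^bsub>SU_n1\<^esub>"
  then have "y ** p g = mat 1" by (simp add: SU_n1_def)
  then show "y = p (inv\<^bsub>Gt\<^esub> g)"
    using \<open>p g ** p (inv\<^bsub>Gt\<^esub> g) = mat 1\<close> by (metis matrix_mul_assoc matrix_mul_lid matrix_mul_rid)
qed

section \<open>The restriction operator\<close>

locale orbit_setting = covering_cocycle s Gt p j
  for s :: real
    and Gt :: "'g::topological_space monoid"
    and p :: "'g \<Rightarrow> complex ^ ('n::finite) option ^ 'n option"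
    and j :: "'g \<Rightarrow> complex ^ 'n \<Rightarrow> complex" +
  fixes H :: "(complex ^ 'n option ^ 'n option) set"
    and Ht :: "'g set"
    and z0 :: "complex ^ 'n"
    and M :: "(complex ^ 'n) set"
    and \<mu> :: "(complex ^ 'n) measure"
  assumes s: "real CARD('n) < s"
    and H: "subgroup H SU_n1" "closedin (top_of_set (carrier SU_n1)) H"
    and Ht_eq: "Ht = {g \<in> carrier Gt. p g \<in> H}"
    and z0: "z0 \<in> ball 0 1"
    and M_eq: "M = (\<lambda>h. act h z0) ` H"
    and mu: "space \<mu> = M" "sets \<mu> = sets (restrict_space borel M)"
    and mu_inv: "\<And>h. h \<in> Ht \<Longrightarrow> distr \<mu> \<mu> (act (p h)) = \<mu>"
    and D: "(\<lambda>h. j h z0) \<in> L2_orbit Gt p j Ht z0 \<mu>"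
begin

abbreviation "stab \<equiv> stabilizer p Ht z0"

lemma Ht_carrier: "h \<in> Ht \<Longrightarrow> h \<in> carrier Gt"
  by (simp add: Ht_eq)

lemma Ht_mult: "g \<in> Ht \<Longrightarrow> h \<in> Ht \<Longrightarrow> g \<otimes>\<^bsub>Gt\<^esub> h \<in> Ht"
  using subgroup.m_closed[OF H(1), of "p g" "p h"] by (simp add: Ht_eq p_mult SU_n1_def)

lemma Ht_inv: "g \<in> Ht \<Longrightarrow> inv\<^bsub>Gt\<^esub> g \<in> Ht"
  using subgroup.m_inv_closed[OF H(1), of "p g"] by (simp add: Ht_eq p_inv)

lemma orbit_in_M: "h \<in> Ht \<Longrightarrow> act (p h) z0 \<in> M"
  by (auto simp: M_eq Ht_eq)

lemma M_ball: "m \<in> M \<Longrightarrow> m \<in> ball 0 1"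
proof -
  assume "m \<in> M"
  then obtain g where g: "g \<in> H" "m = act g z0" unfolding M_eq by blast
  then have "g \<in> carrier SU_n1" using subgroup.subset[OF H(1)] by blast
  then show ?thesis unfolding g(2) act_eq_pact by (intro pact_in_ball mlin_pseudo_unitary z0)
qed

lemma act_M: "h \<in> Ht \<Longrightarrow> m \<in> M \<Longrightarrow> act (p h) m \<in> M"
proof -
  assume h: "h \<in> Ht" and m: "m \<in> M"
  have ps: "p ` carrier Gt = carrier SU_n1" using cov by (simp add: universal_covering_group_def covering_space_def)
  obtain g0 where g0: "g0 \<in> H" "m = act g0 z0" using m by (auto simp: M_eq)
  have "g0 \<in> carrier SU_n1" using subgroup.subset[OF H(1)] g0(1) by (rule subsetD)
  then have "g0 \<in> p ` carrier Gt" unfolding ps .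
  then obtain g where g: "g \<in> carrier Gt" "p g = g0" by auto
  then have gH: "g \<in> Ht" using g0 by (simp add: Ht_eq)
  have "act (p h) m = act (p (h \<otimes>\<^bsub>Gt\<^esub> g)) z0"
    using act_mult[OF Ht_carrier[OF h] g(1) z0] g(2) g0(2) by simp
  then show ?thesis using orbit_in_M[OF Ht_mult[OF h gH]] by simp
qed

text \<open>Replaces the arbitrary representatives picked by \<open>descend\<close> by Borel measurable ones, so that
  measurability on \<open>Ht\<close> passes to the orbit.\<close>
definition sec :: "complex ^ 'n \<Rightarrow> 'g" where
  "sec = (SOME t. t \<in> restrict_space borel M \<rightarrow>\<^sub>M restrict_space borel Ht \<and> (\<forall>m\<in>M. t m \<in> Ht \<and> act (p (t m)) z0 = m))"

lemma sec_props: "sec \<in> restrict_space borel M \<rightarrow>\<^sub>M restrict_space borel Ht \<and> (\<forall>m\<in>M. sec m \<in> Ht \<and> act (p (sec m)) z0 = m)"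
proof -
  \<comment> \<open>A Borel section of the orbit map into H exists because H is closed among all
    matrices; a Borel section of the covering then lifts it to Ht.\<close>
  have Hc: "closed H" using H(2) closed_SU by (rule closedin_closed_trans)
  have Hs: "H \<subseteq> carrier SU_n1" using H(1) by (rule subgroup.subset)
  obtain t where t: "t \<in> borel_measurable (restrict_space borel M)" "\<And>m. m \<in> M \<Longrightarrow> t m \<in> H" "\<And>m. m \<in> M \<Longrightarrow> act (t m) z0 = m"
    using borel_selection[OF Hc continuous_on_subset[OF continuous_on_act_SU[OF z0] Hs]] unfolding M_eq by blast
  obtain \<sigma> where \<sigma>: "\<sigma> \<in> restrict_space borel (carrier SU_n1) \<rightarrow>\<^sub>M restrict_space borel (carrier Gt)"
    "\<And>x. x \<in> carrier SU_n1 \<Longrightarrow> \<sigma> x \<in> carrier Gt" "\<And>x. x \<in> carrier SU_n1 \<Longrightarrow> p (\<sigma> x) = x"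
    using covering_space_borel_section[of "carrier Gt" p "carrier SU_n1"] cov unfolding universal_covering_group_def by metis
  define u where "u = (\<lambda>m. \<sigma> (t m))"
  have uH: "u m \<in> Ht" "act (p (u m)) z0 = m" if "m \<in> M" for m
    using t(2,3)[OF that] \<sigma>(2,3)[of "t m"] Hs by (auto simp: u_def Ht_eq)
  have "t \<in> restrict_space borel M \<rightarrow>\<^sub>M restrict_space borel (carrier SU_n1)"
    using t(1,2) Hs by (intro measurable_restrict_space2) (auto simp: space_restrict_space)
  from measurable_compose[OF this \<sigma>(1)]
  have "u \<in> restrict_space borel M \<rightarrow>\<^sub>M restrict_space borel (carrier Gt)" unfolding u_def .
  then have "u \<in> restrict_space borel M \<rightarrow>\<^sub>M borel" by (simp add: measurable_restrict_space2_iff)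
  then have "u \<in> restrict_space borel M \<rightarrow>\<^sub>M restrict_space borel Ht"
    using uH(1) by (intro measurable_restrict_space2) (auto simp: space_restrict_space)
  then have ex: "\<exists>t. t \<in> restrict_space borel M \<rightarrow>\<^sub>M restrict_space borel Ht \<and> (\<forall>m\<in>M. t m \<in> Ht \<and> act (p (t m)) z0 = m)"
    using uH by blast
  show ?thesis unfolding sec_def by (rule someI_ex[OF ex])
qed

lemma sec_Ht: "m \<in> M \<Longrightarrow> sec m \<in> Ht" and act_sec: "m \<in> M \<Longrightarrow> act (p (sec m)) z0 = m"
  using sec_props by auto

lemma sec_measurable: "f \<in> borel_measurable (restrict_space borel Ht) \<Longrightarrow> (\<lambda>m. f (sec m)) \<in> borel_measurable \<mu>"
  unfolding measurable_cong_sets[OF mu(2) refl]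
  using measurable_compose[OF conjunct1[OF sec_props]] .

lemma id_measurable [measurable]: "(\<lambda>m. m) \<in> borel_measurable \<mu>"
  unfolding measurable_cong_sets[OF mu(2) refl] by (rule measurable_restrict_space1) simp

text \<open>Two representatives of the same orbit point differ on the right by an element of the
  stabilizer, which F does not see.\<close>

lemma descend_sec:
  assumes inv: "\<And>h k. h \<in> Ht \<Longrightarrow> k \<in> stab \<Longrightarrow> F (h \<otimes>\<^bsub>Gt\<^esub> k) = F h" and m: "m \<in> M"
  shows "descend p Ht z0 F m = F (sec m)"
proof -
  define h where "h = (SOME h. h \<in> Ht \<and> act (p h) z0 = m)"
  have "h \<in> Ht \<and> act (p h) z0 = m" unfolding h_def by (rule someI[of _ "sec m"]) (simp add: sec_Ht act_sec m)
  then have h: "h \<in> Ht" "act (p h) z0 = m" by auto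
  note c = Ht_carrier[OF h(1)] Ht_carrier[OF sec_Ht[OF m]]
  define k where "k = inv\<^bsub>Gt\<^esub> (sec m) \<otimes>\<^bsub>Gt\<^esub> h"
  have "k \<in> Ht" unfolding k_def by (intro Ht_mult Ht_inv sec_Ht m h)
  moreover have "act (p k) z0 = z0"
    unfolding k_def act_mult[OF Gt.inv_closed[OF c(2)] c(1) z0] h(2)
    using act_inv(1)[OF c(2) z0] by (simp add: act_sec[OF m])
  ultimately have "k \<in> stab" by (simp add: stabilizer_def)
  from inv[OF sec_Ht[OF m] this] have "F (sec m \<otimes>\<^bsub>Gt\<^esub> k) = F (sec m)" .
  moreover have "sec m \<otimes>\<^bsub>Gt\<^esub> k = h"
    unfolding k_def using c by (simp add: Gt.m_assoc[symmetric])
  ultimately show ?thesis by (simp add: descend_def h_def)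
qed

text \<open>At a fixed point the identity for 1 - |z|^2 forces the denominator to have modulus 1;
  this is the unitarity of the character.\<close>

lemma norm_j_stab:
  assumes "k \<in> stab" shows "norm (j k z0) = 1"
proof -
  have k: "k \<in> carrier Gt" "act (p k) z0 = z0" using assms by (auto simp: stabilizer_def Ht_eq)
  have n: "1 - (norm z0)\<^sup>2 > 0" using z0 norm_sq_less_1[of z0] by simp
  have "1 - (norm z0)\<^sup>2 = (1 - (norm z0)\<^sup>2) / (norm (pden (T k) z0))\<^sup>2"
    using one_minus_norm_pact[OF T_pu[OF k(1)] z0] k(2) by (simp add: act_eq_pact)
  then have "(1 - (norm z0)\<^sup>2) * (norm (pden (T k) z0))\<^sup>2 = 1 - (norm z0)\<^sup>2"
    using pden_nonzero[OF T_pu[OF k(1)] z0] by (simp add: eq_divide_eq)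
  then have "(norm (pden (T k) z0))\<^sup>2 = 1" using n by (simp only: mult_cancel_left2) simp
  then have "norm (pden (T k) z0) = 1" by (simp add: power2_eq_1_iff) (smt (verit) norm_ge_zero)
  then have "(norm (j k z0))\<^sup>2 = 1" unfolding norm_j_sq[OF k(1) z0] by (simp add: jac_def)
  then show ?thesis by (simp add: power2_eq_1_iff) (smt (verit) norm_ge_zero)
qed

text \<open>The factor \<open>j k z0\<close> is the inverse of the character, which is itself
  defined as an inverse.\<close>

definition equivariant :: "('g \<Rightarrow> complex) \<Rightarrow> bool" where
  "equivariant f \<longleftrightarrow> (\<forall>h\<in>Ht. \<forall>k\<in>stab. f (h \<otimes>\<^bsub>Gt\<^esub> k) = j k z0 * f h)"

lemma cnj_mult_stab: "k \<in> stab \<Longrightarrow> j k z0 * a * cnj (j k z0 * b) = a * cnj b"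
proof -
  assume "k \<in> stab"
  then have "j k z0 * cnj (j k z0) = 1" unfolding complex_norm_square[symmetric] by (simp add: norm_j_stab)
  then show ?thesis by (metis (no_types, lifting) complex_cnj_mult mult.assoc mult.commute mult_1)
qed

text \<open>Composition with the section carries sections on the group to functions on the orbit, so
  that the theory of square integrable functions for \<mu> becomes available.\<close>

lemma L2_orbit_iff:
  "f \<in> L2_orbit Gt p j Ht z0 \<mu> \<longleftrightarrow> f \<in> borel_measurable (restrict_space borel Ht) \<and> equivariant f \<and> square_integrable \<mu> (\<lambda>m. f (sec m))"
proof -
  have e: "(\<forall>h\<in>Ht. \<forall>k\<in>stab. f (h \<otimes>\<^bsub>Gt\<^esub> k) = inverse (character j z0 k) * f h) \<longleftrightarrow> equivariant f"
    by (simp add: equivariant_def character_def)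
  have "integrable \<mu> (descend p Ht z0 (\<lambda>h. (norm (f h))\<^sup>2)) \<longleftrightarrow> integrable \<mu> (\<lambda>m. (norm (f (sec m)))\<^sup>2)" if "equivariant f"
  proof (rule Bochner_Integration.integrable_cong[OF refl])
    fix m assume "m \<in> space \<mu>"
    then have m: "m \<in> M" by (simp add: mu)
    show "descend p Ht z0 (\<lambda>h. (norm (f h))\<^sup>2) m = (norm (f (sec m)))\<^sup>2"
      using that by (intro descend_sec m) (simp add: equivariant_def norm_mult norm_j_stab)
  qed
  then show ?thesis unfolding L2_orbit_def square_integrable_def using e sec_measurable by auto
qed

lemma orbit_inner_eq:
  assumes "equivariant f" "equivariant g"
  shows "orbit_inner p Ht z0 \<mu> f g = l2_inner \<mu> (\<lambda>m. f (sec m)) (\<lambda>m. g (sec m))"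
  unfolding orbit_inner_def l2_inner_def
proof (rule Bochner_Integration.integral_cong[OF refl])
  fix m assume "m \<in> space \<mu>"
  then have m: "m \<in> M" by (simp add: mu)
  show "descend p Ht z0 (\<lambda>h. f h * cnj (g h)) m = f (sec m) * cnj (g (sec m))"
  proof (rule descend_sec[OF _ m])
    fix h k assume hk: "h \<in> Ht" "k \<in> stab"
    show "f (h \<otimes>\<^bsub>Gt\<^esub> k) * cnj (g (h \<otimes>\<^bsub>Gt\<^esub> k)) = f h * cnj (g h)"
      using assms hk cnj_mult_stab[OF hk(2), of "f h" "g h"] unfolding equivariant_def by simp
  qed
qed

lemma j_mult_stab:
  assumes "h \<in> Ht" "k \<in> stab"
  shows "j (h \<otimes>\<^bsub>Gt\<^esub> k) z0 = j k z0 * j h z0" "act (p (h \<otimes>\<^bsub>Gt\<^esub> k)) z0 = act (p h) z0"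
proof -
  have k: "k \<in> carrier Gt" "act (p k) z0 = z0" using assms by (auto simp: stabilizer_def Ht_eq)
  show "j (h \<otimes>\<^bsub>Gt\<^esub> k) z0 = j k z0 * j h z0" using j_mult[OF Ht_carrier[OF assms(1)] k(1) z0] k(2) by simp
  show "act (p (h \<otimes>\<^bsub>Gt\<^esub> k)) z0 = act (p h) z0" using act_mult[OF Ht_carrier[OF assms(1)] k(1) z0] k(2) by simp
qed

lemma equivariant_restr: "equivariant (restr p j z0 u)"
  by (simp add: equivariant_def restr_def j_mult_stab)

lemma restr_measurable:
  assumes u: "u \<in> bergman_space s"
  shows "restr p j z0 u \<in> borel_measurable (restrict_space borel Ht)"
proof (rule borel_measurable_continuous_on_restrict)
  have sub: "Ht \<subseteq> carrier Gt" using Ht_carrier by blast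
  have "continuous_on Ht (\<lambda>h. u (act (p h) z0))"
  proof (rule continuous_on_compose2[OF holomorphic_n_continuous[OF bergman_spaceD(1)[OF u]]])
    show "continuous_on Ht (\<lambda>h. act (p h) z0)" by (rule continuous_on_act) (use z0 Ht_carrier in \<open>auto intro!: continuous_intros\<close>)
    show "(\<lambda>h. act (p h) z0) ` Ht \<subseteq> ball 0 1" using act_in_ball[OF Ht_carrier z0] by blast
  qed
  then show "continuous_on Ht (restr p j z0 u)"
    unfolding restr_def[abs_def] by (intro continuous_on_mult continuous_on_j z0 sub)
qed

text \<open>The denominator at z0 is determined in modulus by the ratio of 1 - |z|^2 at z0 and at
  its image. So |j(h, z0)|^2 is a function of the orbit point alone, and it is the weight occurring
  in \<open>bergman_submean\<close>.\<close>

lemma norm_j_sec: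
  assumes m: "m \<in> M"
  shows "(norm (j (sec m) z0))\<^sup>2 = (1 - (norm m)\<^sup>2) powr s / (1 - (norm z0)\<^sup>2) powr s"
proof -
  note c = Ht_carrier[OF sec_Ht[OF m]]
  define d where "d = norm (pden (T (sec m)) z0)"
  have d: "d > 0" unfolding d_def using pden_nonzero[OF T_pu[OF c] z0] by simp
  have n: "1 - (norm z0)\<^sup>2 > 0" using z0 norm_sq_less_1[of z0] by simp
  have "1 - (norm m)\<^sup>2 = (1 - (norm z0)\<^sup>2) / d\<^sup>2"
    using one_minus_norm_pact[OF T_pu[OF c] z0] act_sec[OF m] by (simp add: act_eq_pact d_def)
  then have "(1 - (norm m)\<^sup>2) powr s = (1 - (norm z0)\<^sup>2) powr s / (d\<^sup>2) powr s" using n d by (simp add: powr_divide)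
  also have "(d\<^sup>2) powr s = d powr (2 * s)" using d by (simp add: powr_powr flip: powr_numeral)
  finally have e: "(1 - (norm m)\<^sup>2) powr s / (1 - (norm z0)\<^sup>2) powr s = d powr (- 2 * s)"
    using n d by (simp add: powr_minus divide_inverse)
  show ?thesis unfolding e norm_j_sq[OF c z0] jac_def d_def ..
qed

text \<open>The hypothesis that h \<mapsto> j(h, z0) is square integrable, rewritten on the
  orbit.\<close>

lemma integrable_weight: "integrable \<mu> (\<lambda>m. (1 - (norm m)\<^sup>2) powr s)"
proof -
  have n: "(1 - (norm z0)\<^sup>2) powr s > 0" using z0 norm_sq_less_1[of z0] by simp
  have "integrable \<mu> (\<lambda>m. (norm (j (sec m) z0))\<^sup>2)" using D by (simp add: L2_orbit_iff square_integrable_def)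
  then have "integrable \<mu> (\<lambda>m. (1 - (norm m)\<^sup>2) powr s / (1 - (norm z0)\<^sup>2) powr s)"
    by (rule Bochner_Integration.integrable_cong[OF refl, THEN iffD1, rotated]) (simp add: mu norm_j_sec)
  then have "integrable \<mu> (\<lambda>m. (1 - (norm z0)\<^sup>2) powr s * ((1 - (norm m)\<^sup>2) powr s / (1 - (norm z0)\<^sup>2) powr s))"
    by (rule integrable_mult_right)
  then show ?thesis using n by simp
qed

text \<open>Markov's inequality: on this set the integrable weight is at least c powr s.\<close>

lemma layer_finite:
  assumes c: "c > 0"
  shows "{m \<in> M. c \<le> 1 - (norm m)\<^sup>2} \<in> sets \<mu>" "emeasure \<mu> {m \<in> M. c \<le> 1 - (norm m)\<^sup>2} < \<infinity>"
proof -
  have sp: "0 \<le> s" using s by linarith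
  have "{m \<in> space \<mu>. c \<le> 1 - (norm m)\<^sup>2} \<in> sets \<mu>" by measurable
  then show sets: "{m \<in> M. c \<le> 1 - (norm m)\<^sup>2} \<in> sets \<mu>" by (simp add: mu)
  have "emeasure \<mu> {m \<in> M. c \<le> 1 - (norm m)\<^sup>2} = (\<integral>\<^sup>+m. indicator {m \<in> M. c \<le> 1 - (norm m)\<^sup>2} m \<partial>\<mu>)"
    using sets by simp
  also have "\<dots> \<le> (\<integral>\<^sup>+m. ennreal ((1 - (norm m)\<^sup>2) powr s / c powr s) \<partial>\<mu>)"
  proof (rule nn_integral_mono)
    fix m :: "complex ^ 'n"
    have "1 \<le> (1 - (norm m)\<^sup>2) powr s / c powr s" if "c \<le> 1 - (norm m)\<^sup>2"
      using powr_mono2[OF sp less_imp_le[OF c] that] c by simp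
    then show "indicator {m \<in> M. c \<le> 1 - (norm m)\<^sup>2} m \<le> ennreal ((1 - (norm m)\<^sup>2) powr s / c powr s)"
      by (simp add: indicator_def ennreal_ge_1)
  qed
  also have "\<dots> < \<infinity>"
    using integrable_weight by (subst nn_integral_eq_integral) auto
  finally show "emeasure \<mu> {m \<in> M. c \<le> 1 - (norm m)\<^sup>2} < \<infinity>" .
qed

lemma sigma_finite_mu: "sigma_finite_measure \<mu>"
proof
  \<comment> \<open>Every orbit point lies inside the open ball, so these sets of finite measure
    exhaust the orbit.\<close>
  define A where "A = (\<lambda>n::nat. {m \<in> M. 1 / real (Suc n) \<le> 1 - (norm m)\<^sup>2})"
  have "(\<Union>n. A n) = M"
  proof
    show "M \<subseteq> (\<Union>n. A n)"
    proof
      fix m assume m: "m \<in> M"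
      then have "0 < 1 - (norm m)\<^sup>2" using norm_sq_less_1[of m] M_ball[OF m] by simp
      then obtain n where "1 / real (Suc n) < 1 - (norm m)\<^sup>2" by (rule nat_approx_posE)
      then show "m \<in> (\<Union>n. A n)" using m by (auto simp: A_def intro: less_imp_le)
    qed
  qed (auto simp: A_def)
  moreover have "A n \<in> sets \<mu>" "emeasure \<mu> (A n) \<noteq> \<infinity>" for n
    using layer_finite[of "1 / real (Suc n)"] by (auto simp: A_def)
  ultimately show "\<exists>A. countable A \<and> A \<subseteq> sets \<mu> \<and> \<Union>A = space \<mu> \<and> (\<forall>a\<in>A. emeasure \<mu> a \<noteq> \<infinity>)"
    by (intro exI[of _ "range A"]) (auto simp: mu)
qed

section \<open>Uniform bounds on hyperbolic balls and boundedness of the restriction\<close>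

lemma act_measurable:
  assumes h: "h \<in> Ht" shows "act (p h) \<in> \<mu> \<rightarrow>\<^sub>M \<mu>"
proof -
  note hc = Ht_carrier[OF h]
  have "continuous_on M (act (p h))"
    unfolding act_eq_pact[abs_def]
    by (rule continuous_on_subset[OF continuous_on_pact[OF T_pu[OF hc]] subsetI[OF M_ball]])
  then have "act (p h) \<in> borel_measurable (restrict_space borel M)" by (rule borel_measurable_continuous_on_restrict)
  then have "act (p h) \<in> restrict_space borel M \<rightarrow>\<^sub>M restrict_space borel M"
    using act_M[OF h] by (intro measurable_restrict_space2) (auto simp: space_restrict_space)
  then show ?thesis by (simp add: measurable_cong_sets[OF mu(2) mu(2)])
qed

lemma hdist_act:
  assumes "h \<in> carrier Gt" "z \<in> ball 0 1" "w \<in> ball 0 1"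
  shows "hdist (act (p h) z) (act (p h) w) = hdist z w"
  unfolding act_eq_pact by (rule hdist_pact[OF T_pu[OF assms(1)] assms(2,3)])

text \<open>A neighbourhood of bounded size meeting the orbit can be moved by \<open>Ht\<close> close to the base point.\<close>
lemma neighbourhood_bound:
  defines "c \<equiv> (3/4) * ((3/8) * (1 - norm z0)\<^sup>2)\<^sup>2"
  assumes z: "z \<in> ball 0 1"
  shows "emeasure \<mu> {m \<in> space \<mu>. hdist z m \<le> 4/3} \<le> emeasure \<mu> {m \<in> M. c \<le> 1 - (norm m)\<^sup>2}"
proof (cases "{m \<in> space \<mu>. hdist z m \<le> 4/3} = {}")
  case True show ?thesis unfolding True by (simp only: emeasure_empty zero_le)
next
  case False
  then obtain m1 where m1: "m1 \<in> M" "hdist z m1 \<le> 4/3" by (auto simp: mu)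
  \<comment> \<open>Moves the orbit point m1 to z0, and with it the whole neighbourhood;
    \<open>hdist_bounded\<close> then confines the neighbourhood to a fixed layer.\<close>
  define h where "h = inv\<^bsub>Gt\<^esub> (sec m1)"
  have h: "h \<in> Ht" unfolding h_def by (intro Ht_inv sec_Ht m1)
  note hc = Ht_carrier[OF h]
  have hm1: "act (p h) m1 = z0"
    unfolding h_def using act_inv(1)[OF Ht_carrier[OF sec_Ht[OF m1(1)]] z0] by (simp add: act_sec[OF m1(1)])
  have c: "c > 0" unfolding c_def using z0 by simp
  define S where "S = {m \<in> M. c \<le> 1 - (norm m)\<^sup>2}"
  have "{m \<in> space \<mu>. hdist z m \<le> 4/3} \<subseteq> act (p h) -` S \<inter> space \<mu>"
  proof
    fix m assume "m \<in> {m \<in> space \<mu>. hdist z m \<le> 4/3}"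
    then have m: "m \<in> M" "hdist z m \<le> 4/3" by (auto simp: mu)
    have "hdist (act (p h) z) z0 \<le> 4/3" using hdist_act[OF hc z M_ball[OF m1(1)]] m1(2) hm1 by simp
    moreover have "hdist (act (p h) z) (act (p h) m) \<le> 4/3" using hdist_act[OF hc z M_ball[OF m(1)]] m(2) by simp
    ultimately have "c \<le> 1 - (norm (act (p h) m))\<^sup>2"
      unfolding c_def by (intro hdist_bounded[OF act_in_ball[OF hc z] z0 act_in_ball[OF hc M_ball[OF m(1)]]])
    then show "m \<in> act (p h) -` S \<inter> space \<mu>" using act_M[OF h m(1)] m(1) by (simp add: S_def mu)
  qed
  then have "emeasure \<mu> {m \<in> space \<mu>. hdist z m \<le> 4/3} \<le> emeasure \<mu> (act (p h) -` S \<inter> space \<mu>)"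
    using measurable_sets[OF act_measurable[OF h], of S] layer_finite(1)[OF c] by (intro emeasure_mono) (auto simp: S_def)
  also have "\<dots> = emeasure (distr \<mu> \<mu> (act (p h))) S"
    using layer_finite(1)[OF c] by (subst emeasure_distr[OF act_measurable[OF h]]) (auto simp: S_def)
  finally show ?thesis by (simp add: mu_inv[OF h] S_def)
qed

text \<open>By \<open>norm_j_sec\<close> the integrand |R u|^2 is, up to a constant, |u m|^2 (1 -
  |m|^2)^s, which is what \<open>carleson_estimate\<close> controls.\<close>

lemma restr_bounded:
  obtains K where "K \<ge> 0" "\<And>u. u \<in> bergman_space s \<Longrightarrow> square_integrable \<mu> (\<lambda>m. restr p j z0 u (sec m))"
    "\<And>u. u \<in> bergman_space s \<Longrightarrow> (LINT m|\<mu>. (norm (restr p j z0 u (sec m)))\<^sup>2) \<le> K * (LINT z|bergman_measure s. (norm (u z))\<^sup>2)"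
proof -
  define c where "c = (3/4) * ((3/8) * (1 - norm z0)\<^sup>2)\<^sup>2"
  have c: "c > 0" unfolding c_def using z0 by simp
  define C where "C = measure \<mu> {m \<in> M. c \<le> 1 - (norm m)\<^sup>2}"
  have C: "emeasure \<mu> {m \<in> M. c \<le> 1 - (norm m)\<^sup>2} = ennreal C"
    using layer_finite(2)[OF c] by (simp add: C_def emeasure_eq_ennreal_measure)
  \<comment> \<open>Collects the measure of the ball of radius 1/2 and the normalization at z0 from
    \<open>norm_j_sec\<close>.\<close>
  define \<beta> where "\<beta> = measure (bergman_measure s :: (complex ^ 'n) measure) (ball 0 (1/2)) * (1 - (norm z0)\<^sup>2) powr s"
  have z0n: "(1 - (norm z0)\<^sup>2) powr s > 0" using z0 norm_sq_less_1[of z0] by simp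
  have \<beta>: "\<beta> > 0" unfolding \<beta>_def using measure_bergman_ball_pos[where 'n='n, OF s, of "1/2"] z0n by simp
  have main: "square_integrable \<mu> (\<lambda>m. restr p j z0 u (sec m)) \<and>
      (LINT m|\<mu>. (norm (restr p j z0 u (sec m)))\<^sup>2) \<le> C / \<beta> * (LINT z|bergman_measure s. (norm (u z))\<^sup>2)"
    if u: "u \<in> bergman_space s" for u
  proof -
    let ?I = "LINT z|bergman_measure s. (norm (u z))\<^sup>2"
    have I0: "0 \<le> ?I" by (intro integral_nonneg_AE) simp
    note [measurable] = sec_measurable[OF restr_measurable[OF u]]
    have eq: "measure (bergman_measure s :: (complex ^ 'n) measure) (ball 0 (1/2)) * ((norm (u m))\<^sup>2 * (1 - (norm m)\<^sup>2) powr s) =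
        \<beta> * (norm (restr p j z0 u (sec m)))\<^sup>2" if "m \<in> M" for m
      using norm_j_sec[OF that] act_sec[OF that] z0n
      by (simp add: restr_def norm_mult power_mult_distrib \<beta>_def)
    have "ennreal \<beta> * (\<integral>\<^sup>+m. ennreal ((norm (restr p j z0 u (sec m)))\<^sup>2) \<partial>\<mu>) =
        (\<integral>\<^sup>+m. ennreal \<beta> * ennreal ((norm (restr p j z0 u (sec m)))\<^sup>2) \<partial>\<mu>)"
      by (rule nn_integral_cmult[symmetric]) measurable
    also have "\<dots> = (\<integral>\<^sup>+m. ennreal (measure (bergman_measure s :: (complex ^ 'n) measure) (ball 0 (1/2)) * ((norm (u m))\<^sup>2 * (1 - (norm m)\<^sup>2) powr s)) \<partial>\<mu>)"
      using \<beta> by (intro nn_integral_cong) (simp add: mu eq ennreal_mult)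
    also have "\<dots> \<le> ennreal C * (\<integral>\<^sup>+z. ennreal ((norm (u z))\<^sup>2) \<partial>bergman_measure s)"
    proof (rule carleson_estimate[OF s sigma_finite_mu id_measurable _ _ u])
      show "space \<mu> \<subseteq> ball 0 1" using M_ball by (auto simp: mu simp del: mem_ball)
      show "emeasure \<mu> {m \<in> space \<mu>. hdist z m \<le> 4/3} \<le> ennreal C" if "z \<in> ball 0 1" for z
        using neighbourhood_bound[OF that] unfolding C[symmetric] c_def .
    qed
    also have "\<dots> = ennreal (C * ?I)"
      using square_integrableD(2)[OF bergman_spaceD(2)[OF u]] I0
      by (subst nn_integral_eq_integral) (auto simp: ennreal_mult C_def)
    also have "\<dots> = ennreal \<beta> * ennreal (C / \<beta> * ?I)"
      using \<beta> I0 by (simp add: ennreal_mult'[symmetric] C_def)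
    finally have le: "(\<integral>\<^sup>+m. ennreal ((norm (restr p j z0 u (sec m)))\<^sup>2) \<partial>\<mu>) \<le> ennreal (C / \<beta> * ?I)"
      using \<beta> by (subst (asm) ennreal_mult_le_mult_iff) auto
    then have i: "integrable \<mu> (\<lambda>m. (norm (restr p j z0 u (sec m)))\<^sup>2)"
      by (intro integrableI_bounded) (auto intro: le_less_trans[OF _ ennreal_less_top])
    have "0 \<le> C / \<beta> * ?I" using \<beta> I0 by (simp add: C_def)
    then have "(LINT m|\<mu>. (norm (restr p j z0 u (sec m)))\<^sup>2) \<le> C / \<beta> * ?I"
      using le i by (simp add: nn_integral_eq_integral)
    then show ?thesis using i by (simp add: square_integrable_def)
  qed
  show ?thesis by (rule that[of "C / \<beta>"]) (use main \<beta> in \<open>auto simp: C_def\<close>)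
qed

section \<open>The adjoint on the whole space\<close>

lemma restr_L2: "u \<in> bergman_space s \<Longrightarrow> restr p j z0 u \<in> L2_orbit Gt p j Ht z0 \<mu>"
  unfolding L2_orbit_iff using restr_bounded restr_measurable equivariant_restr by metis

text \<open>Being everywhere defined, the restriction operator has a unique adjoint, and any
  function in the Bergman space may be tested against it.\<close>

lemma restr_dom_eq: "restr_dom s Gt p j Ht z0 \<mu> = bergman_space s"
  unfolding restr_dom_def using restr_L2 by blast

text \<open>For every f the functional u \<mapsto> \<langle>R u, f\<rangle> is bounded by
  Cauchy-Schwarz and \<open>restr_bounded\<close>, so Riesz supplies the value of the
  adjoint.\<close>

lemma restr_adj_exists:
  assumes f: "f \<in> L2_orbit Gt p j Ht z0 \<mu>"
  shows "is_restr_adj s Gt p j Ht z0 \<mu> f (restr_adj s Gt p j Ht z0 \<mu> f)" "f \<in> restr_adj_dom s Gt p j Ht z0 \<mu>"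
proof -
  let ?B = "bergman_measure s :: (complex ^ 'n) measure"
  interpret Hs: function_hilbert_space "bergman_space s :: (complex ^ 'n \<Rightarrow> complex) set" "l2_inner ?B"
    by (rule bergman_hilbert[OF s])
  interpret L2: semi_inner_space "Collect (square_integrable \<mu>)" "l2_inner \<mu>" by (rule semi_inner_space_L2)
  define l where "l = (\<lambda>u. orbit_inner p Ht z0 \<mu> (restr p j z0 u) f)"
  have ef: "equivariant f" and fs: "(\<lambda>m. f (sec m)) \<in> Collect (square_integrable \<mu>)"
    using f by (auto simp: L2_orbit_iff)
  have l_eq: "l u = l2_inner \<mu> (\<lambda>m. restr p j z0 u (sec m)) (\<lambda>m. f (sec m))" for u
    unfolding l_def by (rule orbit_inner_eq[OF equivariant_restr ef])
  have Rs: "(\<lambda>m. restr p j z0 u (sec m)) \<in> Collect (square_integrable \<mu>)" if "u \<in> bergman_space s" for u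
    using restr_L2[OF that] by (simp add: L2_orbit_iff)
  obtain K where K: "K \<ge> 0" "\<And>u. u \<in> bergman_space s \<Longrightarrow> (LINT m|\<mu>. (norm (restr p j z0 u (sec m)))\<^sup>2) \<le> K * (LINT z|?B. (norm (u z))\<^sup>2)"
    using restr_bounded by metis
  have "\<exists>g\<in>bergman_space s. \<forall>u\<in>bergman_space s. l u = l2_inner ?B u g"
  proof (rule Hs.riesz)
    fix u v :: "complex ^ 'n \<Rightarrow> complex" and c assume u: "u \<in> bergman_space s"
    have "restr p j z0 (\<lambda>x. c * u x) = (\<lambda>h. c * restr p j z0 u h)" by (simp add: restr_def fun_eq_iff)
    then show "l (\<lambda>x. c * u x) = c * l u" unfolding l_eq using L2.ip_scale[OF Rs[OF u] fs, of c] by simp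
    show "(norm (l u))\<^sup>2 \<le> (LINT m|\<mu>. (norm (f (sec m)))\<^sup>2) * K * Hs.sqn u"
    proof -
      have "(norm (l u))\<^sup>2 \<le> (LINT m|\<mu>. (norm (restr p j z0 u (sec m)))\<^sup>2) * (LINT m|\<mu>. (norm (f (sec m)))\<^sup>2)"
        unfolding l_eq using Rs[OF u] fs by (intro l2_cauchy_schwarz) auto
      also have "\<dots> \<le> K * (LINT z|?B. (norm (u z))\<^sup>2) * (LINT m|\<mu>. (norm (f (sec m)))\<^sup>2)"
        by (intro mult_right_mono K(2)[OF u] integral_nonneg_AE) simp
      finally show ?thesis by (simp add: Hs.sqn_def Re_l2_inner_self ac_simps)
    qed
    assume v: "v \<in> bergman_space s"
    have "restr p j z0 (\<lambda>x. u x + v x) = (\<lambda>h. restr p j z0 u h + restr p j z0 v h)" by (simp add: restr_def fun_eq_iff distrib_left)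
    then show "l (\<lambda>x. u x + v x) = l u + l v" unfolding l_eq using L2.ip_add[OF Rs[OF u] Rs[OF v] fs] by simp
  qed
  then obtain g where "g \<in> bergman_space s" "\<And>u. u \<in> bergman_space s \<Longrightarrow> l u = l2_inner ?B u g" by blast
  then have g: "is_restr_adj s Gt p j Ht z0 \<mu> f g" by (simp add: is_restr_adj_def restr_dom_eq l_def)
  then show "f \<in> restr_adj_dom s Gt p j Ht z0 \<mu>" using f by (auto simp: restr_adj_dom_def)
  have "g' = g" if g': "is_restr_adj s Gt p j Ht z0 \<mu> f g'" for g'
    using g g' unfolding is_restr_adj_def restr_dom_eq by (intro bergman_eqI[OF s]) auto
  then show "is_restr_adj s Gt p j Ht z0 \<mu> f (restr_adj s Gt p j Ht z0 \<mu> f)"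
    unfolding restr_adj_def using g by (intro theI[of "is_restr_adj s Gt p j Ht z0 \<mu> f" g])
qed

lemma restr_range_closure:
  assumes "u \<in> bergman_space s"
  shows "restr p j z0 u \<in> range_closure s Gt p j Ht z0 \<mu>"
proof -
  have "orbit_norm p Ht z0 \<mu> (\<lambda>h. restr p j z0 u h - restr p j z0 u h) = 0"
    by (simp add: orbit_norm_def descend_def)
  then show ?thesis unfolding range_closure_def restr_dom_eq using restr_L2[OF assms] assms
    by (auto intro!: bexI[of _ u])
qed

end

section \<open>Toeplitz operators\<close>

lemma square_integrable_symbol:
  fixes \<phi> f :: "complex ^ ('n::finite) \<Rightarrow> complex"
  assumes \<phi>: "essentially_bounded (bergman_measure s) \<phi>" and f: "square_integrable (bergman_measure s) f"
  shows "square_integrable (bergman_measure s) (\<lambda>z. \<phi> z * f z)"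
    and "square_integrable (bergman_measure s) (\<lambda>z. cnj (\<phi> z) * f z)"
proof -
  obtain C where C: "AE z in bergman_measure s. norm (\<phi> z) \<le> C" and [measurable]: "\<phi> \<in> borel_measurable (bergman_measure s)"
    using \<phi> by (auto simp: essentially_bounded_def)
  have [measurable]: "f \<in> borel_measurable (bergman_measure s)" by (rule square_integrableD(1)[OF f])
  have i: "integrable (bergman_measure s) (\<lambda>z. C\<^sup>2 * (norm (f z))\<^sup>2)" using square_integrableD(2)[OF f] by simp
  have "AE z in bergman_measure s. (norm (\<phi> z))\<^sup>2 * (norm (f z))\<^sup>2 \<le> C\<^sup>2 * (norm (f z))\<^sup>2"
    using C by eventually_elim (simp add: mult_right_mono power_mono)
  then show "square_integrable (bergman_measure s) (\<lambda>z. \<phi> z * f z)"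
    "square_integrable (bergman_measure s) (\<lambda>z. cnj (\<phi> z) * f z)"
    by (auto intro!: square_integrable_bound[OF i] simp: norm_mult power_mult_distrib)
qed

text \<open>The symbol is moved onto the kernel as its conjugate. Projecting that product puts it
  into the Bergman space, where the defining relation of the adjoint can be applied to it.\<close>

lemma toeplitz_value:
  fixes \<phi> g :: "complex ^ ('n::finite) \<Rightarrow> complex"
  assumes s: "real CARD('n) < s" and \<phi>: "essentially_bounded (bergman_measure s) \<phi>" and g: "g \<in> bergman_space s"
    and w: "w \<in> ball 0 1"
  shows "toeplitz s \<phi> g w = cnj (l2_inner (bergman_measure s) (bergman_proj s (\<lambda>z. cnj (\<phi> z) * kernel0 s w z)) g)"
proof -
  let ?B = "bergman_measure s :: (complex ^ 'n) measure"
  note pg = bergman_proj_props[OF s square_integrable_symbol(1)[OF \<phi> bergman_spaceD(2)[OF g]]]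
  note pk = bergman_proj_props[OF s square_integrable_symbol(2)[OF \<phi> square_integrable_kernel0[OF s w]]]
  have "toeplitz s \<phi> g w = l2_inner ?B (\<lambda>z. \<phi> z * g z) (kernel0 s w)"
    unfolding toeplitz_def bergman_reproducing_kernel0[OF s pg(1) w] pg(2)[OF kernel0_in_bergman[OF s w]] ..
  also have "\<dots> = cnj (l2_inner ?B (\<lambda>z. cnj (\<phi> z) * kernel0 s w z) g)"
    unfolding l2_inner_def by (subst Bochner_Integration.integral_cnj[symmetric]) (simp add: ac_simps)
  finally show ?thesis unfolding pk(2)[OF g] .
qed

text \<open>Evaluation at y is the inner product with the kernel there, and against an element of
  the Bergman space the projection may be dropped. What remains is the inner product occurring in
  \<open>nu\<close>.\<close>

lemma bergman_proj_kernel_value: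
  fixes \<phi> :: "complex ^ ('n::finite) \<Rightarrow> complex"
  assumes s: "real CARD('n) < s" and \<phi>: "essentially_bounded (bergman_measure s) \<phi>"
    and w: "w \<in> ball 0 1" and y: "y \<in> ball 0 1"
  shows "cnj (bergman_proj s (\<lambda>z. cnj (\<phi> z) * kernel0 s w z) y) =
    l2_inner (bergman_measure s) (\<lambda>z. \<phi> z * bergman_kernel s y z) (bergman_kernel s w)"
proof -
  let ?B = "bergman_measure s :: (complex ^ 'n) measure"
  have [measurable]: "\<phi> \<in> borel_measurable ?B" using \<phi> by (simp add: essentially_bounded_def)
  have [measurable]: "bergman_kernel s v \<in> borel_measurable ?B" "kernel0 s v \<in> borel_measurable ?B" for v
    by (auto intro!: borel_measurable_bergman)
  note pk = bergman_proj_props[OF s square_integrable_symbol(2)[OF \<phi> square_integrable_kernel0[OF s w]]]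
  have "cnj (bergman_proj s (\<lambda>z. cnj (\<phi> z) * kernel0 s w z) y) = cnj (l2_inner ?B (\<lambda>z. cnj (\<phi> z) * kernel0 s w z) (kernel0 s y))"
    unfolding bergman_reproducing_kernel0[OF s pk(1) y] pk(2)[OF kernel0_in_bergman[OF s y]] ..
  also have "\<dots> = (LINT z|?B. \<phi> z * kernel0 s y z * cnj (kernel0 s w z))"
    unfolding l2_inner_def by (subst Bochner_Integration.integral_cnj[symmetric]) (simp add: ac_simps)
  also have "\<dots> = (LINT z|?B. \<phi> z * bergman_kernel s y z * cnj (bergman_kernel s w z))"
  proof (rule integral_cong_AE)
    show "AE z in ?B. \<phi> z * kernel0 s y z * cnj (kernel0 s w z) = \<phi> z * bergman_kernel s y z * cnj (bergman_kernel s w z)"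
      using AE_bergman_ball[where 'n='n, OF s] by eventually_elim (simp add: kernel0_def)
  qed measurable
  finally show ?thesis by (simp add: l2_inner_def)
qed

context covering_cocycle
begin

text \<open>Substitute \<open>z \<mapsto> k \<cdot> z\<close> in the inner product and use the invariance of the symbol.\<close>
lemma nu_eq:
  assumes s: "real CARD('n) < s" and \<phi>: "essentially_bounded (bergman_measure s) \<phi>"
    and inv: "AE z in bergman_measure s. \<phi> (act (p k) z) = \<phi> z"
    and h: "h \<in> carrier Gt" and k: "k \<in> carrier Gt" and z0: "z0 \<in> ball 0 1"
  shows "nu s p j z0 \<phi> (inv\<^bsub>Gt\<^esub> k \<otimes>\<^bsub>Gt\<^esub> h) = j h z0 * cnj (j k z0) *
    l2_inner (bergman_measure s) (\<lambda>z. \<phi> z * bergman_kernel s (act (p k) z0) z) (bergman_kernel s (act (p h) z0))"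
proof -
  let ?B = "bergman_measure s :: (complex ^ 'n) measure"
  define r where "r = inv\<^bsub>Gt\<^esub> k \<otimes>\<^bsub>Gt\<^esub> h"
  have r: "r \<in> carrier Gt" unfolding r_def using h k by simp
  have kr: "k \<otimes>\<^bsub>Gt\<^esub> r = h" unfolding r_def using h k by (simp add: Gt.m_assoc[symmetric])
  define y where "y = act (p r) z0"
  have y: "y \<in> ball 0 1" unfolding y_def by (rule act_in_ball[OF r z0])
  have ky: "act (p h) z0 = act (p k) y" using act_mult[OF k r z0] by (simp add: kr y_def)
  have jh: "j h z0 = j k y * j r z0" using j_mult[OF k r z0] by (simp add: kr y_def)
  have [measurable]: "\<phi> \<in> borel_measurable ?B" using \<phi> by (simp add: essentially_bounded_def)
  have km [measurable]: "bergman_kernel s v \<in> borel_measurable ?B" for v by (auto intro!: borel_measurable_bergman)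
  define F where "F = (\<lambda>z. \<phi> z * bergman_kernel s (act (p k) z0) z * cnj (bergman_kernel s (act (p k) y) z))"
  have Fm [measurable]: "F \<in> borel_measurable ?B" unfolding F_def by measurable
  note [measurable] = tact_measurable[OF T_pu[OF k], of s s] borel_measurable_bergman[OF jac_borel[OF T_pu[OF k]], of s s]
  \<comment> \<open>The two constant factors are the ones that \<open>kernel_transform\<close>
    demands in addition to the Jacobian.\<close>
  have "(LINT z|?B. F z) * (cnj (j k z0) * j k y) = (LINT z|?B. jac s (T k) z *\<^sub>R F (tact (T k) z)) * (cnj (j k z0) * j k y)"
    unfolding integral_bergman_tact[OF T_pu[OF k] s Fm] ..
  also have "\<dots> = (LINT z|?B. (jac s (T k) z *\<^sub>R F (tact (T k) z)) * (cnj (j k z0) * j k y))"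
    by (rule integral_mult_left_zero[symmetric])
  also have "\<dots> = (LINT z|?B. \<phi> z * bergman_kernel s z0 z * cnj (bergman_kernel s y z))"
  proof (rule integral_cong_AE)
    show "AE z in ?B. (jac s (T k) z *\<^sub>R F (tact (T k) z)) * (cnj (j k z0) * j k y) = \<phi> z * bergman_kernel s z0 z * cnj (bergman_kernel s y z)"
      using AE_bergman_ball[where 'n='n, OF s] inv
    proof eventually_elim
      case (elim z)
      have t: "tact (T k) z = act (p k) z" using elim(1) by (simp add: tact_def act_eq_pact)
      \<comment> \<open>The Jacobian splits into j(k, z) and its conjugate, one for each of the two
        kernels.\<close>
      have J: "complex_of_real (jac s (T k) z) = j k z * cnj (j k z)"
        unfolding norm_j_sq[OF k elim(1), symmetric] by (rule complex_norm_square)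
      note K1 = kernel_transform[OF k elim(1) z0]
      have K2: "cnj (bergman_kernel s (act (p k) y) (act (p k) z)) * (cnj (j k z) * j k y) = cnj (bergman_kernel s y z)"
        unfolding kernel_transform[OF k elim(1) y, symmetric] by simp
      have "(jac s (T k) z *\<^sub>R F (tact (T k) z)) * (cnj (j k z0) * j k y) =
          \<phi> (act (p k) z) * (bergman_kernel s (act (p k) z0) (act (p k) z) * (j k z * cnj (j k z0))) *
          (cnj (bergman_kernel s (act (p k) y) (act (p k) z)) * (cnj (j k z) * j k y))"
        unfolding F_def t scaleR_conv_of_real J by (simp only: ac_simps)
      then show ?case unfolding K1 K2 elim(2) .
    qed
  qed measurable
  finally have "(LINT z|?B. \<phi> z * bergman_kernel s z0 z * cnj (bergman_kernel s y z)) = (LINT z|?B. F z) * (cnj (j k z0) * j k y)" ..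
  then show ?thesis
    unfolding nu_def l2_inner_def r_def[symmetric] y_def[symmetric] jh ky F_def by (simp add: ac_simps)
qed

end

theorem theorem5p1:
  fixes s :: real
    and H :: "(complex ^ ('n::finite) option ^ 'n option) set"
    and Gt :: "'g::topological_space monoid"
    and p :: "'g \<Rightarrow> complex ^ 'n option ^ 'n option"
    and j :: "'g \<Rightarrow> complex ^ 'n \<Rightarrow> complex"
    and Ht :: "'g set"
    and z\<^sub>0 :: "complex ^ 'n"
    and M :: "(complex ^ 'n) set"
    and \<mu> :: "(complex ^ 'n) measure"
    and \<phi> :: "complex ^ 'n \<Rightarrow> complex"
  assumes "s > real CARD('n)"
    and "subgroup H SU_n1" and "closedin (top_of_set (carrier SU_n1)) H"
    and "universal_covering_group SU_n1 Gt p"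
    and "Ht = {g \<in> carrier Gt. p g \<in> H}"
    and "is_cocycle s Gt p j"
    and "z\<^sub>0 \<in> ball 0 1"
    and "M = (\<lambda>h. act h z\<^sub>0) ` H"
    and "restriction_injective M"
    and "radon_measure_on M \<mu>" and "emeasure \<mu> M \<noteq> 0"
    and "\<forall>h\<in>Ht. distr \<mu> \<mu> (act (p h)) = \<mu>"
    and "(\<lambda>h. j h z\<^sub>0) \<in> L2_orbit Gt p j Ht z\<^sub>0 \<mu>"
    and "essentially_bounded (bergman_measure s) \<phi>"
    and "\<forall>h\<in>H. AE z in bergman_measure s. \<phi> (act (inv\<^bsub>SU_n1\<^esub> h) z) = \<phi> z"
  shows "\<forall>f \<in> L2_orbit Gt p j Ht z\<^sub>0 \<mu>.
    f \<in> restr_adj_dom s Gt p j Ht z\<^sub>0 \<mu> \<and>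
    toeplitz s \<phi> (restr_adj s Gt p j Ht z\<^sub>0 \<mu> f) \<in> restr_dom s Gt p j Ht z\<^sub>0 \<mu> \<and>
    restr p j z\<^sub>0 (toeplitz s \<phi> (restr_adj s Gt p j Ht z\<^sub>0 \<mu> f)) \<in> range_closure s Gt p j Ht z\<^sub>0 \<mu> \<and>
    (\<forall>h\<in>Ht.
       integrable \<mu> (descend p Ht z\<^sub>0 (\<lambda>k. f k * nu s p j z\<^sub>0 \<phi> (inv\<^bsub>Gt\<^esub> k \<otimes>\<^bsub>Gt\<^esub> h))) \<and>
       restr p j z\<^sub>0 (toeplitz s \<phi> (restr_adj s Gt p j Ht z\<^sub>0 \<mu> f)) h =
         (LINT m|\<mu>. descend p Ht z\<^sub>0 (\<lambda>k. f k * nu s p j z\<^sub>0 \<phi> (inv\<^bsub>Gt\<^esub> k \<otimes>\<^bsub>Gt\<^esub> h)) m))"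
proof -
  let ?B = "bergman_measure s :: (complex ^ 'n) measure"
  interpret orbit_setting s Gt p j H Ht z\<^sub>0 M \<mu>
  proof (intro orbit_setting.intro covering_cocycle.intro orbit_setting_axioms.intro)
    show "distr \<mu> \<mu> (act (p h)) = \<mu>" if "h \<in> Ht" for h using assms(12) that by blast
    show "space \<mu> = M" "sets \<mu> = sets (restrict_space borel M)"
      using assms(10) by (simp_all add: radon_measure_on_def)
  qed (fact assms)+
  have \<phi>: "essentially_bounded ?B \<phi>" by fact
  have \<phi>inv: "AE z in ?B. \<phi> (act (p k) z) = \<phi> z" if "k \<in> Ht" for k
  proof -
    \<comment> \<open>The invariance is stated for inverses, so it is applied to the inverse of
      k.\<close>
    have "p (inv\<^bsub>Gt\<^esub> k) \<in> H" using Ht_inv[OF that] by (simp add: Ht_eq)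
    then have "AE z in ?B. \<phi> (act (inv\<^bsub>SU_n1\<^esub> (p (inv\<^bsub>Gt\<^esub> k))) z) = \<phi> z" using assms(15) by blast
    then show ?thesis using Ht_carrier[OF that] by (simp add: p_inv)
  qed
  show ?thesis
  proof (intro ballI)
    fix f assume f: "f \<in> L2_orbit Gt p j Ht z\<^sub>0 \<mu>"
    have ef: "equivariant f" and fs: "square_integrable \<mu> (\<lambda>m. f (sec m))" using f by (auto simp: L2_orbit_iff)
    define g where "g = restr_adj s Gt p j Ht z\<^sub>0 \<mu> f"
    have g: "g \<in> bergman_space s" and adj: "\<And>u. u \<in> bergman_space s \<Longrightarrow> orbit_inner p Ht z\<^sub>0 \<mu> (restr p j z\<^sub>0 u) f = l2_inner ?B u g"
      using restr_adj_exists(1)[OF f] unfolding is_restr_adj_def restr_dom_eq g_def by auto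
    have Tg: "toeplitz s \<phi> g \<in> bergman_space s"
      unfolding toeplitz_def by (rule bergman_proj_props(1)[OF s square_integrable_symbol(1)[OF \<phi> bergman_spaceD(2)[OF g]]])
    have formula: "integrable \<mu> (descend p Ht z\<^sub>0 (\<lambda>k. f k * nu s p j z\<^sub>0 \<phi> (inv\<^bsub>Gt\<^esub> k \<otimes>\<^bsub>Gt\<^esub> h))) \<and>
       restr p j z\<^sub>0 (toeplitz s \<phi> g) h = (LINT m|\<mu>. descend p Ht z\<^sub>0 (\<lambda>k. f k * nu s p j z\<^sub>0 \<phi> (inv\<^bsub>Gt\<^esub> k \<otimes>\<^bsub>Gt\<^esub> h)) m)"
      if h: "h \<in> Ht" for h
    proof -
      define w where "w = act (p h) z\<^sub>0"
      have w: "w \<in> ball 0 1" unfolding w_def by (rule act_in_ball[OF Ht_carrier[OF h] z0])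
      \<comment> \<open>The function that represents evaluation of the Toeplitz operator at w. It
        depends on h through w, and pairing its restriction with f gives the convolution
        integral.\<close>
      define u where "u = bergman_proj s (\<lambda>z. cnj (\<phi> z) * kernel0 s w z)"
      have u: "u \<in> bergman_space s"
        unfolding u_def by (rule bergman_proj_props(1)[OF s square_integrable_symbol(2)[OF \<phi> square_integrable_kernel0[OF s w]]])
      have us: "square_integrable \<mu> (\<lambda>m. restr p j z\<^sub>0 u (sec m))" using restr_L2[OF u] by (simp add: L2_orbit_iff)
      define F where "F = (\<lambda>k. f k * nu s p j z\<^sub>0 \<phi> (inv\<^bsub>Gt\<^esub> k \<otimes>\<^bsub>Gt\<^esub> h))"
      \<comment> \<open>Holds at every k, not merely almost everywhere, since the exceptional set of
        the symbol has been integrated away. The right side also shows that F is invariant under the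
        stabilizer, because f and the restriction of u transform by the same unitary factor.\<close>
      have F: "F k = j h z\<^sub>0 * (f k * cnj (restr p j z\<^sub>0 u k))" if k: "k \<in> Ht" for k
      proof -
        have "cnj (u (act (p k) z\<^sub>0)) = l2_inner ?B (\<lambda>z. \<phi> z * bergman_kernel s (act (p k) z\<^sub>0) z) (bergman_kernel s w)"
          unfolding u_def by (rule bergman_proj_kernel_value[OF s \<phi> w act_in_ball[OF Ht_carrier[OF k] z0]])
        then show ?thesis
          unfolding F_def nu_eq[OF s \<phi> \<phi>inv[OF k] Ht_carrier[OF h] Ht_carrier[OF k] z0] w_def restr_def by simp
      qed
      have Fd: "descend p Ht z\<^sub>0 F m = j h z\<^sub>0 * (f (sec m) * cnj (restr p j z\<^sub>0 u (sec m)))" if m: "m \<in> M" for m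
      proof -
        have "descend p Ht z\<^sub>0 F m = F (sec m)"
        proof (rule descend_sec[OF _ m])
          fix a k assume a: "a \<in> Ht" and k: "k \<in> stab"
          have ak: "a \<otimes>\<^bsub>Gt\<^esub> k \<in> Ht" using a k by (intro Ht_mult) (auto simp: stabilizer_def)
          have "f (a \<otimes>\<^bsub>Gt\<^esub> k) * cnj (restr p j z\<^sub>0 u (a \<otimes>\<^bsub>Gt\<^esub> k)) = f a * cnj (restr p j z\<^sub>0 u a)"
            using ef equivariant_restr[of u] a k cnj_mult_stab[OF k] unfolding equivariant_def by simp
          then show "F (a \<otimes>\<^bsub>Gt\<^esub> k) = F a" unfolding F[OF ak] F[OF a] by simp
        qed
        then show ?thesis by (simp add: F sec_Ht m)
      qed
      have i: "integrable \<mu> (\<lambda>m. j h z\<^sub>0 * (f (sec m) * cnj (restr p j z\<^sub>0 u (sec m))))"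
        using square_integrable_product[OF fs us] by simp
      have "integrable \<mu> (descend p Ht z\<^sub>0 F)"
        using i by (rule Bochner_Integration.integrable_cong[OF refl, THEN iffD1, rotated]) (simp add: mu Fd)
      moreover have "restr p j z\<^sub>0 (toeplitz s \<phi> g) h = (LINT m|\<mu>. descend p Ht z\<^sub>0 F m)"
      proof -
        have "restr p j z\<^sub>0 (toeplitz s \<phi> g) h = j h z\<^sub>0 * cnj (l2_inner ?B u g)"
          unfolding restr_def w_def[symmetric] toeplitz_value[OF s \<phi> g w] u_def ..
        \<comment> \<open>The defining relation of the adjoint, transported to the orbit by the
          section.\<close>
        also have "l2_inner ?B u g = l2_inner \<mu> (\<lambda>m. restr p j z\<^sub>0 u (sec m)) (\<lambda>m. f (sec m))"
          unfolding adj[OF u, symmetric] by (rule orbit_inner_eq[OF equivariant_restr ef])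
        also have "j h z\<^sub>0 * cnj \<dots> = j h z\<^sub>0 * (LINT m|\<mu>. f (sec m) * cnj (restr p j z\<^sub>0 u (sec m)))"
          unfolding l2_inner_def by (subst Bochner_Integration.integral_cnj[symmetric]) (simp add: mult.commute)
        also have "\<dots> = (LINT m|\<mu>. j h z\<^sub>0 * (f (sec m) * cnj (restr p j z\<^sub>0 u (sec m))))"
          by (rule integral_mult_right_zero[symmetric])
        also have "\<dots> = (LINT m|\<mu>. descend p Ht z\<^sub>0 F m)"
          by (rule Bochner_Integration.integral_cong) (simp_all add: mu Fd)
        finally show ?thesis .
      qed
      ultimately show ?thesis unfolding F_def by simp
    qed
    show "f \<in> restr_adj_dom s Gt p j Ht z\<^sub>0 \<mu> \<and>
      toeplitz s \<phi> (restr_adj s Gt p j Ht z\<^sub>0 \<mu> f) \<in> restr_dom s Gt p j Ht z\<^sub>0 \<mu> \<and>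
      restr p j z\<^sub>0 (toeplitz s \<phi> (restr_adj s Gt p j Ht z\<^sub>0 \<mu> f)) \<in> range_closure s Gt p j Ht z\<^sub>0 \<mu> \<and>
      (\<forall>h\<in>Ht.
         integrable \<mu> (descend p Ht z\<^sub>0 (\<lambda>k. f k * nu s p j z\<^sub>0 \<phi> (inv\<^bsub>Gt\<^esub> k \<otimes>\<^bsub>Gt\<^esub> h))) \<and>
         restr p j z\<^sub>0 (toeplitz s \<phi> (restr_adj s Gt p j Ht z\<^sub>0 \<mu> f)) h =
           (LINT m|\<mu>. descend p Ht z\<^sub>0 (\<lambda>k. f k * nu s p j z\<^sub>0 \<phi> (inv\<^bsub>Gt\<^esub> k \<otimes>\<^bsub>Gt\<^esub> h)) m))"
      unfolding g_def[symmetric] restr_dom_eq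
      using restr_adj_exists(2)[OF f] Tg restr_range_closure[OF Tg] formula by blast
  qed
qed

end
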